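(* Let $R$ be a linear subspace of $\mathbb{C}^{2n}$ and let $P\in C([0,T],\mathfrak{gl}(n,\mathbb{C}))$ be a path of selfadjoint matrices. Define $\gamma(t)=\begin{pmatrix}I&0\\ P(t)&I\end{pmatrix}$ for all $t\in[0,T]$. Then $$i_{W(R)}(\gamma)=m^+(P(T)|_S)-m^+(P(0)|_S),$$ where $S=\{x\in\mathbb{C}^n;\ (x,x)\in R^b\}$, $m^+(P(t)|_S)$ denotes the Morse positive index (the maximal dimension of a subspace on which the form is positive definite) of the Hermitian form $x,y\mapsto(P(t)x,y)$ restricted to $S$, $R^b=\{(x,y)\in\mathbb{C}^{2n};(x,-y)\in R^\perp\}$, and $W(R)=\{(x,y,z,u)\in\mathbb{C}^{4n};(x,-z)\in R^{\perp},(y,u)\in R\}$.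
   Context: $(\cdot,\cdot)$ is the standard Hermitian inner product (also $(x,y)$ denotes the concatenated vector), $\perp$ the Hermitian orthogonal complement in $\mathbb{C}^{2n}$, $J=\begin{pmatrix}0&-I_n\\ I_n&0\end{pmatrix}$. Maslov index. Let $(X,\omega)$ be a finite-dimensional symplectic Hilbert space with $\omega(x,y)=(\mathcal{J}x,y)$, $\mathcal{J}^*=-\mathcal{J}$, $\mathcal{J}^2=-I$. Put $X_1=\ker(\mathcal{J}-\sqrt{-1}I)$, $X_2=\ker(\mathcal{J}+\sqrt{-1}I)$. Lagrange subspaces ($\Lambda=\Lambda^\omega$) are exactly the graphs $\mathrm{Gr}(U)$ of unitary isomorphisms $U:X_1\to X_2$. For continuous curves $\Lambda(s)=\mathrm{Gr}(U(s))$, $\Lambda'(s)=\mathrm{Gr}(U'(s))$, the Maslov index is $i(\Lambda,\Lambda')=-\mathrm{sf}_l\{U'(s)^{-1}U(s)\}$, where $\mathrm{sf}_l$ counts, with multiplicity, the eigenvalues $e^{\sqrt{-1}\theta}$ near $1$ crossing from $\theta<0$ to $\theta\ge0$ minus those crossing from $\theta\ge0$ to $\theta<0$. Maslov-type index. $\mathbb{C}^{2n}$ carries $\omega(x,y)=(Jx,y)$, and $\mathbb{C}^{4n}=\mathbb{C}^{2n}\oplus\mathbb{C}^{2n}$ carries $(-\omega)\oplus\omega$, for which $W(R)$ is a Lagrange subspace. For a continuous path $\gamma$ in $\mathrm{Sp}(2n,\mathbb{C})=\{M; M^*JM=J\}$ and a Lagrange subspace $W$ of $\mathbb{C}^{4n}$,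 $i_W(\gamma):=i(\mathrm{Gr}(\gamma(t)),W)$, with $\mathrm{Gr}(M)=\{(v,Mv)\}$. *)

theory Defs
  imports "HOL-Analysis.Analysis"
begin

section \<open>Hermitian linear algebra on \<open>\<complex>\<^sup>m\<close>\<close>

text \<open>
  Complex subspaces, spans and dimensions are those of the library locale interpretation
  \<open>vec\<close> (scalar multiplication \<open>*s\<close>); the unqualified \<open>subspace\<close>, \<open>dim\<close> and the
  class operation \<open>inner\<close> on \<open>complex ^ 'm\<close> are the underlying real ones.
\<close>

definition herm :: "complex ^ 'm \<Rightarrow> complex ^ 'm \<Rightarrow> complex" where
  "herm x y = (\<Sum>i\<in>UNIV. x $ i * cnj (y $ i))"

definition herm_compl :: "(complex ^ 'm) set \<Rightarrow> (complex ^ 'm) set" where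
  "herm_compl R = {x. \<forall>r\<in>R. herm x r = 0}"

definition conj_transpose :: "complex ^ 'm ^ 'k \<Rightarrow> complex ^ 'k ^ 'm" where
  "conj_transpose A = (\<chi> i j. cnj (A $ j $ i))"

definition selfadjoint :: "complex ^ 'm ^ 'm \<Rightarrow> bool" where
  "selfadjoint A \<longleftrightarrow> conj_transpose A = A"

definition vconcat :: "'a ^ 'k \<Rightarrow> 'a ^ 'm \<Rightarrow> 'a ^ ('k + 'm)" where
  "vconcat x y = (\<chi> i. case i of Inl k \<Rightarrow> x $ k | Inr m \<Rightarrow> y $ m)"

text \<open>\<open>block_mat A B C D\<close> has first block row \<open>A B\<close> and second block row \<open>C D\<close>.\<close>

definition block_mat ::
  "'a ^ 'k ^ 'k \<Rightarrow> 'a ^ 'm ^ 'k \<Rightarrow> 'a ^ 'k ^ 'm \<Rightarrow> 'a ^ 'm ^ 'm \<Rightarrow> 'a ^ ('k + 'm) ^ ('k + 'm)" where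
  "block_mat A B C D = (\<chi> i.
     case i of Inl k \<Rightarrow> vconcat (A $ k) (B $ k) | Inr m \<Rightarrow> vconcat (C $ m) (D $ m))"

text \<open>
  The forms considered below are Hermitian, so \<open>Q x x\<close> is real and positivity of its real
  part is positive definiteness.
\<close>

definition morse_pos_index ::
  "(complex ^ 'm \<Rightarrow> complex ^ 'm \<Rightarrow> complex) \<Rightarrow> (complex ^ 'm) set \<Rightarrow> nat" where
  "morse_pos_index Q S =
     Max {vec.dim V | V. vec.subspace V \<and> V \<subseteq> S \<and> (\<forall>x\<in>V. x \<noteq> 0 \<longrightarrow> 0 < Re (Q x x))}"


section \<open>Spectral flow through \<open>1\<close> of a path of unitary operators\<close>

definition eigenspace_on ::
  "(complex ^ 'm) set \<Rightarrow> (complex ^ 'm \<Rightarrow> complex ^ 'm) \<Rightarrow> complex \<Rightarrow> (complex ^ 'm) set" where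
  "eigenspace_on X V z = {x \<in> X. V x = z *s x}"

text \<open>
  Number of eigenvalues in \<open>A\<close> of an operator \<open>V\<close> on \<open>X\<close>, with multiplicity; for the
  unitary operators considered here geometric and algebraic multiplicities agree.
\<close>

definition eigenvalue_count ::
  "(complex ^ 'm) set \<Rightarrow> (complex ^ 'm \<Rightarrow> complex ^ 'm) \<Rightarrow> complex set \<Rightarrow> nat" where
  "eigenvalue_count X V A =
     (\<Sum>z \<in> {z \<in> A. eigenspace_on X V z \<noteq> {0}}. vec.dim (eigenspace_on X V z))"

text \<open>
  The interval is divided into pieces on each of which some \<open>cis \<epsilon>\<close>, \<open>0 < \<epsilon> < pi\<close>, is
  never an eigenvalue.  On such a piece eigenvalues can enter or leave the arc
  \<open>{cis \<theta> | 0 \<le> \<theta> < \<epsilon>}\<close> only through its end \<open>1\<close>, so the change of the number of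
  eigenvalues on the arc is the number of crossings from \<open>\<theta> < 0\<close> to \<open>\<theta> \<ge> 0\<close> minus the
  number of crossings from \<open>\<theta> \<ge> 0\<close> to \<open>\<theta> < 0\<close>.  For a continuous path of unitary
  operators such a subdivision exists, and the total does not depend on it.
\<close>

definition is_spectral_flow ::
  "(complex ^ 'm) set \<Rightarrow> (real \<Rightarrow> complex ^ 'm \<Rightarrow> complex ^ 'm) \<Rightarrow> real \<Rightarrow> real \<Rightarrow> int \<Rightarrow> bool" where
  "is_spectral_flow X V a b k \<longleftrightarrow>
     (\<exists>(N::nat) (s :: nat \<Rightarrow> real) (\<epsilon> :: nat \<Rightarrow> real).
        s 0 = a \<and> s N = b \<and>
        (\<forall>j<N. s j < s (Suc j) \<and> 0 < \<epsilon> j \<and> \<epsilon> j < pi \<and>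
               (\<forall>t\<in>{s j..s (Suc j)}. eigenspace_on X (V t) (cis (\<epsilon> j)) = {0})) \<and>
        k = (\<Sum>j<N. int (eigenvalue_count X (V (s (Suc j))) (cis ` {0..<\<epsilon> j}))
                  - int (eigenvalue_count X (V (s j)) (cis ` {0..<\<epsilon> j}))))"

definition spectral_flow ::
  "(complex ^ 'm) set \<Rightarrow> (real \<Rightarrow> complex ^ 'm \<Rightarrow> complex ^ 'm) \<Rightarrow> real \<Rightarrow> real \<Rightarrow> int" where
  "spectral_flow X V a b = (THE k. is_spectral_flow X V a b k)"


section \<open>Maslov index\<close>

text \<open>
  Throughout, a matrix \<open>K\<close> with \<open>K\<^sup>* = - K\<close> and \<open>K\<^sup>2 = - 1\<close> encodes the symplectic
  structure \<open>\<omega>(x, y) = (K x, y)\<close>.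
\<close>

definition pos_part :: "complex ^ 'm ^ 'm \<Rightarrow> (complex ^ 'm) set" where
  "pos_part K = {x. (K - mat \<i>) *v x = 0}"

definition neg_part :: "complex ^ 'm ^ 'm \<Rightarrow> (complex ^ 'm) set" where
  "neg_part K = {x. (K + mat \<i>) *v x = 0}"

definition unitary_iso ::
  "(complex ^ 'm) set \<Rightarrow> (complex ^ 'm) set \<Rightarrow> (complex ^ 'm \<Rightarrow> complex ^ 'm) \<Rightarrow> bool" where
  "unitary_iso X Y U \<longleftrightarrow>
     bij_betw U X Y \<and>
     (\<forall>x\<in>X. \<forall>y\<in>X. U (x + y) = U x + U y) \<and>
     (\<forall>c. \<forall>x\<in>X. U (c *s x) = c *s U x) \<and>
     (\<forall>x\<in>X. \<forall>y\<in>X. herm (U x) (U y) = herm x y)"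

text \<open>The graph of \<open>U : X \<rightarrow> Y\<close> inside the orthogonal direct sum of \<open>X\<close> and \<open>Y\<close>.\<close>

definition inner_graph ::
  "(complex ^ 'm) set \<Rightarrow> (complex ^ 'm \<Rightarrow> complex ^ 'm) \<Rightarrow> (complex ^ 'm) set" where
  "inner_graph X U = {x + U x | x. x \<in> X}"

text \<open>
  The unitary isomorphism whose graph is the Lagrange subspace \<open>L\<close>.  It is determined on
  \<open>pos_part K\<close>, and only its values there are used.
\<close>

definition lagrange_unitary ::
  "complex ^ 'm ^ 'm \<Rightarrow> (complex ^ 'm) set \<Rightarrow> complex ^ 'm \<Rightarrow> complex ^ 'm" where
  "lagrange_unitary K L =
     (SOME U. unitary_iso (pos_part K) (neg_part K) U \<and> L = inner_graph (pos_part K) U)"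

definition maslov_index ::
  "complex ^ 'm ^ 'm \<Rightarrow> (real \<Rightarrow> (complex ^ 'm) set) \<Rightarrow> (real \<Rightarrow> (complex ^ 'm) set)
     \<Rightarrow> real \<Rightarrow> real \<Rightarrow> int" where
  "maslov_index K L L' a b =
     - spectral_flow (pos_part K)
         (\<lambda>s x. inv_into (pos_part K) (lagrange_unitary K (L' s)) (lagrange_unitary K (L s) x)) a b"


section \<open>Maslov-type index\<close>

definition Jstd :: "complex ^ ('n::finite + 'n) ^ ('n + 'n)" where
  "Jstd = block_mat 0 (- mat 1) (mat 1) 0"

definition Jdiff :: "complex ^ (('n::finite + 'n) + ('n + 'n)) ^ (('n + 'n) + ('n + 'n))" where
  "Jdiff = block_mat (- Jstd) 0 0 Jstd"

lemma vconcat_nth [simp]: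
  "vconcat x y $ Inl k = x $ k"  "vconcat x y $ Inr m = y $ m"
  by (simp_all add: vconcat_def)

lemma herm_vconcat:
  "herm (vconcat x y) (vconcat z w) = herm x z + herm y w"
  by (simp add: herm_def UNIV_Plus_UNIV [symmetric] sum.Plus del: UNIV_Plus_UNIV)

lemma block_mat_vconcat:
  fixes A :: "complex ^ 'k ^ 'k" and D :: "complex ^ 'm ^ 'm"
  shows "block_mat A B C D *v vconcat x y = vconcat (A *v x + B *v y) (C *v x + D *v y)"
  by (auto simp add: vec_eq_iff block_mat_def matrix_vector_mult_def UNIV_Plus_UNIV [symmetric]
        sum.Plus vconcat_def simp del: UNIV_Plus_UNIV split: sum.splits)

text \<open>The form belonging to \<open>Jdiff\<close> is \<open>(- \<omega>) \<oplus> \<omega>\<close>.\<close>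

lemma herm_Jdiff:
  "herm (Jdiff *v vconcat x y) (vconcat z w) = - herm (Jstd *v x) z + herm (Jstd *v y) w"
proof -
  have "- Jstd *v x = - (Jstd *v x)"
    by (metis diff_0 matrix_vector_mult_0 matrix_vector_mult_diff_rdistrib)
  moreover have "herm (- u) z = - herm u z" for u
    by (simp add: herm_def sum_negf)
  ultimately show ?thesis
    by (simp add: Jdiff_def block_mat_vconcat herm_vconcat)
qed

definition mat_graph :: "complex ^ 'm ^ 'm \<Rightarrow> (complex ^ ('m + 'm)) set" where
  "mat_graph M = {vconcat v (M *v v) | v. True}"

definition maslov_type_index ::
  "(complex ^ (('n::finite + 'n) + ('n + 'n))) set \<Rightarrow> (real \<Rightarrow> complex ^ ('n + 'n) ^ ('n + 'n))
     \<Rightarrow> real \<Rightarrow> real \<Rightarrow> int" where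
  "maslov_type_index W \<gamma> a b = maslov_index Jdiff (\<lambda>t. mat_graph (\<gamma> t)) (\<lambda>t. W) a b"

definition Rb :: "(complex ^ ('n::finite + 'n)) set \<Rightarrow> (complex ^ ('n + 'n)) set" where
  "Rb R = {vconcat x y | x y. vconcat x (- y) \<in> herm_compl R}"

definition WR :: "(complex ^ ('n::finite + 'n)) set \<Rightarrow> (complex ^ (('n + 'n) + ('n + 'n))) set" where
  "WR R = {vconcat (vconcat x y) (vconcat z u) | x y z u.
             vconcat x (- z) \<in> herm_compl R \<and> vconcat y u \<in> R}"

end

theory Submission
  imports Defs
begin

text \<open>
  Let \<open>L\<^sub>t\<close> be the graph of \<open>\<gamma>(t)\<close>, \<open>W = W(R)\<close>, let \<open>W\<close> be the graph of the unitary map \<open>U'\<close>, and let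
  \<open>V\<^sub>t\<close> be the relative unitary operator \<open>U'\<^sup>-\<^sup>1 U\<^sub>t\<close>.  Suppose that \<open>cis \<epsilon>\<close>, with \<open>0 < \<epsilon> < pi\<close>, is not an
  eigenvalue of \<open>V\<^sub>t\<close> for \<open>t\<close> in some interval, and let \<open>N(t)\<close> be the number of eigenvalues on the arc
  from \<open>1\<close> to \<open>cis \<epsilon>\<close>.  The theorem follows, by telescoping over an arbitrary subdivision, once
  \<open>N(t) + m\<^sup>+(P(t)|S)\<close> is known to be constant on such an interval.

  To see this, both terms are read off from one Hermitian form.  The graph of
  \<open>cis \<epsilon> \<cdot> U'\<close> is a Lagrangian complement of \<open>W\<close>; write \<open>z = w + m\<close> for the corresponding splitting.
  In an eigenbasis of \<open>V\<^sub>t\<close> the form \<open>\<omega>(w, m)\<close> on \<open>L\<^sub>t\<close> is diagonal, with the sign of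
  \<open>cos (\<epsilon> / 2) - cos (\<theta> - \<epsilon> / 2)\<close> at an eigenvalue \<open>cis \<theta>\<close>; hence \<open>N(t)\<close> is the dimension of a maximal
  nonpositive subspace (\<open>eigenvalue_arc_split\<close>).  All \<open>L\<^sub>t\<close> lie in the space \<open>Y\<close> of vectors
  \<open>(x, y, x, u)\<close>, of dimension \<open>3 n\<close>.  On \<open>Y\<close> consider the form
  \<open>B\<^sub>t(z, z) = 2 Re \<omega>(w, m) + 2 Re (x, u - y) - 2 (P(t) x, x)\<close>.
  It is \<open>2 \<omega>(w, m)\<close> on \<open>L\<^sub>t\<close> (\<open>comparison_on_graph\<close>), it is \<open>- 2 (P(t) x, x)\<close> with \<open>x\<close> ranging over \<open>S\<close> on
  the intersection of \<open>Y\<close> and \<open>W\<close> (\<open>comparison_on_WR_WR\<close>), and these two subspaces are orthogonal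
  for it (\<open>comparison_graph_WR\<close>).  A count of dimensions gives
  \<open>N(t) + m\<^sup>+(P(t)|S) = n\<^sup>-(B\<^sub>t) + dim {y. (y, y) \<in> R}\<close>, where \<open>n\<^sup>-\<close> is the negative index
  (\<open>signature_identity\<close>).

  The null space of \<open>B\<^sub>t\<close> consists of the vectors of \<open>W\<close> with \<open>x = 0\<close> precisely when \<open>cis \<epsilon>\<close> is not an
  eigenvalue of \<open>V\<^sub>t\<close> (\<open>index_sum_eq_iff\<close>), so on the interval \<open>B\<^sub>t\<close> has constant rank.  It depends
  continuously on \<open>t\<close>, its positive and negative indices are lower semicontinuous, and their
  sum is constant; therefore both are constant.  The same argument shows that avoiding
  \<open>cis \<epsilon>\<close> is an open condition on \<open>t\<close>, which together with the finiteness of the spectrum provides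
  the subdivision on which the spectral flow is computed.
\<close>

section \<open>Dimensions of sums of subspaces\<close>

lemma dim_direct_sum:
  fixes E G :: "('a::field ^ 'm) set"
  assumes "vec.subspace E" "vec.subspace G" "E \<inter> G \<subseteq> {0}"
  shows "vec.dim {x + y |x y. x \<in> E \<and> y \<in> G} = vec.dim E + vec.dim G"
proof -
  obtain B where B: "B \<subseteq> E" "vec.independent B" "vec.span B = E" "card B = vec.dim E"
    using vec.basis_subspace_exists[OF assms(1)] by metis
  obtain C where C: "C \<subseteq> G" "vec.independent C" "vec.span C = G" "card C = vec.dim G"
    using vec.basis_subspace_exists[OF assms(2)] by metis
  have fin: "finite B" "finite C"
    using B C vec.finiteI_independent by auto
  have "vec.independent (F \<union> C)" if "finite F" "F \<subseteq> B" for F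
    using that
  proof (induction F rule: finite_induct)
    case empty
    then show ?case using C by simp
  next
    case (insert a F)
    have "a \<notin> vec.span (F \<union> C)"
    proof
      assume "a \<in> vec.span (F \<union> C)"
      then obtain f g where fg: "a = f + g" "f \<in> vec.span F" "g \<in> G"
        using C by (auto simp: vec.span_Un)
      have "f \<in> E"
        using fg(2) insert.prems B(3) vec.span_mono by blast
      moreover have "a \<in> E"
        using insert.prems B(1) by auto
      ultimately have "g \<in> E"
        using fg(1) vec.subspace_diff[OF assms(1)] by (metis add_diff_cancel_left')
      with fg assms(3) have "a \<in> vec.span F" by auto
      moreover have "F \<subseteq> B - {a}"
        using insert by auto
      ultimately have "a \<in> vec.span (B - {a})"
        using vec.span_mono by blast
      then show False
        using B(2) insert.prems vec.dependent_def by blast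
    qed
    then show ?case
      using insert by (simp add: vec.independent_insertI)
  qed
  then have ind: "vec.independent (B \<union> C)"
    using fin by blast
  have "B \<inter> C = {}"
    using assms(3) B C vec.dependent_zero by blast
  then have "card (B \<union> C) = vec.dim E + vec.dim G"
    using fin B C by (simp add: card_Un_disjoint)
  moreover have "vec.span (B \<union> C) = {x + y |x y. x \<in> E \<and> y \<in> G}"
    using B C by (simp add: vec.span_Un)
  ultimately show ?thesis
    using ind vec.dim_span_eq_card_independent by metis
qed

lemma subspace_complement_exists:
  fixes A S :: "('a::field ^ 'm) set"
  assumes "vec.subspace A" "vec.subspace S" "A \<subseteq> S"
  obtains C where "vec.subspace C" "C \<subseteq> S" "A \<inter> C = {0}" "vec.dim A + vec.dim C = vec.dim S"
    "S = {x + y |x y. x \<in> A \<and> y \<in> C}"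
proof -
  obtain B where B: "B \<subseteq> A" "vec.independent B" "vec.span B = A" "card B = vec.dim A"
    using vec.basis_subspace_exists[OF assms(1)] by metis
  obtain D where D: "B \<subseteq> D" "D \<subseteq> S" "vec.independent D" "S \<subseteq> vec.span D"
    using vec.maximal_independent_subset_extend[of B S] B assms by blast
  let ?C = "vec.span (D - B)"
  have "vec.subspace ?C" by simp
  moreover have CS: "?C \<subseteq> S"
    using D assms by (meson Diff_subset order_trans vec.span_minimal)
  moreover have int: "A \<inter> ?C = {0}"
  proof -
    have "x = 0" if x: "x \<in> vec.span B" "x \<in> ?C" for x
    proof -
      have "vec.representation D x b = 0" for b
      proof (cases "b \<in> B")
        case True
        have "vec.representation D x = vec.representation (D - B) x"
          using x D vec.representation_extend[of D x "D - B"] by auto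
        then show ?thesis
          using True vec.representation_ne_zero by (metis DiffD2)
      next
        case False
        have "vec.representation D x = vec.representation B x"
          using x D vec.representation_extend[of D x B] by auto
        then show ?thesis
          using False vec.representation_ne_zero by metis
      qed
      moreover have "x \<in> vec.span D"
        using x D vec.span_mono by blast
      ultimately show ?thesis
        using vec.sum_nonzero_representation_eq[of D x] D by (metis (mono_tags, lifting) Collect_empty_eq sum.empty)
    qed
    then show ?thesis
      using B vec.span_zero[of "D - B"] vec.subspace_0[OF assms(1)] by auto
  qed
  moreover have S: "S = {x + y |x y. x \<in> A \<and> y \<in> ?C}"
  proof -
    have "S = vec.span (B \<union> (D - B))"
      using D assms by (metis Un_Diff_cancel Un_absorb1 vec.span_subspace)
    then show ?thesis
      by (simp only: vec.span_Un B)
  qed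
  moreover have "vec.dim A + vec.dim ?C = vec.dim S"
    using dim_direct_sum[of A ?C] int S assms by (simp add: subset_eq)
  ultimately show ?thesis
    using that by blast
qed

lemma dim_sum_Int:
  fixes E G :: "('a::field ^ 'm) set"
  assumes "vec.subspace E" "vec.subspace G"
  shows "vec.dim {x + y |x y. x \<in> E \<and> y \<in> G} + vec.dim (E \<inter> G) = vec.dim E + vec.dim G"
proof -
  obtain C where C: "vec.subspace C" "C \<subseteq> E" "(E \<inter> G) \<inter> C = {0}"
    "vec.dim (E \<inter> G) + vec.dim C = vec.dim E" "E = {x + y |x y. x \<in> E \<inter> G \<and> y \<in> C}"
    by (rule subspace_complement_exists[OF vec.subspace_inter[OF assms] assms(1) inf_le1])
  have "{x + y |x y. x \<in> E \<and> y \<in> G} = {x + y |x y. x \<in> C \<and> y \<in> G}" (is "?L = ?R")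
  proof
    show "?L \<subseteq> ?R"
    proof
      fix z assume "z \<in> ?L"
      then obtain x y where z: "z = x + y" "x \<in> E" "y \<in> G" by blast
      obtain g c where "x = g + c" "g \<in> G" "c \<in> C"
        using C(5) z(2) by blast
      then have "z = c + (g + y)" "g + y \<in> G"
        using z vec.subspace_add[OF assms(2)] by auto
      then show "z \<in> ?R" using \<open>c \<in> C\<close> by blast
    qed
  qed (use C(2) in blast)
  moreover have "C \<inter> G \<subseteq> {0}" using C by blast
  ultimately show ?thesis
    using dim_direct_sum[of C G] C assms by simp
qed

lemma dim_add_le_of_subset:
  fixes E G S :: "('a::field ^ 'm) set"
  assumes "vec.subspace E" "vec.subspace G" "vec.subspace S" "E \<subseteq> S" "G \<subseteq> S"
  shows "vec.dim E + vec.dim G \<le> vec.dim S + vec.dim (E \<inter> G)"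
proof -
  have "{x + y |x y. x \<in> E \<and> y \<in> G} \<subseteq> S"
    using assms vec.subspace_add by blast
  then have "vec.dim {x + y |x y. x \<in> E \<and> y \<in> G} \<le> vec.dim S"
    by (rule vec.dim_subset)
  then show ?thesis
    using dim_sum_Int[OF assms(1,2)] by linarith
qed

section \<open>Hermitian forms and their positive index\<close>

definition herm_form :: "(complex ^ 'm \<Rightarrow> complex ^ 'm \<Rightarrow> complex) \<Rightarrow> bool" where
  "herm_form b \<longleftrightarrow> (\<forall>x y z. b (x + y) z = b x z + b y z) \<and> (\<forall>c x y. b (c *s x) y = c * b x y)
     \<and> (\<forall>x y. b y x = cnj (b x y))"

abbreviation pos_on :: "(complex ^ 'm \<Rightarrow> complex ^ 'm \<Rightarrow> complex) \<Rightarrow> (complex ^ 'm) set \<Rightarrow> bool" where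
  "pos_on b V \<equiv> \<forall>x\<in>V. x \<noteq> 0 \<longrightarrow> 0 < Re (b x x)"

abbreviation nonpos_on :: "(complex ^ 'm \<Rightarrow> complex ^ 'm \<Rightarrow> complex) \<Rightarrow> (complex ^ 'm) set \<Rightarrow> bool" where
  "nonpos_on b V \<equiv> \<forall>x\<in>V. Re (b x x) \<le> 0"

context
  fixes b :: "complex ^ 'm \<Rightarrow> complex ^ 'm \<Rightarrow> complex"
  assumes b: "herm_form b"
begin

lemma form_add_left: "b (x + y) z = b x z + b y z"
  and form_scale_left: "b (c *s x) y = c * b x y"
  and form_sym: "b y x = cnj (b x y)"
  using b unfolding herm_form_def by blast+

lemma form_add_right: "b z (x + y) = b z x + b z y"
  by (metis form_add_left form_sym complex_cnj_add)

lemma form_scale_right: "b x (c *s y) = cnj c * b x y"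
  by (metis form_scale_left form_sym complex_cnj_mult)

lemma form_zero_left: "b 0 y = 0"
  using form_scale_left[of 0] by simp

lemma form_zero_right: "b y 0 = 0"
  using form_scale_right[of _ 0] by simp

lemma form_diff_left: "b (x - y) z = b x z - b y z"
  by (metis add_diff_cancel_right' diff_add_cancel form_add_left)

lemma form_diff_right: "b z (x - y) = b z x - b z y"
  by (metis add_diff_cancel_right' diff_add_cancel form_add_right)

lemma form_sum_left: "b (\<Sum>i\<in>I. f i) y = (\<Sum>i\<in>I. b (f i) y)"
  by (induction I rule: infinite_finite_induct) (auto simp: form_zero_left form_add_left)

lemma form_sum_right: "b y (\<Sum>i\<in>I. f i) = (\<Sum>i\<in>I. b y (f i))"
  by (induction I rule: infinite_finite_induct) (auto simp: form_zero_right form_add_right)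

lemma form_eq_Re: "b x x = of_real (Re (b x x))"
  using form_sym[of x x] by (metis Reals_cnj_iff of_real_Re)

lemma herm_form_uminus: "herm_form (\<lambda>x y. - b x y)"
  unfolding herm_form_def
  by (auto simp: form_add_left form_scale_left intro: form_sym)

lemma subspace_orthogonal: "vec.subspace S \<Longrightarrow> vec.subspace {y \<in> S. \<forall>a\<in>A. b y a = 0}"
  by (auto simp: vec.subspace_def form_zero_left form_add_left form_scale_left)

text \<open>
  The Cauchy--Schwarz argument: if \<open>w = b x y\<close> were nonzero, the value of the form at
  \<open>- r \<cdot> cnj w \<cdot> x + y\<close> would be \<open>b y y - 2 r \<bar>w\<bar>\<^sup>2\<close>, which is negative for large \<open>r\<close>.
\<close>

lemma semidefinite_null_vector:
  assumes S: "vec.subspace S" and nonneg: "\<And>z. z \<in> S \<Longrightarrow> 0 \<le> Re (b z z)"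
    and x: "x \<in> S" "b x x = 0" and y: "y \<in> S"
  shows "b x y = 0"
proof (rule ccontr)
  define w where "w = b x y"
  assume "b x y \<noteq> 0"
  then have w: "0 < (cmod w)\<^sup>2" by (simp add: w_def)
  have *: "0 \<le> Re (b y y) - 2 * r * (cmod w)\<^sup>2" for r :: real
  proof -
    define s where "s = - of_real r * cnj w"
    have "b (s *s x + y) (s *s x + y) = b y y + s * w + cnj (s * w)"
      using x(2) form_sym[of y x] unfolding w_def
      by (simp add: form_add_left form_add_right form_scale_left form_scale_right)
    moreover have "s * w = - of_real (r * (cmod w)\<^sup>2)"
      unfolding s_def of_real_mult complex_norm_square by (simp add: mult_ac)
    ultimately have "Re (b (s *s x + y) (s *s x + y)) = Re (b y y) - 2 * r * (cmod w)\<^sup>2"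
      by simp
    moreover have "s *s x + y \<in> S"
      using S x y by (simp add: vec.subspace_add vec.subspace_scale)
    ultimately show ?thesis using nonneg by metis
  qed
  have "2 * ((Re (b y y) + 1) / (2 * (cmod w)\<^sup>2)) * (cmod w)\<^sup>2 = Re (b y y) + 1"
    using w by (simp add: field_simps)
  with *[of "(Re (b y y) + 1) / (2 * (cmod w)\<^sup>2)"] show False by linarith
qed

text \<open>
  Gram--Schmidt as an induction on dimension: a vector \<open>v\<close> of \<open>A\<close> is split off, and \<open>x\<close> is
  first projected to the part of \<open>A\<close> orthogonal to \<open>v\<close>.  Definiteness is required on \<open>A\<close>
  only, so that definite subspaces can be split off from indefinite forms.
\<close>

lemma definite_projection:
  assumes "vec.subspace A" "\<And>a. a \<in> A \<Longrightarrow> a \<noteq> 0 \<Longrightarrow> b a a \<noteq> 0"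
  shows "\<exists>a\<in>A. \<forall>a'\<in>A. b (x - a) a' = 0"
  using assms
proof (induction "vec.dim A" arbitrary: A rule: less_induct)
  case less
  show ?case
  proof (cases "A = {0}")
    case True
    then show ?thesis by (auto simp: form_zero_right)
  next
    case False
    then obtain v where v: "v \<in> A" "v \<noteq> 0"
      using less.prems vec.subspace_0 by blast
    then have bv: "b v v \<noteq> 0" using less.prems by blast
    let ?A = "{y \<in> A. \<forall>a\<in>{v}. b y a = 0}"
    have sub: "vec.subspace ?A"
      using less.prems subspace_orthogonal by blast
    have "vec.dim ?A < vec.dim A"
    proof (rule vec.dim_psubset)
      have "v \<notin> ?A" using bv by simp
      then have "?A \<subset> A" using v by blast
      then show "vec.span ?A \<subset> vec.span A"
        using sub less.prems by (simp only: vec.span_eq_iff[THEN iffD2])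
    qed
    from less.hyps[OF this sub] less.prems obtain a where a: "a \<in> ?A" "\<forall>a'\<in>?A. b (x - a) a' = 0"
      by blast
    define c where "c = b (x - a) v / b v v"
    have "a + c *s v \<in> A"
      using a v less.prems by (simp add: vec.subspace_add vec.subspace_scale)
    moreover have "b (x - (a + c *s v)) a' = 0" if "a' \<in> A" for a'
    proof -
      define k where "k = b a' v / b v v"
      have "b (a' - k *s v) v = 0"
        using bv by (simp add: form_diff_left form_scale_left k_def)
      moreover have "a' - k *s v \<in> A"
        using that v less.prems by (simp add: vec.subspace_diff vec.subspace_scale)
      ultimately have "a' - k *s v \<in> ?A" by simp
      with a have "b (x - a) (a' - k *s v) = 0" "b v (a' - k *s v) = 0"
        using form_sym[of "a' - k *s v" v] by auto
      moreover have "b (x - (a + c *s v)) v = 0"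
        using bv by (simp add: form_diff_left form_add_left form_scale_left c_def)
      moreover have "b (x - (a + c *s v)) a' =
          b (x - a) (a' - k *s v) - c * b v (a' - k *s v) + cnj k * b (x - (a + c *s v)) v"
        by (simp add: form_diff_left form_diff_right form_add_left form_scale_left form_scale_right
            algebra_simps)
      ultimately show ?thesis by simp
    qed
    ultimately show ?thesis by blast
  qed
qed

lemma definite_orthogonal_split:
  assumes "vec.subspace S" "vec.subspace A" "A \<subseteq> S" "\<And>a. a \<in> A \<Longrightarrow> a \<noteq> 0 \<Longrightarrow> b a a \<noteq> 0"
  shows "S = {x + y |x y. x \<in> A \<and> y \<in> {y \<in> S. \<forall>a\<in>A. b y a = 0}}"
    and "vec.dim A + vec.dim {y \<in> S. \<forall>a\<in>A. b y a = 0} = vec.dim S"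
proof -
  let ?C = "{y \<in> S. \<forall>a\<in>A. b y a = 0}"
  show eq: "S = {x + y |x y. x \<in> A \<and> y \<in> ?C}"
  proof
    show "S \<subseteq> {x + y |x y. x \<in> A \<and> y \<in> ?C}"
    proof
      fix x assume x: "x \<in> S"
      obtain a where a: "a \<in> A" "\<forall>a'\<in>A. b (x - a) a' = 0"
        using definite_projection assms by blast
      then have "x = a + (x - a)" "x - a \<in> ?C"
        using x assms(1,3) vec.subspace_diff[OF assms(1), of x a] by auto
      with a show "x \<in> {x + y |x y. x \<in> A \<and> y \<in> ?C}" by blast
    qed
  qed (use assms vec.subspace_add in blast)
  have "A \<inter> ?C \<subseteq> {0}" using assms(4) by blast
  with dim_direct_sum[of A ?C] eq assms subspace_orthogonal[of S A]
  show "vec.dim A + vec.dim ?C = vec.dim S" by simp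
qed

lemma
  assumes S: "vec.subspace S"
  shows morse_pos_index_ge: "vec.subspace V \<Longrightarrow> V \<subseteq> S \<Longrightarrow> pos_on b V \<Longrightarrow> vec.dim V \<le> morse_pos_index b S"
    and morse_pos_index_witness: "\<exists>V. vec.subspace V \<and> V \<subseteq> S \<and> pos_on b V \<and> vec.dim V = morse_pos_index b S"
proof -
  let ?D = "{vec.dim V | V. vec.subspace V \<and> V \<subseteq> S \<and> pos_on b V}"
  have "?D \<subseteq> {..vec.dim S}" using vec.dim_subset by blast
  then have fin: "finite ?D" using finite_subset by blast
  then show "vec.subspace V \<Longrightarrow> V \<subseteq> S \<Longrightarrow> pos_on b V \<Longrightarrow> vec.dim V \<le> morse_pos_index b S"
    unfolding morse_pos_index_def by (intro Max_ge) auto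
  have "vec.dim {0::complex^'m} \<in> ?D"
    using vec.subspace_0[OF S] by (intro CollectI exI[of _ "{0}"]) auto
  then have "Max ?D \<in> ?D" using fin Max_in by blast
  then show "\<exists>V. vec.subspace V \<and> V \<subseteq> S \<and> pos_on b V \<and> vec.dim V = morse_pos_index b S"
    unfolding morse_pos_index_def by fastforce
qed

text \<open>
  A vector orthogonal to \<open>A\<close> on which the form is positive could be added to \<open>A\<close>.
\<close>

lemma maximal_pos_orthogonal_nonpos:
  assumes S: "vec.subspace S" and A: "vec.subspace A" "A \<subseteq> S" "pos_on b A"
    and dim: "vec.dim A = morse_pos_index b S"
  shows "nonpos_on b {y \<in> S. \<forall>a\<in>A. b y a = 0}"
proof (rule ccontr)
  assume "\<not> ?thesis"
  then obtain y where y: "y \<in> S" "\<And>a. a \<in> A \<Longrightarrow> b y a = 0" "0 < Re (b y y)"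
    by force
  let ?V = "{a + k |a k. a \<in> A \<and> k \<in> vec.span {y}}"
  have "vec.subspace ?V" using A vec.subspace_sums by blast
  moreover have "?V \<subseteq> S"
    using A S y vec.subspace_add vec.span_minimal[of "{y}" S] by blast
  moreover have "pos_on b ?V"
  proof (intro ballI impI)
    fix z assume "z \<in> ?V" "z \<noteq> 0"
    then obtain a k where z: "a \<in> A" "z = a + k *s y"
      by (auto simp: vec.span_singleton)
    have "b a y = 0" using form_sym[of y a] y z by simp
    then have "b z z = b a a + (k * cnj k) * b y y"
      using y z by (simp add: form_add_left form_add_right form_scale_left form_scale_right)
    then have eq: "Re (b z z) = Re (b a a) + (cmod k)\<^sup>2 * Re (b y y)"
      by (simp flip: complex_norm_square of_real_power)
    show "0 < Re (b z z)"
    proof (cases "a = 0")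
      case True
      then have "k \<noteq> 0" using z \<open>z \<noteq> 0\<close> by auto
      then show ?thesis using eq True y by (simp add: form_zero_left)
    next
      case False
      then have "0 < Re (b a a)" using A z by blast
      then show ?thesis using eq y by (simp add: add_pos_nonneg)
    qed
  qed
  ultimately have "vec.dim ?V \<le> morse_pos_index b S"
    by (rule morse_pos_index_ge[OF S])
  moreover have "A \<inter> vec.span {y} \<subseteq> {0}"
  proof
    fix z assume z: "z \<in> A \<inter> vec.span {y}"
    then obtain k where k: "z = k *s y" by (auto simp: vec.span_singleton)
    have "b y z = 0" using y z by blast
    then have "k = 0"
      using y(3) unfolding k by (auto simp: form_scale_right)
    then show "z \<in> {0}" using k by simp
  qed
  then have "vec.dim ?V = vec.dim A + vec.dim {y}"
    using dim_direct_sum[of A "vec.span {y}"] A by simp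
  moreover have "y \<noteq> 0" using y by (auto simp: form_zero_left)
  ultimately show False using dim by simp
qed

lemma pos_nonpos_dim_le:
  assumes S: "vec.subspace S" and E: "vec.subspace E" "E \<subseteq> S" "pos_on b E"
    and G: "vec.subspace G" "G \<subseteq> S" "nonpos_on b G"
  shows "vec.dim E + vec.dim G \<le> vec.dim S"
proof -
  have "E \<inter> G \<subseteq> {0}"
    using E G by fastforce
  then have "vec.dim (E \<inter> G) = 0" by simp
  then show ?thesis
    using dim_add_le_of_subset[OF E(1) G(1) S E(2) G(2)] by linarith
qed

lemma morse_pos_index_add_nonpos_le:
  assumes S: "vec.subspace S" and G: "vec.subspace G" "G \<subseteq> S" "nonpos_on b G"
  shows "morse_pos_index b S + vec.dim G \<le> vec.dim S"
  using morse_pos_index_witness[OF S] pos_nonpos_dim_le[OF S _ _ _ G] by metis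

lemma nonpos_witness:
  assumes S: "vec.subspace S"
  shows "\<exists>G. vec.subspace G \<and> G \<subseteq> S \<and> nonpos_on b G \<and> morse_pos_index b S + vec.dim G = vec.dim S"
proof -
  obtain A where A: "vec.subspace A" "A \<subseteq> S" "pos_on b A" "vec.dim A = morse_pos_index b S"
    using morse_pos_index_witness[OF S] by blast
  let ?C = "{y \<in> S. \<forall>a\<in>A. b y a = 0}"
  have "nonpos_on b ?C" using maximal_pos_orthogonal_nonpos[OF S] A by blast
  moreover have "vec.dim A + vec.dim ?C = vec.dim S"
    using definite_orthogonal_split(2)[OF S A(1,2)] A(3) by fastforce
  ultimately show ?thesis using A subspace_orthogonal[OF S, of A] by (intro exI[of _ ?C]) auto
qed

end

text \<open>
  Sylvester's law of inertia.  A negative definite subspace together with the null space is a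
  nonpositive subspace, which bounds the sum from above.  For the other inequality, a maximal
  positive subspace \<open>A\<close> and then a maximal negative subspace \<open>A'\<close> are split off
  orthogonally; on what remains the form is both nonpositive and nonnegative, hence
  zero by Cauchy--Schwarz, so the remainder lies in the null space.
\<close>

lemma morse_index_sum:
  assumes b: "herm_form b" and S: "vec.subspace S"
  shows "morse_pos_index b S + morse_pos_index (\<lambda>x y. - b x y) S + vec.dim {z \<in> S. \<forall>z'\<in>S. b z z' = 0}
    = vec.dim S" (is "?p + ?r + vec.dim ?K = _")
proof (rule antisym)
  note b' = herm_form_uminus[OF b]
  have K: "vec.subspace ?K" using subspace_orthogonal[OF b S] .
  obtain E where E: "vec.subspace E" "E \<subseteq> S" "pos_on (\<lambda>x y. - b x y) E" "vec.dim E = ?r"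
    using morse_pos_index_witness[OF b' S] by blast
  let ?V = "{x + y |x y. x \<in> E \<and> y \<in> ?K}"
  have "E \<inter> ?K \<subseteq> {0}" using E by fastforce
  then have "vec.dim ?V = ?r + vec.dim ?K"
    using dim_direct_sum[OF E(1) K] E by simp
  moreover have "nonpos_on b ?V"
  proof
    fix z assume "z \<in> ?V"
    then obtain x y where z: "z = x + y" "x \<in> E" "y \<in> ?K" by blast
    then have "b y x = 0" "b y y = 0" "b x y = 0"
      using E form_sym[OF b, of y x] by auto
    then have "b z z = b x x" using z b by (simp add: form_add_left form_add_right)
    moreover have "Re (b x x) \<le> 0"
      using E z form_zero_left[OF b, of 0] by (cases "x = 0") force+
    ultimately show "Re (b z z) \<le> 0" by simp
  qed
  moreover have "?V \<subseteq> S" using E S vec.subspace_add by blast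
  moreover have "vec.subspace ?V" using E K vec.subspace_sums by blast
  ultimately show "?p + ?r + vec.dim ?K \<le> vec.dim S"
    using morse_pos_index_add_nonpos_le[OF b S, of ?V] by linarith
  obtain A where A: "vec.subspace A" "A \<subseteq> S" "pos_on b A" "vec.dim A = ?p"
    using morse_pos_index_witness[OF b S] by blast
  let ?C = "{y \<in> S. \<forall>a\<in>A. b y a = 0}"
  have C: "vec.subspace ?C" using subspace_orthogonal[OF b S] .
  have Cn: "nonpos_on b ?C" using maximal_pos_orthogonal_nonpos[OF b S] A by blast
  have A0: "b a a \<noteq> 0" if "a \<in> A" "a \<noteq> 0" for a using A that by fastforce
  obtain A' where A': "vec.subspace A'" "A' \<subseteq> ?C" "pos_on (\<lambda>x y. - b x y) A'"
      "vec.dim A' = morse_pos_index (\<lambda>x y. - b x y) ?C"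
    using morse_pos_index_witness[OF b' C] by blast
  let ?D = "{y \<in> ?C. \<forall>a\<in>A'. - b y a = 0}"
  have D: "vec.subspace ?D" using subspace_orthogonal[OF b' C] .
  have Dn: "nonpos_on (\<lambda>x y. - b x y) ?D" using maximal_pos_orthogonal_nonpos[OF b' C] A' by blast
  have A0': "- b a a \<noteq> 0" if "a \<in> A'" "a \<noteq> 0" for a using A' that by fastforce
  have "?D \<subseteq> ?K"
  proof
    fix x assume x: "x \<in> ?D"
    have "b x x = 0"
      using form_eq_Re[OF b, of x] Cn Dn x by fastforce
    then have xD: "b x y = 0" if "y \<in> ?D" for y
      using semidefinite_null_vector[OF b D _ x _ that] Dn by fastforce
    have "b x z = 0" if "z \<in> S" for z
    proof -
      obtain a c where z: "z = a + c" "a \<in> A" "c \<in> ?C"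
        using definite_orthogonal_split(1)[OF b S A(1,2) A0] \<open>z \<in> S\<close> by blast
      obtain a' d where c: "c = a' + d" "a' \<in> A'" "d \<in> ?D"
        using definite_orthogonal_split(1)[OF b' C A'(1,2) A0'] z(3) by blast
      show ?thesis
        using x z c xD[OF c(3)] by (simp add: form_add_right[OF b])
    qed
    then show "x \<in> ?K" using x by blast
  qed
  then have "vec.dim ?D \<le> vec.dim ?K" by (rule vec.dim_subset)
  moreover have "vec.dim A + vec.dim ?C = vec.dim S"
    using definite_orthogonal_split(2)[OF b S A(1,2) A0] .
  moreover have "vec.dim A' + vec.dim ?D = vec.dim ?C"
    using definite_orthogonal_split(2)[OF b' C A'(1,2) A0'] .
  moreover have "vec.dim A' \<le> ?r"
    using morse_pos_index_ge[OF b' S A'(1)] A' by blast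
  ultimately show "vec.dim S \<le> ?p + ?r + vec.dim ?K"
    using A(4) by linarith
qed

lemma scaleR_eq_scale_of_real: "r *\<^sub>R v = of_real r *s v" for v :: "complex ^ 'm"
  by (simp add: vec_eq_iff scaleR_conv_of_real[where 'a=complex])

lemma herm_form_bounded_bilinear:
  assumes b: "herm_form b"
  shows "bounded_bilinear b"
proof -
  have "bilinear b"
    unfolding bilinear_def
  proof (intro conjI allI linearI)
    fix r :: real and x y
    note s = scaleR_eq_scale_of_real
    show "b (r *\<^sub>R x) y = r *\<^sub>R b x y"
      unfolding s form_scale_left[OF b] by (rule scaleR_conv_of_real[symmetric])
    show "b x (r *\<^sub>R y) = r *\<^sub>R b x y"
      unfolding s form_scale_right[OF b] complex_cnj_complex_of_real
      by (rule scaleR_conv_of_real[symmetric])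
  qed (simp_all add: form_add_left[OF b] form_add_right[OF b])
  then show ?thesis by (simp add: bilinear_conv_bounded_bilinear)
qed

lemma vec_subspace_imp_subspace:
  fixes S :: "(complex ^ 'm) set"
  assumes "vec.subspace S"
  shows "subspace S"
  using assms by (auto simp: subspace_def vec.subspace_def scaleR_eq_scale_of_real)

text \<open>
  On a maximal positive subspace of \<open>b0\<close>, compactness of the unit sphere bounds \<open>b0 x x\<close> below
  by a multiple \<open>2 c\<close> of the squared norm; a form that differs by at most \<open>c\<close> is still
  positive there.
\<close>

lemma morse_pos_index_lower_semicontinuous:
  assumes b0: "herm_form b0" and S: "vec.subspace S"
  obtains c where "0 < c"
    and "\<And>b. herm_form b \<Longrightarrow> (\<And>x. \<bar>Re (b x x) - Re (b0 x x)\<bar> \<le> c * (norm x)\<^sup>2) \<Longrightarrow>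
      morse_pos_index b0 S \<le> morse_pos_index b S"
proof -
  obtain A where A: "vec.subspace A" "A \<subseteq> S" "pos_on b0 A" "vec.dim A = morse_pos_index b0 S"
    using morse_pos_index_witness[OF b0 S] by blast
  let ?K = "A \<inter> sphere 0 1"
  have "\<exists>c>0. \<forall>x\<in>?K. 2 * c \<le> Re (b0 x x)"
  proof (cases "?K = {}")
    case False
    have "compact ?K"
      by (simp add: A(1) closed_Int_compact closed_subspace vec_subspace_imp_subspace)
    moreover have "continuous_on ?K (\<lambda>x. Re (b0 x x))"
      by (intro continuous_on_Re bounded_bilinear.continuous_on[OF herm_form_bounded_bilinear[OF b0]]
          continuous_on_id)
    ultimately obtain x where x: "x \<in> ?K" "\<forall>y\<in>?K. Re (b0 x x) \<le> Re (b0 y y)"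
      using False continuous_attains_inf by blast
    then have "0 < Re (b0 x x)" using A(3) by fastforce
    then show ?thesis using x by (intro exI[of _ "Re (b0 x x) / 2"]) auto
  qed (auto intro: exI[of _ 1])
  then obtain c where c: "0 < c" "\<And>x. x \<in> ?K \<Longrightarrow> 2 * c \<le> Re (b0 x x)" by blast
  have low: "2 * c * (norm x)\<^sup>2 \<le> Re (b0 x x)" if "x \<in> A" "x \<noteq> 0" for x
  proof -
    interpret bounded_bilinear b0 by (rule herm_form_bounded_bilinear[OF b0])
    have "(1 / norm x) *\<^sub>R x \<in> ?K"
      using that subspace_scale[OF vec_subspace_imp_subspace[OF A(1)]] by auto
    from c(2)[OF this] have "2 * c \<le> (1 / norm x) * (1 / norm x) * Re (b0 x x)"
      by (simp add: scaleR_left scaleR_right)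
    then show ?thesis
      using that by (simp add: field_simps power2_eq_square)
  qed
  have "morse_pos_index b0 S \<le> morse_pos_index b S"
    if b: "herm_form b" "\<And>x. \<bar>Re (b x x) - Re (b0 x x)\<bar> \<le> c * (norm x)\<^sup>2" for b
  proof -
    have "pos_on b A"
    proof (intro ballI impI)
      fix x assume x: "x \<in> A" "x \<noteq> 0"
      have "0 < c * (norm x)\<^sup>2" using c x by simp
      then show "0 < Re (b x x)"
        using low[OF x] b(2)[of x] by linarith
    qed
    then show ?thesis using morse_pos_index_ge[OF b(1) S A(1,2)] A(4) by simp
  qed
  then show ?thesis using that c(1) by blast
qed

section \<open>Unitary operators\<close>

lemma herm_form_herm: "herm_form herm"
  unfolding herm_form_def herm_def
  by (simp add: sum.distrib sum_distrib_left algebra_simps)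

lemmas herm_add_left = form_add_left[OF herm_form_herm]
  and herm_add_right = form_add_right[OF herm_form_herm]
  and herm_scale_left = form_scale_left[OF herm_form_herm]
  and herm_scale_right = form_scale_right[OF herm_form_herm]
  and herm_diff_left = form_diff_left[OF herm_form_herm]
  and herm_diff_right = form_diff_right[OF herm_form_herm]
  and herm_zero_left = form_zero_left[OF herm_form_herm]
  and herm_zero_right = form_zero_right[OF herm_form_herm]
  and herm_sym = form_sym[OF herm_form_herm]

lemma herm_self: "herm x x = of_real ((norm x)\<^sup>2)"
  unfolding herm_def norm_vec_def L2_set_def
  by (simp add: sum_nonneg flip: complex_norm_square of_real_power)

lemma herm_self_eq_0 [simp]: "herm x x = 0 \<longleftrightarrow> x = 0"
  by (simp add: herm_self)

lemma dim_herm_compl: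
  fixes R :: "(complex ^ 'm) set"
  assumes "vec.subspace R"
  shows "vec.subspace (herm_compl R)" "vec.dim R + vec.dim (herm_compl R) = CARD('m)"
proof -
  have eq: "herm_compl R = {y \<in> UNIV. \<forall>a\<in>R. herm y a = 0}"
    by (auto simp: herm_compl_def)
  show "vec.subspace (herm_compl R)"
    unfolding eq by (rule subspace_orthogonal[OF herm_form_herm vec.subspace_UNIV])
  show "vec.dim R + vec.dim (herm_compl R) = CARD('m)"
    using definite_orthogonal_split(2)[OF herm_form_herm vec.subspace_UNIV assms]
    unfolding eq vec_dim_card by simp
qed

text \<open>
  Unitary operators are given on a subspace only.  A linear map of the whole space that agrees
  with them there is continuous and can be used inside a \<open>herm_form\<close>.
\<close>

lemma linear_on_subspace_extend:
  fixes f :: "'a::field ^ 'm \<Rightarrow> 'a ^ 'k"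
  assumes X: "vec.subspace X" and add: "\<And>x y. x \<in> X \<Longrightarrow> y \<in> X \<Longrightarrow> f (x + y) = f x + f y"
    and scale: "\<And>c x. x \<in> X \<Longrightarrow> f (c *s x) = c *s f x"
  obtains g where "Vector_Spaces.linear (*s) (*s) g" "\<And>x. x \<in> X \<Longrightarrow> g x = f x"
proof -
  obtain B where B: "B \<subseteq> X" "vec.independent B" "vec.span B = X"
    using vec.basis_subspace_exists[OF X] by metis
  obtain g where g: "Vector_Spaces.linear (*s) (*s) g" "\<forall>x\<in>B. g x = f x"
    using vec.linear_independent_extend[OF B(2)] by blast
  interpret g: Vector_Spaces.linear "(*s)" "(*s)" g by (rule g(1))
  have "x \<in> X \<and> g x = f x" if "x \<in> vec.span B" for x
    using that
  proof (induction rule: vec.span_induct_alt)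
    case base
    then show ?case using scale[of 0 0] vec.subspace_0[OF X] by (simp add: g.zero)
  next
    case (step c x y)
    then have "x \<in> X" using B by auto
    then show ?case
      using step g add scale X by (simp add: g.add g.scale vec.subspace_add vec.subspace_scale)
  qed
  then show ?thesis using that g B by blast
qed

lemma unitary_isoD:
  assumes "unitary_iso X Y U"
  shows "bij_betw U X Y" "x \<in> X \<Longrightarrow> U x \<in> Y" "U ` X = Y"
    "x \<in> X \<Longrightarrow> y \<in> X \<Longrightarrow> U (x + y) = U x + U y"
    "x \<in> X \<Longrightarrow> U (c *s x) = c *s U x"
    "x \<in> X \<Longrightarrow> y \<in> X \<Longrightarrow> herm (U x) (U y) = herm x y"
  using assms unfolding unitary_iso_def by (auto dest: bij_betwE bij_betw_imp_surj_on)

text \<open>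
  Let \<open>x\<close> maximise \<open>Re (V x, x)\<close> on the unit sphere of \<open>X\<close>, with maximum \<open>l\<close>.  Then \<open>x\<close> is a null
  vector of the semidefinite form \<open>l (x, y) - ((V x, y) + (x, V y)) / 2\<close>, which says that
  \<open>V (V x) - 2 l V x + x = 0\<close>.  This equation factors as \<open>(V - z) (V - z') x = 0\<close> with
  \<open>z + z' = 2 l\<close> and \<open>z z' = 1\<close>, so either \<open>x\<close> or \<open>(V - z') x\<close> is an eigenvector.
\<close>

lemma unitary_eigenvector_exists:
  fixes X :: "(complex ^ 'm) set"
  assumes X: "vec.subspace X" and V: "unitary_iso X X V" and nz: "X \<noteq> {0}"
  obtains v z where "v \<in> X" "v \<noteq> 0" "V v = z *s v"
proof -
  note VX = unitary_isoD[OF V]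
  obtain g where g: "Vector_Spaces.linear (*s) (*s) g" "\<And>x. x \<in> X \<Longrightarrow> g x = V x"
    using linear_on_subspace_extend[OF X, of V] VX by blast
  interpret g: Vector_Spaces.linear "(*s)" "(*s)" g by (rule g(1))
  let ?K = "X \<inter> sphere 0 1"
  define f where "f x = Re (herm (g x) x)" for x
  have herm_r: "herm (r *\<^sub>R x) (s *\<^sub>R y) = of_real (r * s) * herm x y" for r s and x y :: "complex ^ 'm"
    by (simp add: scaleR_eq_scale_of_real herm_scale_left herm_scale_right)
  have g_r: "g (r *\<^sub>R x) = r *\<^sub>R g x" for r x
    by (simp add: scaleR_eq_scale_of_real g.scale)
  have lin: "linear g" by (rule linearI) (simp_all add: g.add g_r)
  obtain x where x: "x \<in> ?K" "\<And>y. y \<in> ?K \<Longrightarrow> f y \<le> f x"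
  proof -
    have "compact ?K"
      by (simp add: X closed_Int_compact closed_subspace vec_subspace_imp_subspace)
    moreover have "continuous_on ?K f"
      unfolding f_def
      by (intro continuous_on_Re bounded_bilinear.continuous_on[OF herm_form_bounded_bilinear[OF herm_form_herm]]
          continuous_on_id linear_continuous_on linear_conv_bounded_linear[THEN iffD1] lin)
    moreover have "?K \<noteq> {}"
    proof -
      obtain y where y: "y \<in> X" "y \<noteq> 0" using nz vec.subspace_0[OF X] by blast
      then have "(1 / norm y) *\<^sub>R y \<in> ?K"
        using subspace_scale[OF vec_subspace_imp_subspace[OF X]] by auto
      then show ?thesis by blast
    qed
    ultimately show ?thesis using that continuous_attains_sup by metis
  qed
  define l where "l = f x"
  define k where "k x y = of_real l * herm x y - (herm (g x) y + herm x (g y)) / 2" for x y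
  have k: "herm_form k"
    unfolding herm_form_def
  proof (intro conjI allI)
    fix x y
    show "k y x = cnj (k x y)"
      using herm_sym[of y x] herm_sym[of y "g x"] herm_sym[of "g y" x] by (simp add: k_def)
  qed (simp_all add: k_def g.add g.scale herm_add_left herm_scale_left field_simps)
  have Re_k: "Re (k y y) = l * (norm y)\<^sup>2 - f y" for y
    using herm_sym[of y "g y"] by (simp add: k_def f_def herm_self)
  have "0 \<le> Re (k y y)" if "y \<in> X" for y
  proof (cases "y = 0")
    case False
    have "(1 / norm y) *\<^sub>R y \<in> ?K"
      using that False subspace_scale[OF vec_subspace_imp_subspace[OF X]] by auto
    then have "f ((1 / norm y) *\<^sub>R y) \<le> l" using x l_def by blast
    moreover have "f ((1 / norm y) *\<^sub>R y) = f y / (norm y)\<^sup>2"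
      by (simp add: f_def g_r herm_r power2_eq_square)
    ultimately show ?thesis
      using False by (simp add: Re_k field_simps)
  qed (simp add: form_zero_left[OF k])
  moreover have "k x x = 0"
    using form_eq_Re[OF k, of x] Re_k[of x] x(1) by (simp add: l_def)
  ultimately have kx: "k x y = 0" if "y \<in> X" for y
    using semidefinite_null_vector[OF k X, of x y] that x(1) by blast
  define u where "u = V (V x) - (2 * of_real l) *s V x + x"
  have xX: "x \<in> X" using x by blast
  have uX: "u \<in> X"
    unfolding u_def using xX VX X by (simp add: vec.subspace_add vec.subspace_diff vec.subspace_scale)
  then obtain y where y: "y \<in> X" "u = V y" using VX(3) by blast
  have "herm u (V y) = herm (V x) y - 2 * of_real l * herm x y + herm x (V y)"
    unfolding u_def using xX y VX
    by (simp add: herm_add_left herm_diff_left herm_scale_left)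
  also have "\<dots> = - 2 * k x y"
    using y xX by (simp add: k_def g)
  finally have "u = 0" using kx[OF y(1)] y by simp
  \<comment> \<open>the roots \<open>z\<close> and \<open>z'\<close> of \<open>X\<^sup>2 - 2 l X + 1\<close>\<close>
  define z where "z = of_real l + csqrt ((of_real l)\<^sup>2 - 1)"
  define z' where "z' = 2 * of_real l - z"
  have "(z - of_real l)\<^sup>2 = (of_real l)\<^sup>2 - 1" by (simp add: z_def)
  then have zz: "z * z' = 1" by (simp add: z'_def power2_eq_square algebra_simps)
  define v where "v = V x - z' *s x"
  have vX: "v \<in> X" unfolding v_def using xX VX X by (simp add: vec.subspace_diff vec.subspace_scale)
  have "x \<noteq> 0" using x by auto
  show ?thesis
  proof (cases "v = 0")
    case True
    then show ?thesis using that[of x z'] xX \<open>x \<noteq> 0\<close> by (simp add: v_def)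
  next
    case False
    have "V (v + z' *s x) = V v + z' *s V x"
      using vX xX VX X by (simp add: vec.subspace_scale)
    then have "V v = V (V x) - z' *s V x" by (simp add: v_def)
    also have "\<dots> = u + z *s v"
      using zz unfolding u_def v_def z'_def
      by (simp add: vec_eq_iff algebra_simps)
    finally show ?thesis using that[of v z] False vX \<open>u = 0\<close> by simp
  qed
qed

text \<open>
  The orthogonal complement of an eigenvector is invariant because \<open>V\<close> is unitary, so the basis
  is obtained by induction on the dimension.
\<close>

lemma unitary_eigenbasis_exists:
  fixes X :: "(complex ^ 'm) set"
  assumes "vec.subspace X" "unitary_iso X X V"
  obtains B l where "finite B" "B \<subseteq> X" "vec.independent B" "vec.span B = X"
    "\<And>v. v \<in> B \<Longrightarrow> V v = l v *s v" "\<And>v. v \<in> B \<Longrightarrow> cmod (l v) = 1"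
    "\<And>v w. v \<in> B \<Longrightarrow> w \<in> B \<Longrightarrow> v \<noteq> w \<Longrightarrow> herm v w = 0"
proof -
  have "\<exists>B l. finite B \<and> B \<subseteq> X \<and> vec.independent B \<and> vec.span B = X \<and>
      (\<forall>v\<in>B. V v = l v *s v \<and> cmod (l v) = 1) \<and> (\<forall>v\<in>B. \<forall>w\<in>B. v \<noteq> w \<longrightarrow> herm v w = 0)"
    using assms
  proof (induction "vec.dim X" arbitrary: X rule: less_induct)
    case less
    note X = less.prems(1) and VX = unitary_isoD[OF less.prems(2)]
    show ?case
    proof (cases "X = {0}")
      case True
      then show ?thesis by (intro exI[of _ "{}"]) (auto simp: vec.independent_empty)
    next
      case False
      then obtain v z where v: "v \<in> X" "v \<noteq> 0" "V v = z *s v"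
        using unitary_eigenvector_exists[OF less.prems] by blast
      have "herm v v = z * cnj z * herm v v"
        using VX(6)[OF v(1) v(1)] v(3) by (simp add: herm_scale_left herm_scale_right mult.commute)
      then have "z * cnj z = 1" using v(2) by (simp add: mult.commute)
      then have "(cmod z)\<^sup>2 = 1"
        by (metis complex_norm_square of_real_eq_1_iff)
      then have z: "cmod z = 1"
        by (smt (verit) norm_ge_zero power2_eq_1_iff)
      then have "z \<noteq> 0" by auto
      let ?Y = "{y \<in> X. \<forall>a\<in>vec.span {v}. herm y a = 0}"
      have Y: "vec.subspace ?Y" by (rule subspace_orthogonal[OF herm_form_herm X])
      have Y_iff: "y \<in> ?Y \<longleftrightarrow> y \<in> X \<and> herm y v = 0" for y
        by (auto simp: vec.span_singleton herm_scale_right dest: spec[of _ 1])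
      have sp: "vec.span {v} \<subseteq> X" using v X by (simp add: vec.span_minimal)
      have split: "X = {x + y |x y. x \<in> vec.span {v} \<and> y \<in> ?Y}"
        "vec.dim (vec.span {v}) + vec.dim ?Y = vec.dim X"
        using definite_orthogonal_split[OF herm_form_herm X vec.subspace_span sp] by simp_all
      then have lt: "vec.dim ?Y < vec.dim X" using v by simp
      have herm_V: "herm (V y) v = cnj (inverse z) * herm y v" if "y \<in> X" for y
      proof -
        have "herm (V y) (V v) = herm y v" using VX that v by blast
        then show ?thesis using v \<open>z \<noteq> 0\<close> by (simp add: herm_scale_right field_simps)
      qed
      have "V ` ?Y = ?Y"
      proof
        show "V ` ?Y \<subseteq> ?Y"
        proof
          fix w assume "w \<in> V ` ?Y"
          then obtain y where "y \<in> ?Y" "w = V y" by blast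
          then show "w \<in> ?Y"
            unfolding Y_iff using herm_V[of y] VX(2)[of y] by simp
        qed
        show "?Y \<subseteq> V ` ?Y"
        proof
          fix y assume y: "y \<in> ?Y"
          then obtain y' where y': "y' \<in> X" "y = V y'" using VX(3) Y_iff by blast
          then have "herm y' v = 0"
            using herm_V[of y'] y \<open>z \<noteq> 0\<close> Y_iff by simp
          then show "y \<in> V ` ?Y" using y' Y_iff by blast
        qed
      qed
      then have "bij_betw V ?Y ?Y"
        using VX(1) by (auto simp: bij_betw_def inj_on_def)
      then have "unitary_iso ?Y ?Y V"
        using VX unfolding unitary_iso_def by auto
      from less.hyps[OF lt Y this] obtain B l where B: "finite B" "B \<subseteq> ?Y" "vec.independent B"
        "vec.span B = ?Y" "\<forall>w\<in>B. V w = l w *s w \<and> cmod (l w) = 1"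
        "\<forall>w\<in>B. \<forall>w'\<in>B. w \<noteq> w' \<longrightarrow> herm w w' = 0" by blast
      have vY: "v \<notin> ?Y" using v(2) Y_iff herm_self_eq_0 by blast
      have orth: "herm v w = 0" "herm w v = 0" if "w \<in> B" for w
        using B(2) that Y_iff herm_sym[of w v] by auto
      show ?thesis
      proof (intro exI[of _ "insert v B"] exI[of _ "l(v := z)"] conjI)
        show "vec.independent (insert v B)"
          using vec.independent_insertI B vY by metis
        show "vec.span (insert v B) = X"
        proof -
          have "vec.span ({v} \<union> B) = {x + y |x y. x \<in> vec.span {v} \<and> y \<in> ?Y}"
            by (simp only: vec.span_Un B(4))
          then show ?thesis using split(1) by simp
        qed
        show "\<forall>w\<in>insert v B. V w = (l(v := z)) w *s w \<and> cmod ((l(v := z)) w) = 1"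
          using B vY v z by auto
        show "\<forall>w\<in>insert v B. \<forall>w'\<in>insert v B. w \<noteq> w' \<longrightarrow> herm w w' = 0"
          using B orth by auto
      qed (use B v in auto)
    qed
  qed
  then show ?thesis using that by blast
qed

lemma sum_scale_in_span: "B' \<subseteq> B \<Longrightarrow> (\<Sum>v\<in>B'. c v *s v) \<in> vec.span B'"
  by (intro vec.span_sum vec.span_scale vec.span_base)

context
  fixes X :: "(complex ^ 'm) set" and V and B and l :: "complex ^ 'm \<Rightarrow> complex"
  assumes X: "vec.subspace X" and V: "unitary_iso X X V"
    and B: "finite B" "B \<subseteq> X" "vec.independent B" "vec.span B = X"
    and ev: "\<And>v. v \<in> B \<Longrightarrow> V v = l v *s v"
    and orth: "\<And>v w. v \<in> B \<Longrightarrow> w \<in> B \<Longrightarrow> v \<noteq> w \<Longrightarrow> herm v w = 0"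
begin

lemma unitary_expand:
  assumes "B' \<subseteq> B"
  shows "V (\<Sum>v\<in>B'. c v *s v) = (\<Sum>v\<in>B'. (c v * l v) *s v)"
proof -
  have "finite B'" using assms B finite_subset by blast
  then show ?thesis using assms
  proof (induction B' rule: finite_induct)
    case empty
    then show ?case using unitary_isoD(5)[OF V vec.subspace_0[OF X], of 0] by simp
  next
    case (insert a F)
    have "(\<Sum>v\<in>F. c v *s v) \<in> X"
      using insert.prems B X by (intro vec.subspace_sum vec.subspace_scale) auto
    moreover have "a \<in> X" "c a *s a \<in> X" using insert.prems B X by (auto intro: vec.subspace_scale)
    ultimately show ?case
      using insert unitary_isoD(4,5)[OF V] ev by simp
  qed
qed

lemma eigenspace_eq_span: "eigenspace_on X V z = vec.span {v \<in> B. l v = z}"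
proof
  let ?B = "{v \<in> B. l v = z}"
  show "vec.span ?B \<subseteq> eigenspace_on X V z"
  proof
    fix x assume "x \<in> vec.span ?B"
    moreover have "finite ?B" using B by simp
    ultimately obtain c where c: "x = (\<Sum>v\<in>?B. c v *s v)"
      by (auto simp: vec.span_finite)
    have "V x = (\<Sum>v\<in>?B. (c v * l v) *s v)" unfolding c by (rule unitary_expand) auto
    also have "\<dots> = z *s x" unfolding c vec.scale_sum_right by (rule sum.cong) (auto simp: mult.commute)
    finally show "x \<in> eigenspace_on X V z"
      using c B X unfolding eigenspace_on_def
      by (auto intro!: vec.subspace_sum vec.subspace_scale)
  qed
  show "eigenspace_on X V z \<subseteq> vec.span ?B"
  proof
    fix x assume x: "x \<in> eigenspace_on X V z"
    then obtain c where c: "x = (\<Sum>v\<in>B. c v *s v)"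
      using B by (auto simp: eigenspace_on_def vec.span_finite)
    have "(\<Sum>v\<in>B. (c v * l v) *s v) = z *s (\<Sum>v\<in>B. c v *s v)"
      using x unitary_expand[of B c] c by (simp add: eigenspace_on_def)
    then have "(\<Sum>v\<in>B. (c v * l v - z * c v) *s v) = 0"
      by (simp add: vec.scale_sum_right vec.scale_left_diff_distrib sum_subtractf)
    then have "c v * l v - z * c v = 0" if "v \<in> B" for v
      using vec.independentD[OF B(3) B(1) subset_refl, of "\<lambda>v. c v * l v - z * c v"] that by blast
    then have "c v = 0" if "v \<in> B" "l v \<noteq> z" for v
      using that by (metis eq_iff_diff_eq_0 mult.commute mult_left_cancel)
    then have "x = (\<Sum>v\<in>?B. c v *s v)"
      unfolding c using B(1) by (intro sum.mono_neutral_right) auto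
    then show "x \<in> vec.span ?B"
      using sum_scale_in_span by blast
  qed
qed

lemma eigenspace_nontrivial_iff: "eigenspace_on X V z \<noteq> {0} \<longleftrightarrow> z \<in> l ` B"
proof -
  have "0 \<notin> B" using B(3) vec.dependent_zero by blast
  then have "vec.span {v \<in> B. l v = z} = {0} \<longleftrightarrow> {v \<in> B. l v = z} = {}"
    using vec.span_superset[of "{v \<in> B. l v = z}"] vec.span_empty by (metis (no_types, lifting)
        mem_Collect_eq subset_singletonD singletonI)
  then show ?thesis unfolding eigenspace_eq_span by auto
qed

lemma eigenvalue_count_eq_card: "eigenvalue_count X V A = card {v \<in> B. l v \<in> A}"
proof -
  have "vec.dim (eigenspace_on X V z) = card {v \<in> B. l v = z}" for z
    unfolding eigenspace_eq_span
    by (rule vec.dim_span_eq_card_independent, rule vec.independent_mono[OF B(3)]) blast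
  moreover have "{z \<in> A. eigenspace_on X V z \<noteq> {0}} = l ` {v \<in> B. l v \<in> A}"
    unfolding eigenspace_nontrivial_iff by auto
  ultimately have "eigenvalue_count X V A = (\<Sum>z\<in>l ` {v \<in> B. l v \<in> A}. card {v \<in> B. l v = z})"
    by (simp add: eigenvalue_count_def)
  also have "\<dots> = (\<Sum>z\<in>l ` {v \<in> B. l v \<in> A}. \<Sum>v\<in>{v \<in> {v \<in> B. l v \<in> A}. l v = z}. 1)"
    by (rule sum.cong) (auto intro!: arg_cong[of _ _ card])
  also have "\<dots> = card {v \<in> B. l v \<in> A}"
    using sum.image_gen[of "{v \<in> B. l v \<in> A}" "\<lambda>_. 1::nat" l] B(1) by simp
  finally show ?thesis .
qed

text \<open>
  In coordinates with respect to the eigenbasis, every first order polynomial in \<open>V\<close> acts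
  diagonally.  The weights are \<open>\<bar>c v\<bar>\<^sup>2 \<cdot> \<bar>v\<bar>\<^sup>2\<close> with \<open>c\<close> the coordinates of \<open>x\<close>; they are the same for
  all pairs of polynomials.
\<close>

lemma herm_expand:
  assumes B': "B' \<subseteq> B" and x: "x \<in> vec.span B'"
  obtains w where "\<forall>v\<in>B'. 0 \<le> w v" "x \<noteq> 0 \<longrightarrow> (\<exists>v\<in>B'. 0 < w v)"
    "\<forall>a b a' b'. herm (a *s x + b *s V x) (a' *s x + b' *s V x)
       = (\<Sum>v\<in>B'. of_real (w v) * ((a + b * l v) * cnj (a' + b' * l v)))"
proof -
  have fin: "finite B'" using B' B finite_subset by blast
  then obtain c where c: "x = (\<Sum>v\<in>B'. c v *s v)"
    using x by (auto simp: vec.span_finite)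
  define w where "w v = (cmod (c v))\<^sup>2 * (norm v)\<^sup>2" for v
  have e: "a *s x + b *s V x = (\<Sum>v\<in>B'. (c v * (a + b * l v)) *s v)" for a b
    unfolding c unitary_expand[OF B'] vec.scale_sum_right sum.distrib[symmetric]
    by (rule sum.cong) (simp_all add: vec_eq_iff algebra_simps)
  have h: "herm (a *s x + b *s V x) (a' *s x + b' *s V x)
       = (\<Sum>v\<in>B'. of_real (w v) * ((a + b * l v) * cnj (a' + b' * l v)))" for a b a' b'
  proof -
    have "herm (a *s x + b *s V x) (a' *s x + b' *s V x)
      = (\<Sum>v\<in>B'. \<Sum>u\<in>B'. herm ((c v * (a + b * l v)) *s v) ((c u * (a' + b' * l u)) *s u))"
      unfolding e form_sum_left[OF herm_form_herm]
      unfolding form_sum_right[OF herm_form_herm] ..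
    also have "\<dots> = (\<Sum>v\<in>B'. \<Sum>u\<in>B'. if u = v then of_real (w v) * ((a + b * l v) * cnj (a' + b' * l v)) else 0)"
    proof (intro sum.cong refl)
      fix v u assume vu: "v \<in> B'" "u \<in> B'"
      show "herm ((c v * (a + b * l v)) *s v) ((c u * (a' + b' * l u)) *s u) =
        (if u = v then of_real (w v) * ((a + b * l v) * cnj (a' + b' * l v)) else 0)"
        using vu B' orth[of v u]
        by (auto simp: herm_scale_left herm_scale_right herm_self w_def complex_norm_square mult_ac
            simp del: of_real_power simp flip: of_real_power)
    qed
    also have "\<dots> = (\<Sum>v\<in>B'. of_real (w v) * ((a + b * l v) * cnj (a' + b' * l v)))"
      using fin by simp
    finally show ?thesis .
  qed
  have "\<exists>v\<in>B'. 0 < w v" if "x \<noteq> 0"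
  proof (rule ccontr)
    assume "\<not> ?thesis"
    then have "w v = 0" if "v \<in> B'" for v
      using that by (metis antisym_conv2 linorder_not_less mult_nonneg_nonneg w_def zero_le_power2)
    moreover have "v \<noteq> 0" if "v \<in> B'" for v
      using that B' B(3) vec.dependent_zero by blast
    ultimately have "c v = 0" if "v \<in> B'" for v using that by (auto simp: w_def)
    then have "x = 0" by (simp add: c)
    then show False using that by simp
  qed
  then show ?thesis using that[of w] h by (simp add: w_def)
qed

end

lemma finite_eigenvalues:
  assumes "vec.subspace X" "unitary_iso X X V"
  shows "finite {z. eigenspace_on X V z \<noteq> {0}}"
proof -
  obtain B l where B: "finite B" "B \<subseteq> X" "vec.independent B" "vec.span B = X"
    "\<And>v. v \<in> B \<Longrightarrow> V v = l v *s v" "\<And>v. v \<in> B \<Longrightarrow> cmod (l v) = 1"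
    "\<And>v w. v \<in> B \<Longrightarrow> w \<in> B \<Longrightarrow> v \<noteq> w \<Longrightarrow> herm v w = 0"
    using unitary_eigenbasis_exists[OF assms] by metis
  have "{z. eigenspace_on X V z \<noteq> {0}} = l ` B"
    using eigenspace_nontrivial_iff[OF assms B(1-5,7)] by blast
  then show ?thesis using B by simp
qed

text \<open>
  The Hermitian form \<open>m \<cdot> ((a + b V) x, (a' + b' V) x)\<close> is diagonal in an eigenbasis of \<open>V\<close>, and
  its value on an eigenvector is decided by the eigenvalue.  If it is nonpositive for eigenvalues
  in \<open>A\<close> and positive for the others, then counting eigenvalues in \<open>A\<close> is the same as
  computing the dimension of a maximal nonpositive subspace.
\<close>

lemma unitary_sign_split:
  assumes X: "vec.subspace X" and V: "unitary_iso X X V"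
    and nonpos: "\<And>z. cmod z = 1 \<Longrightarrow> z \<in> A \<Longrightarrow> Re (m * ((a + b * z) * cnj (a' + b' * z))) \<le> 0"
    and pos: "\<And>z. cmod z = 1 \<Longrightarrow> z \<notin> A \<Longrightarrow> eigenspace_on X V z \<noteq> {0} \<Longrightarrow>
      0 < Re (m * ((a + b * z) * cnj (a' + b' * z)))"
  obtains E F where "vec.subspace E" "vec.subspace F" "E \<subseteq> X" "F \<subseteq> X"
    "vec.dim E = eigenvalue_count X V A" "vec.dim E + vec.dim F = vec.dim X"
    "\<forall>x\<in>E. Re (m * herm (a *s x + b *s V x) (a' *s x + b' *s V x)) \<le> 0"
    "\<forall>x\<in>F. x \<noteq> 0 \<longrightarrow> 0 < Re (m * herm (a *s x + b *s V x) (a' *s x + b' *s V x))"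
proof -
  obtain B l where B: "finite B" "B \<subseteq> X" "vec.independent B" "vec.span B = X"
    "\<And>v. v \<in> B \<Longrightarrow> V v = l v *s v" and unit: "\<And>v. v \<in> B \<Longrightarrow> cmod (l v) = 1"
    and orth: "\<And>v w. v \<in> B \<Longrightarrow> w \<in> B \<Longrightarrow> v \<noteq> w \<Longrightarrow> herm v w = 0"
    using unitary_eigenbasis_exists[OF X V] by metis
  note ctx = X V B orth
  let ?P = "{v \<in> B. l v \<in> A}" and ?N = "{v \<in> B. l v \<notin> A}"
  have ind: "vec.independent ?P" "vec.independent ?N"
    by (rule vec.independent_mono[OF B(3)], blast)+
  have fin: "finite ?P" "finite ?N" using B(1) by auto
  have expand: "Re (m * (\<Sum>v\<in>B'. of_real (w v) * ((a + b * l v) * cnj (a' + b' * l v))))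
      = (\<Sum>v\<in>B'. w v * Re (m * ((a + b * l v) * cnj (a' + b' * l v))))" for B' w
  proof -
    have "Re (m * (of_real r * y)) = r * Re (m * y)" for r y
      by (simp add: algebra_simps)
    then show ?thesis by (simp only: sum_distrib_left Re_sum)
  qed
  show ?thesis
  proof (rule that[of "vec.span ?P" "vec.span ?N"])
    show "vec.span ?P \<subseteq> X" "vec.span ?N \<subseteq> X"
      using B(2) by (intro vec.span_minimal X; blast)+
    show "vec.dim (vec.span ?P) = eigenvalue_count X V A"
      using vec.dim_span_eq_card_independent[OF ind(1)] eigenvalue_count_eq_card[OF ctx, of A] by simp
    have "card B = card (?P \<union> ?N)" by (rule arg_cong[of _ _ card]) auto
    also have "\<dots> = card ?P + card ?N" by (rule card_Un_disjoint) (use fin in auto)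
    finally show "vec.dim (vec.span ?P) + vec.dim (vec.span ?N) = vec.dim X"
      using vec.dim_span_eq_card_independent[OF ind(1)] vec.dim_span_eq_card_independent[OF ind(2)]
        vec.dim_span_eq_card_independent[OF B(3)] B(4) by simp
    show "\<forall>x\<in>vec.span ?P. Re (m * herm (a *s x + b *s V x) (a' *s x + b' *s V x)) \<le> 0"
    proof
      fix x assume x: "x \<in> vec.span ?P"
      have sub: "?P \<subseteq> B" by blast
      obtain w where w: "\<forall>v\<in>?P. 0 \<le> w v" "x \<noteq> 0 \<longrightarrow> (\<exists>v\<in>?P. 0 < w v)"
        "\<forall>a b a' b'. herm (a *s x + b *s V x) (a' *s x + b' *s V x)
         = (\<Sum>v\<in>?P. of_real (w v) * ((a + b * l v) * cnj (a' + b' * l v)))"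
        by (rule herm_expand[OF ctx sub x])
      show "Re (m * herm (a *s x + b *s V x) (a' *s x + b' *s V x)) \<le> 0"
        unfolding w(3)[rule_format] expand
        by (intro sum_nonpos mult_nonneg_nonpos w(1)[rule_format] nonpos unit) auto
    qed
    show "\<forall>x\<in>vec.span ?N. x \<noteq> 0 \<longrightarrow> 0 < Re (m * herm (a *s x + b *s V x) (a' *s x + b' *s V x))"
    proof (intro ballI impI)
      fix x assume x: "x \<in> vec.span ?N" "x \<noteq> 0"
      have sub: "?N \<subseteq> B" by blast
      obtain w where w: "\<forall>v\<in>?N. 0 \<le> w v" "x \<noteq> 0 \<longrightarrow> (\<exists>v\<in>?N. 0 < w v)"
        "\<forall>a b a' b'. herm (a *s x + b *s V x) (a' *s x + b' *s V x)
         = (\<Sum>v\<in>?N. of_real (w v) * ((a + b * l v) * cnj (a' + b' * l v)))"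
        by (rule herm_expand[OF ctx sub x(1)])
      have pos': "0 < Re (m * ((a + b * l v) * cnj (a' + b' * l v)))" if "v \<in> ?N" for v
        using that eigenspace_nontrivial_iff[OF ctx] by (intro pos unit) auto
      obtain v where v: "v \<in> ?N" "0 < w v" using w(2) x(2) by blast
      show "0 < Re (m * herm (a *s x + b *s V x) (a' *s x + b' *s V x))"
        unfolding w(3)[rule_format] expand
      proof (rule sum_pos2[OF fin(2) v(1)])
        show "0 < w v * Re (m * ((a + b * l v) * cnj (a' + b' * l v)))"
          using v pos' by simp
      qed (use w(1) pos' in \<open>simp add: less_imp_le\<close>)
    qed
  qed simp_all
qed

section \<open>Lagrangian subspaces as graphs\<close>

definition sform :: "complex ^ 'm ^ 'm \<Rightarrow> complex ^ 'm \<Rightarrow> complex ^ 'm \<Rightarrow> complex" where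
  "sform K x y = herm (K *v x) y"

definition complex_structure :: "complex ^ 'm ^ 'm \<Rightarrow> bool" where
  "complex_structure K \<longleftrightarrow> (\<forall>x y. herm (K *v x) y = - herm x (K *v y)) \<and> (\<forall>x. K *v (K *v x) = - x)"

definition isotropic :: "complex ^ 'm ^ 'm \<Rightarrow> (complex ^ 'm) set \<Rightarrow> bool" where
  "isotropic K L \<longleftrightarrow> (\<forall>x\<in>L. \<forall>y\<in>L. sform K x y = 0)"

text \<open>
  For a nondegenerate form, an isotropic subspace of half the dimension is the same as a subspace
  equal to its own symplectic complement; the dimension is easier to check for explicit
  subspaces.
\<close>

definition lagrangian :: "complex ^ 'm ^ 'm \<Rightarrow> (complex ^ 'm) set \<Rightarrow> bool" where
  "lagrangian K L \<longleftrightarrow> vec.subspace L \<and> isotropic K L \<and> 2 * vec.dim L = CARD('m)"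

definition pos_proj :: "complex ^ 'm ^ 'm \<Rightarrow> complex ^ 'm \<Rightarrow> complex ^ 'm" where
  "pos_proj K z = (1/2) *s (z - \<i> *s (K *v z))"

definition neg_proj :: "complex ^ 'm ^ 'm \<Rightarrow> complex ^ 'm \<Rightarrow> complex ^ 'm" where
  "neg_proj K z = (1/2) *s (z + \<i> *s (K *v z))"

lemma mat_mult_vec: "mat c *v x = c *s x" for x :: "'a::comm_semiring_1 ^ 'm"
  by (simp add: vec_eq_iff mat_def matrix_vector_mult_def if_distrib if_distribR sum.delta cong: if_cong)

lemma pos_proj_zero [simp]: "pos_proj K 0 = 0"
  by (simp add: pos_proj_def)

lemma mem_pos_part: "x \<in> pos_part K \<longleftrightarrow> K *v x = \<i> *s x"
  by (simp add: pos_part_def matrix_vector_mult_diff_rdistrib mat_mult_vec)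

lemma mem_neg_part: "x \<in> neg_part K \<longleftrightarrow> K *v x = - (\<i> *s x)"
  by (simp add: neg_part_def matrix_vector_mult_add_rdistrib mat_mult_vec eq_neg_iff_add_eq_0)

lemma subspace_pos_part [simp]: "vec.subspace (pos_part K)"
  and subspace_neg_part [simp]: "vec.subspace (neg_part K)"
  by (auto simp: vec.subspace_def mem_pos_part mem_neg_part vec.add vec.scale vec.scale_right_distrib
      mult.commute)

lemma linear_pos_proj: "Vector_Spaces.linear (*s) (*s) (pos_proj K)"
  and linear_neg_proj: "Vector_Spaces.linear (*s) (*s) (neg_proj K)"
  unfolding Vector_Spaces.linear_iff pos_proj_def neg_proj_def
  by (simp_all add: vec.vector_space_axioms vec.add vec.scale vec_eq_iff algebra_simps)

lemma sform_add_left: "sform K (x + y) z = sform K x z + sform K y z"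
  and sform_scale_left: "sform K (c *s x) z = c * sform K x z"
  and sform_add_right: "sform K z (x + y) = sform K z x + sform K z y"
  by (simp_all add: sform_def vec.add vec.scale herm_add_left herm_scale_left herm_add_right)

lemma inj_on_subspaceI:
  assumes "Vector_Spaces.linear (*s) (*s) f" "vec.subspace S" "\<And>x. x \<in> S \<Longrightarrow> f x = 0 \<Longrightarrow> x = 0"
  shows "inj_on f S"
proof -
  interpret Vector_Spaces.linear "(*s)" "(*s)" f by fact
  show ?thesis
    using assms inj_on_iff_eq_0 by blast
qed

lemma dim_image_inj_on:
  fixes f :: "'a::field ^ 'm \<Rightarrow> 'a ^ 'k"
  assumes "Vector_Spaces.linear (*s) (*s) f" "vec.subspace S" "\<And>x. x \<in> S \<Longrightarrow> f x = 0 \<Longrightarrow> x = 0"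
  shows "vec.dim (f ` S) = vec.dim S"
  using vec.dim_image_eq[OF assms(1), of S] inj_on_subspaceI[OF assms]
  by (simp add: vec.span_eq_iff[THEN iffD2, OF assms(2)])

lemma image_eq_of_dim_eq:
  fixes f :: "'a::field ^ 'm \<Rightarrow> 'a ^ 'k"
  assumes "Vector_Spaces.linear (*s) (*s) f" "vec.subspace S" "\<And>x. x \<in> S \<Longrightarrow> f x = 0 \<Longrightarrow> x = 0"
    and "f ` S \<subseteq> T" "vec.subspace T" "vec.dim T \<le> vec.dim S"
  shows "f ` S = T"
proof -
  interpret Vector_Spaces.linear "(*s)" "(*s)" f by fact
  show ?thesis
  proof (rule vec.subspace_dim_equal[OF subspace_image[OF assms(2)] assms(5,4)])
    show "vec.dim T \<le> vec.dim (f ` S)"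
      using dim_image_inj_on[OF assms(1,2,3)] assms(6) by linarith
  qed
qed

context
  fixes K :: "complex ^ 'm ^ 'm"
  assumes K: "complex_structure K"
begin

lemma complex_structure_skew: "herm (K *v x) y = - herm x (K *v y)" and complex_structure_square: "K *v (K *v x) = - x"
  using K by (auto simp: complex_structure_def)

lemma sform_sym: "sform K y x = - cnj (sform K x y)"
  using complex_structure_skew[of y x] herm_sym[of y "K *v x"] by (simp add: sform_def)

lemma pos_proj_mem: "pos_proj K z \<in> pos_part K" and neg_proj_mem: "neg_proj K z \<in> neg_part K"
  unfolding mem_pos_part mem_neg_part pos_proj_def neg_proj_def
  by (simp_all add: vec.add vec.diff vec.scale complex_structure_square vec_eq_iff algebra_simps)

lemma proj_sum: "pos_proj K z + neg_proj K z = z"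
  by (simp add: pos_proj_def neg_proj_def vec_eq_iff)

lemma proj_of_sum:
  assumes "x \<in> pos_part K" "y \<in> neg_part K"
  shows "pos_proj K (x + y) = x" "neg_proj K (x + y) = y"
  using assms unfolding mem_pos_part mem_neg_part pos_proj_def neg_proj_def
  by (simp_all add: vec.add) (simp_all add: vec_eq_iff algebra_simps)

lemma herm_pos_neg:
  assumes "x \<in> pos_part K" "y \<in> neg_part K"
  shows "herm x y = 0" "herm y x = 0"
proof -
  have "herm (\<i> *s x) y = - herm x (- (\<i> *s y))"
    using complex_structure_skew[of x y] assms by (simp add: mem_pos_part mem_neg_part)
  moreover have "- (\<i> *s y) = (- \<i>) *s y" by simp
  ultimately have "\<i> * herm x y = - (\<i> * herm x y)"
    by (simp only: herm_scale_left herm_scale_right complex_cnj_minus complex_cnj_i minus_minus)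
  then show "herm x y = 0" by (simp add: eq_neg_iff_add_eq_0)
  then show "herm y x = 0" using herm_sym[of y x] by simp
qed

lemma sform_split:
  assumes "x \<in> pos_part K" "y \<in> neg_part K" "x' \<in> pos_part K" "y' \<in> neg_part K"
  shows "sform K (x + y) (x' + y') = \<i> * herm x x' - \<i> * herm y y'"
proof -
  have "K *v (x + y) = \<i> *s x + (- \<i>) *s y"
    using assms by (simp add: vec.add mem_pos_part mem_neg_part)
  then show ?thesis
    using herm_pos_neg assms
    by (simp add: sform_def herm_add_left herm_diff_left herm_add_right herm_scale_left)
qed

text \<open>
  For \<open>z = z\<^sub>+ + z\<^sub>-\<close> the form gives \<open>\<omega>(z, z) = \<i> ((z\<^sub>+, z\<^sub>+) - (z\<^sub>-, z\<^sub>-))\<close>.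
\<close>

lemma isotropic_norm_eq:
  assumes "isotropic K L" "z \<in> L"
  shows "herm (pos_proj K z) (pos_proj K z) = herm (neg_proj K z) (neg_proj K z)"
  using sform_split[OF pos_proj_mem neg_proj_mem pos_proj_mem neg_proj_mem, of z z z z] assms
  unfolding proj_sum by (simp add: isotropic_def)

lemma dim_pos_neg_part: "vec.dim (pos_part K) + vec.dim (neg_part K) = CARD('m)"
proof -
  have "pos_part K \<inter> neg_part K \<subseteq> {0}" using herm_pos_neg(1) by fastforce
  moreover have "{x + y |x y. x \<in> pos_part K \<and> y \<in> neg_part K} = UNIV"
    using proj_sum pos_proj_mem neg_proj_mem by (metis (mono_tags, lifting) UNIV_eq_I mem_Collect_eq)
  ultimately show ?thesis
    using dim_direct_sum[of "pos_part K" "neg_part K"] vec_dim_card[where 'a=complex and 'n='m] by simp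
qed

text \<open>
  Since both components of an isotropic vector have the same length, both projections are
  injective on \<open>L\<close>; the two parts have total dimension \<open>2 dim L\<close>, which leaves no room.
\<close>

lemma lagrangian_proj_bij:
  assumes L: "lagrangian K L"
  shows "bij_betw (pos_proj K) L (pos_part K)" "bij_betw (neg_proj K) L (neg_part K)"
    "vec.dim (pos_part K) = vec.dim L"
proof -
  have sub: "vec.subspace L" and iso: "isotropic K L" and dim: "2 * vec.dim L = CARD('m)"
    using L by (auto simp: lagrangian_def)
  have 1: "x = 0" if "x \<in> L" "pos_proj K x = 0" for x
    using isotropic_norm_eq[OF iso that(1)] that(2) proj_sum[of x] by (simp add: herm_zero_left)
  have 2: "x = 0" if "x \<in> L" "neg_proj K x = 0" for x
    using isotropic_norm_eq[OF iso that(1)] that(2) proj_sum[of x] by (simp add: herm_zero_left)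
  have im: "pos_proj K ` L \<subseteq> pos_part K" "neg_proj K ` L \<subseteq> neg_part K"
    using pos_proj_mem neg_proj_mem by auto
  have "vec.dim L \<le> vec.dim (pos_part K)" "vec.dim L \<le> vec.dim (neg_part K)"
    using vec.dim_subset[OF im(1)] vec.dim_subset[OF im(2)]
      dim_image_inj_on[OF linear_pos_proj sub 1] dim_image_inj_on[OF linear_neg_proj sub 2] by simp_all
  then have d: "vec.dim (pos_part K) \<le> vec.dim L" "vec.dim (neg_part K) \<le> vec.dim L"
    using dim_pos_neg_part dim by linarith+
  then show "bij_betw (pos_proj K) L (pos_part K)" "bij_betw (neg_proj K) L (neg_part K)"
    unfolding bij_betw_def
    using inj_on_subspaceI[OF linear_pos_proj sub 1] inj_on_subspaceI[OF linear_neg_proj sub 2]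
      image_eq_of_dim_eq[OF linear_pos_proj sub 1 im(1)] image_eq_of_dim_eq[OF linear_neg_proj sub 2 im(2)]
    by simp_all
  show "vec.dim (pos_part K) = vec.dim L" using d(1) \<open>vec.dim L \<le> vec.dim (pos_part K)\<close> by simp
qed

text \<open>
  The unitary map sends the positive component of a vector of \<open>L\<close> to its negative component; it
  is isometric because the form vanishes on \<open>L\<close>.
\<close>

lemma lagrangian_is_graph:
  assumes L: "lagrangian K L"
  shows "\<exists>U. unitary_iso (pos_part K) (neg_part K) U \<and> L = inner_graph (pos_part K) U"
proof -
  have sub: "vec.subspace L" and iso: "isotropic K L"
    using L by (auto simp: lagrangian_def)
  note bij = lagrangian_proj_bij[OF L]
  interpret p: Vector_Spaces.linear "(*s)" "(*s)" "pos_proj K" by (rule linear_pos_proj)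
  interpret q: Vector_Spaces.linear "(*s)" "(*s)" "neg_proj K" by (rule linear_neg_proj)
  define G where "G = inv_into L (pos_proj K)"
  define U where "U x = neg_proj K (G x)" for x
  have G: "G x \<in> L" "pos_proj K (G x) = x" if "x \<in> pos_part K" for x
    using that bij(1) unfolding G_def
    by (auto simp: bij_betw_def inv_into_into f_inv_into_f)
  have G': "G (pos_proj K z) = z" if "z \<in> L" for z
    using that bij(1) unfolding G_def by (simp add: bij_betw_def)
  have Gsum: "G x = x + U x" if "x \<in> pos_part K" for x
    using proj_sum[of "G x"] G[OF that] by (simp add: U_def)
  have "U (x + y) = U x + U y" if "x \<in> pos_part K" "y \<in> pos_part K" for x y
  proof -
    have "G (pos_proj K (G x + G y)) = G x + G y"
      using G' G that vec.subspace_add[OF sub] by blast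
    then show ?thesis unfolding U_def by (simp add: p.add q.add G that)
  qed
  moreover have "U (c *s x) = c *s U x" if "x \<in> pos_part K" for c x
  proof -
    have "G (pos_proj K (c *s G x)) = c *s G x"
      using G' G that vec.subspace_scale[OF sub] by blast
    then show ?thesis unfolding U_def by (simp add: p.scale q.scale G that)
  qed
  moreover have Un: "U x \<in> neg_part K" for x unfolding U_def by (rule neg_proj_mem)
  have "herm (U x) (U y) = herm x y" if "x \<in> pos_part K" "y \<in> pos_part K" for x y
  proof -
    have "sform K (G x) (G y) = 0" using iso G that by (simp add: isotropic_def)
    then show ?thesis
      using sform_split[OF that(1) Un that(2) Un] that by (simp add: Gsum)
  qed
  moreover have "bij_betw U (pos_part K) (neg_part K)"
  proof -
    have "bij_betw G (pos_part K) L" unfolding G_def using bij(1) by (rule bij_betw_inv_into)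
    then have "bij_betw (neg_proj K \<circ> G) (pos_part K) (neg_part K)" using bij(2) by (rule bij_betw_trans)
    then show ?thesis by (simp add: U_def[abs_def] comp_def)
  qed
  ultimately have "unitary_iso (pos_part K) (neg_part K) U" by (simp add: unitary_iso_def)
  moreover have "L = inner_graph (pos_part K) U"
  proof
    show "L \<subseteq> inner_graph (pos_part K) U"
    proof
      fix z assume "z \<in> L"
      then have "z = pos_proj K z + U (pos_proj K z)" using Gsum[OF pos_proj_mem] G' by metis
      then show "z \<in> inner_graph (pos_part K) U"
        unfolding inner_graph_def using pos_proj_mem by blast
    qed
    show "inner_graph (pos_part K) U \<subseteq> L"
      unfolding inner_graph_def using Gsum G by force
  qed
  ultimately show ?thesis by blast
qed

lemma lagrange_unitary_spec:
  assumes "lagrangian K L"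
  shows "unitary_iso (pos_part K) (neg_part K) (lagrange_unitary K L)"
    "L = inner_graph (pos_part K) (lagrange_unitary K L)"
proof -
  have "unitary_iso (pos_part K) (neg_part K) (lagrange_unitary K L)
      \<and> L = inner_graph (pos_part K) (lagrange_unitary K L)"
    unfolding lagrange_unitary_def by (rule someI_ex[OF lagrangian_is_graph[OF assms]])
  then show "unitary_iso (pos_part K) (neg_part K) (lagrange_unitary K L)"
    "L = inner_graph (pos_part K) (lagrange_unitary K L)"
    by simp_all
qed

end

lemma unitary_iso_inv:
  assumes U: "unitary_iso X Y U" and X: "vec.subspace X"
  shows "unitary_iso Y X (inv_into X U)"
proof -
  note D = unitary_isoD[OF U]
  have inv: "inv_into X U y \<in> X" "U (inv_into X U y) = y" if "y \<in> Y" for y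
    using that D(3) by (auto simp: inv_into_into f_inv_into_f)
  have inv': "inv_into X U (U x) = x" if "x \<in> X" for x
    using that D(1) by (simp add: bij_betw_def)
  show ?thesis
    unfolding unitary_iso_def
  proof (intro conjI ballI allI)
    show "bij_betw (inv_into X U) Y X" using D(1) by (rule bij_betw_inv_into)
    fix x assume x: "x \<in> Y"
    show "inv_into X U (c *s x) = c *s inv_into X U x" for c
      using inv'[of "c *s inv_into X U x"] D(5) inv[OF x] vec.subspace_scale[OF X] by simp
    fix y assume y: "y \<in> Y"
    show "inv_into X U (x + y) = inv_into X U x + inv_into X U y"
      using inv'[of "inv_into X U x + inv_into X U y"] D(4) inv[OF x] inv[OF y] vec.subspace_add[OF X] by simp
    show "herm (inv_into X U x) (inv_into X U y) = herm x y"
      using D(6)[of "inv_into X U x" "inv_into X U y"] inv[OF x] inv[OF y] by simp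
  qed
qed

lemma unitary_iso_trans:
  assumes "unitary_iso X Y U" "unitary_iso Y Z V"
  shows "unitary_iso X Z (\<lambda>x. V (U x))"
  using unitary_isoD[OF assms(1)] unitary_isoD[OF assms(2)] bij_betw_trans[of U X Y V Z]
  unfolding unitary_iso_def by (simp add: comp_def)

section \<open>Splitting along a Lagrangian subspace and a rotated copy\<close>

text \<open>
  Let \<open>W\<close> be the graph of \<open>U'\<close>.  For a unit number \<open>c \<noteq> 1\<close> the graph of \<open>c U'\<close> is a Lagrangian
  complement of \<open>W\<close>.  Writing \<open>z = (a + U' a) + (b + c U' b)\<close> and comparing components gives
  \<open>a + b = z\<^sub>+\<close> and \<open>a + c b = U'\<^sup>-\<^sup>1 z\<^sub>-\<close>.  The solution \<open>a\<close> is \<open>rotation_part\<close>, the solution \<open>b\<close> is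
  \<open>rotated_part\<close>, and \<open>rotation_proj\<close> is the projection onto \<open>W\<close> along the graph of \<open>c U'\<close>.
\<close>

definition rotation_part :: "complex ^ 'm ^ 'm \<Rightarrow> (complex ^ 'm) set \<Rightarrow> complex \<Rightarrow> complex ^ 'm \<Rightarrow> complex ^ 'm" where
  "rotation_part K W c z = (1 / (c - 1)) *s
     (c *s pos_proj K z - inv_into (pos_part K) (lagrange_unitary K W) (neg_proj K z))"

definition rotation_proj :: "complex ^ 'm ^ 'm \<Rightarrow> (complex ^ 'm) set \<Rightarrow> complex \<Rightarrow> complex ^ 'm \<Rightarrow> complex ^ 'm" where
  "rotation_proj K W c z = rotation_part K W c z + lagrange_unitary K W (rotation_part K W c z)"

definition rotated_part :: "complex ^ 'm ^ 'm \<Rightarrow> (complex ^ 'm) set \<Rightarrow> complex \<Rightarrow> complex ^ 'm \<Rightarrow> complex ^ 'm" where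
  "rotated_part K W c z = (1 / (c - 1)) *s
     (inv_into (pos_part K) (lagrange_unitary K W) (neg_proj K z) - pos_proj K z)"

text \<open>
  The operator whose spectral flow through \<open>1\<close> is, up to sign, the Maslov index of \<open>L\<close> with respect to \<open>W\<close>.
\<close>

definition relative_unitary :: "complex ^ 'm ^ 'm \<Rightarrow> (complex ^ 'm) set \<Rightarrow> (complex ^ 'm) set \<Rightarrow> complex ^ 'm \<Rightarrow> complex ^ 'm" where
  "relative_unitary K W L x = inv_into (pos_part K) (lagrange_unitary K W) (lagrange_unitary K L x)"

context
  fixes K :: "complex ^ 'm ^ 'm" and W and c :: complex
  assumes K: "complex_structure K" and W: "lagrangian K W" and c: "cmod c = 1" "c \<noteq> 1"
begin

private abbreviation "X \<equiv> pos_part K"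
private abbreviation "U \<equiv> lagrange_unitary K W"
private abbreviation "O' \<equiv> inv_into (pos_part K) (lagrange_unitary K W)"
private abbreviation "a \<equiv> rotation_part K W c"
private abbreviation "b \<equiv> rotated_part K W c"
private abbreviation "pw \<equiv> rotation_proj K W c"

private lemmas U = lagrange_unitary_spec[OF K W]
private lemmas UD = unitary_isoD[OF U(1)]
private lemmas O = unitary_iso_inv[OF U(1) subspace_pos_part]
private lemmas OD = unitary_isoD[OF O]

private lemma U_O: "y \<in> neg_part K \<Longrightarrow> U (O' y) = y"
  and O_U: "x \<in> X \<Longrightarrow> O' (U x) = x"
  using UD(1,3) by (auto simp: f_inv_into_f bij_betw_def)

lemma rotation_part_mem: "a z \<in> X"
  unfolding rotation_part_def
  using OD(2)[OF neg_proj_mem[OF K]] pos_proj_mem[OF K]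
  by (intro vec.subspace_scale vec.subspace_diff subspace_pos_part)

lemma linear_rotation_proj: "Vector_Spaces.linear (*s) (*s) pw"
proof -
  interpret p: Vector_Spaces.linear "(*s)" "(*s)" "pos_proj K" by (rule linear_pos_proj)
  interpret q: Vector_Spaces.linear "(*s)" "(*s)" "neg_proj K" by (rule linear_neg_proj)
  have add: "a (x + y) = a x + a y" for x y
    unfolding rotation_part_def p.add q.add OD(4)[OF neg_proj_mem[OF K] neg_proj_mem[OF K]]
    by (simp add: vec_eq_iff algebra_simps)
  have scale: "a (r *s x) = r *s a x" for r x
    unfolding rotation_part_def p.scale q.scale OD(5)[OF neg_proj_mem[OF K]]
    by (simp add: vec_eq_iff algebra_simps)
  show ?thesis
    unfolding Vector_Spaces.linear_iff rotation_proj_def add scale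
    by (simp add: vec.vector_space_axioms UD(4)[OF rotation_part_mem rotation_part_mem]
        UD(5)[OF rotation_part_mem] vec.scale_right_distrib)
qed

lemma rotation_proj_mem: "pw z \<in> W"
  using U(2) rotation_part_mem unfolding rotation_proj_def inner_graph_def by blast

lemma sform_rotation_proj: "sform K (pw z) (pw z') = 0"
  using W rotation_proj_mem unfolding lagrangian_def isotropic_def by blast

lemma rotated_part_mem: "b z \<in> X"
  unfolding rotated_part_def
  using OD(2)[OF neg_proj_mem[OF K]] pos_proj_mem[OF K]
  by (intro vec.subspace_scale vec.subspace_diff subspace_pos_part)

lemma rotation_complement: "z - pw z = b z + c *s U (b z)"
proof -
  let ?b = "b z"
  have c0: "c - 1 \<noteq> 0" using c by simp
  have frac: "u = (1 / (c - 1)) * (c * u - v) + (1 / (c - 1)) * (v - u)"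
    "v = (1 / (c - 1)) * (c * u - v) + c * ((1 / (c - 1)) * (v - u))" for u v
  proof -
    have "(1 / (c - 1)) * (c - 1) = 1" using c0 by simp
    then show "u = (1 / (c - 1)) * (c * u - v) + (1 / (c - 1)) * (v - u)"
      "v = (1 / (c - 1)) * (c * u - v) + c * ((1 / (c - 1)) * (v - u))"
      by algebra+
  qed
  have 1: "pos_proj K z = a z + ?b"
    unfolding rotation_part_def rotated_part_def vec_eq_iff vector_add_component
      vector_smult_component vector_minus_component by (intro allI frac(1))
  have 2: "O' (neg_proj K z) = a z + c *s ?b"
    unfolding rotation_part_def rotated_part_def vec_eq_iff vector_add_component
      vector_smult_component vector_minus_component by (intro allI frac(2))
  have "neg_proj K z = U (a z + c *s ?b)"
    using U_O[OF neg_proj_mem[OF K]] 2 by metis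
  also have "\<dots> = U (a z) + c *s U ?b"
    using UD(4)[OF rotation_part_mem vec.subspace_scale[OF subspace_pos_part rotated_part_mem]]
      UD(5)[OF rotated_part_mem] by simp
  finally have "z = (a z + ?b) + (U (a z) + c *s U ?b)"
    using proj_sum[OF K, of z] 1 by simp
  then show ?thesis unfolding rotation_proj_def by (simp add: algebra_simps)
qed

text \<open>
  The graph of \<open>c U'\<close> is isotropic because \<open>c U'\<close> is isometric.
\<close>

lemma sform_rotation_complement: "sform K (z - pw z) (z' - pw z') = 0"
proof -
  have cc: "c * cnj c = 1" using c(1) by (simp add: complex_norm_square[symmetric])
  have n: "c *s U (b z) \<in> neg_part K" for z
    using UD(2)[OF rotated_part_mem] by (simp add: vec.subspace_scale)
  have "herm (c *s U (b z)) (c *s U (b z'))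
      = (c * cnj c) * herm (b z) (b z')"
    using UD(6)[OF rotated_part_mem rotated_part_mem]
    by (simp add: herm_scale_left herm_scale_right)
  then show ?thesis
    unfolding rotation_complement sform_split[OF K rotated_part_mem n rotated_part_mem n]
    by (simp add: cc)
qed

lemma rotation_proj_id: "z \<in> W \<longleftrightarrow> pw z = z"
proof
  assume "z \<in> W"
  then obtain x where x: "x \<in> X" "z = x + U x" using U(2) by (auto simp: inner_graph_def)
  have "b z = 0"
    unfolding rotated_part_def x(2) proj_of_sum[OF K x(1) UD(2)[OF x(1)]] O_U[OF x(1)] by simp
  then show "pw z = z"
    using rotation_complement[of z] UD(5)[OF x(1), of 0] by simp
qed (metis rotation_proj_mem)

context
  fixes L
  assumes L: "lagrangian K L"
begin

private abbreviation "V \<equiv> relative_unitary K W L"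

private lemmas UL = lagrange_unitary_spec[OF K L]
private lemmas ULD = unitary_isoD[OF UL(1)]

lemma unitary_relative: "unitary_iso X X V"
  unfolding relative_unitary_def[abs_def] by (rule unitary_iso_trans[OF UL(1) O])

lemma parts_of_graph:
  assumes x: "x \<in> X"
  defines "z \<equiv> x + lagrange_unitary K L x"
  shows "a z = (c / (c - 1)) *s x + (- 1 / (c - 1)) *s V x"
    "b z = (- 1 / (c - 1)) *s x + (1 / (c - 1)) *s V x"
  unfolding rotation_part_def rotated_part_def z_def proj_of_sum[OF K x ULD(2)[OF x]] relative_unitary_def
  by (simp_all add: vec_eq_iff divide_simps)

text \<open>
  For \<open>z = (a + U' a) + (b + c U' b)\<close>, unitarity of \<open>U'\<close> gives
  \<open>\<omega>(a + U' a, b + c U' b) = \<i> (1 - cnj c) (a, b)\<close>; on the graph of a Lagrangian subspace \<open>L\<close> both \<open>a\<close>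
  and \<open>b\<close> are first order polynomials in the relative unitary operator.
\<close>

lemma sform_graph:
  assumes x: "x \<in> X"
  defines "z \<equiv> x + lagrange_unitary K L x"
  shows "sform K (pw z) (z - pw z) = \<i> * (1 - cnj c) *
    herm ((c / (c - 1)) *s x + (- 1 / (c - 1)) *s V x) ((- 1 / (c - 1)) *s x + (1 / (c - 1)) *s V x)"
proof -
  have n: "c *s U (b z) \<in> neg_part K"
    using UD(2)[OF rotated_part_mem] by (simp add: vec.subspace_scale)
  have "sform K (pw z) (z - pw z) = \<i> * herm (a z) (b z) - \<i> * (cnj c * herm (a z) (b z))"
    unfolding rotation_complement unfolding rotation_proj_def
      sform_split[OF K rotation_part_mem UD(2)[OF rotation_part_mem] rotated_part_mem n]
      herm_scale_right UD(6)[OF rotation_part_mem rotated_part_mem] ..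
  also have "\<dots> = \<i> * (1 - cnj c) * herm (a z) (b z)" by (simp add: algebra_simps)
  finally show ?thesis unfolding parts_of_graph[OF x, folded z_def] .
qed

lemma rotation_proj_eq_0_iff:
  assumes x: "x \<in> X"
  shows "pw (x + lagrange_unitary K L x) = 0 \<longleftrightarrow> V x = c *s x"
proof -
  let ?z = "x + lagrange_unitary K L x"
  have c0: "c - 1 \<noteq> 0" using c by simp
  have "pw ?z = 0 \<longleftrightarrow> a ?z = 0"
  proof
    assume "pw ?z = 0"
    then have "pos_proj K (a ?z + U (a ?z)) = pos_proj K 0" unfolding rotation_proj_def by simp
    then show "a ?z = 0"
      by (simp add: proj_of_sum(1)[OF K rotation_part_mem UD(2)[OF rotation_part_mem]])
  next
    assume "a ?z = 0"
    then show "pw ?z = 0" using UD(5)[OF x, of 0] by (simp add: rotation_proj_def)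
  qed
  also have "\<dots> \<longleftrightarrow> (1 / (c - 1)) *s (c *s x - V x) = 0"
    unfolding parts_of_graph(1)[OF x] by (simp add: vec_eq_iff field_simps)
  also have "\<dots> \<longleftrightarrow> c *s x - V x = 0" unfolding vec.scale_eq_0_iff using c0 by simp
  also have "\<dots> \<longleftrightarrow> V x = c *s x" by auto
  finally show ?thesis .
qed

text \<open>
  The kernel of the projection is the graph of \<open>c U'\<close>, and a vector \<open>x + U x\<close> of \<open>L\<close> lies in it
  exactly when \<open>U x = c U' x\<close>, that is, when \<open>x\<close> is an eigenvector for the eigenvalue \<open>c\<close>.
\<close>

lemma no_eigenvalue_iff_transversal:
  "eigenspace_on X V c = {0} \<longleftrightarrow> (\<forall>z\<in>L. pw z = 0 \<longrightarrow> z = 0)"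
proof -
  have z0: "x + lagrange_unitary K L x = 0 \<longleftrightarrow> x = 0" if "x \<in> X" for x
    using proj_of_sum(1)[OF K that ULD(2)[OF that]] ULD(5)[OF that, of 0] by (metis add_0 pos_proj_zero vec.scale_zero_left)
  have "0 \<in> X" by (simp add: vec.subspace_0)
  moreover have "V 0 = 0"
    using unitary_isoD(5)[OF unitary_relative \<open>0 \<in> X\<close>, of 0] by simp
  ultimately have "eigenspace_on X V c = {0} \<longleftrightarrow> (\<forall>x\<in>X. V x = c *s x \<longrightarrow> x = 0)"
    unfolding eigenspace_on_def by auto
  also have "\<dots> \<longleftrightarrow> (\<forall>x\<in>X. pw (x + lagrange_unitary K L x) = 0 \<longrightarrow> x + lagrange_unitary K L x = 0)"
    using rotation_proj_eq_0_iff z0 by simp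
  also have "\<dots> \<longleftrightarrow> (\<forall>z\<in>inner_graph X (lagrange_unitary K L). pw z = 0 \<longrightarrow> z = 0)"
    by (auto simp: inner_graph_def)
  finally show ?thesis using UL(2) by simp
qed

end
end

lemma cos_less_outside:
  assumes "0 \<le> r" "r < x" "x < 2 * pi - r"
  shows "cos x < cos r"
proof (cases "x \<le> pi")
  case True
  then show ?thesis using assms by (intro cos_monotone_0_pi) auto
next
  case False
  have "cos (2 * pi - x) < cos r" using assms False by (intro cos_monotone_0_pi) auto
  then show ?thesis by (simp add: cos_diff)
qed

text \<open>
  After multiplication by \<open>\<bar>c - 1\<bar>\<^sup>2\<close> the left hand side expands to \<open>2 (sin e - sin t - sin (e - t))\<close>.
  As a function of the angle \<open>t\<close> it is nonpositive on \<open>[0, e]\<close>, vanishes at both ends and is positive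
  on the rest of the circle.
\<close>

lemma rotation_sign:
  fixes e t :: real
  assumes e: "0 < e" "e < pi"
  defines "c \<equiv> cis e"
  shows "Re (\<i> * (1 - cnj c) * ((c / (c - 1) + (- 1 / (c - 1)) * cis t) * cnj (- 1 / (c - 1) + (1 / (c - 1)) * cis t)))
    = 4 * sin (e / 2) * (cos (e / 2) - cos (t - e / 2)) / (cmod (c - 1))\<^sup>2"
proof -
  have "c \<noteq> 1"
    using e sin_gt_zero[of e] by (metis c_def cis.simps(2) one_complex.simps(2) order_less_irrefl)
  then have c0: "c - 1 \<noteq> 0" "cnj c - 1 \<noteq> 0" by (simp_all add: complex_eq_iff)
  have "\<i> * (1 - cnj c) * ((c / (c - 1) + (- 1 / (c - 1)) * cis t) * cnj (- 1 / (c - 1) + (1 / (c - 1)) * cis t))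
     = \<i> * (1 - cnj c) * ((c - cis t) * (cnj (cis t) - 1)) / ((c - 1) * cnj (c - 1))"
  proof -
    have "c / (c - 1) + (- 1 / (c - 1)) * cis t = (c - cis t) / (c - 1)"
      "- 1 / (c - 1) + (1 / (c - 1)) * cis t = (cis t - 1) / (c - 1)"
      by (simp_all add: diff_divide_distrib)
    then show ?thesis by simp
  qed
  also have "(c - 1) * cnj (c - 1) = of_real ((cmod (c - 1))\<^sup>2)"
    by (rule complex_norm_square[symmetric])
  finally have "Re (\<i> * (1 - cnj c) * ((c / (c - 1) + (- 1 / (c - 1)) * cis t) * cnj (- 1 / (c - 1) + (1 / (c - 1)) * cis t)))
     = Re (\<i> * (1 - cnj c) * ((c - cis t) * (cnj (cis t) - 1))) / (cmod (c - 1))\<^sup>2"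
    by (simp only: Re_divide_of_real)
  also have "Re (\<i> * (1 - cnj c) * ((c - cis t) * (cnj (cis t) - 1))) = 2 * (sin e - sin t - sin (e - t))"
  proof -
    have 1: "sin e * sin e + cos e * cos e = 1" "sin t * sin t + cos t * cos t = 1"
      using sin_cos_squared_add[of e] sin_cos_squared_add[of t] by (simp_all add: power2_eq_square)
    have "cos t * (cos t * sin e) + sin e * (sin t * sin t) = sin e"
      "cos e * (cos e * sin t) + sin e * (sin e * sin t) = sin t"
      using 1 by algebra+
    then show ?thesis
      unfolding c_def sin_diff by (simp add: algebra_simps)
  qed
  also have "2 * (sin e - sin t - sin (e - t)) = 4 * sin (e / 2) * (cos (e / 2) - cos (t - e / 2))"
  proof -
    have "sin e = 2 * sin (e / 2) * cos (e / 2)" using sin_double[of "e / 2"] by simp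
    moreover have "sin t + sin (e - t) = 2 * sin (e / 2) * cos (t - e / 2)"
      by (simp add: sin_plus_sin cos_diff) (simp add: diff_divide_distrib cos_diff cos_minus)
    ultimately show ?thesis by (simp add: algebra_simps)
  qed
  finally show ?thesis .
qed

text \<open>
  The bridge from eigenvalues to forms.  Evaluated on an eigenvector with eigenvalue \<open>cis t\<close>, the form
  \<open>\<omega>(w, z - w)\<close>, with \<open>w\<close> the projection of \<open>z\<close> to \<open>W\<close>, has the sign of
  \<open>cos (e / 2) - cos (t - e / 2)\<close>.  It is nonpositive for \<open>t\<close> in \<open>[0, e)\<close> and positive for all other
  eigenvalues because \<open>cis e\<close> itself does not occur.
\<close>

lemma eigenvalue_arc_split:
  fixes K :: "complex ^ 'm ^ 'm"
  assumes K: "complex_structure K" and W: "lagrangian K W" and L: "lagrangian K L"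
    and e: "0 < e" "e < pi"
    and noev: "eigenspace_on (pos_part K) (relative_unitary K W L) (cis e) = {0}"
  obtains E F where "vec.subspace E" "vec.subspace F" "E \<subseteq> L" "F \<subseteq> L"
    "vec.dim E = eigenvalue_count (pos_part K) (relative_unitary K W L) (cis ` {0..<e})"
    "vec.dim E + vec.dim F = vec.dim L"
    "\<forall>z\<in>E. Re (sform K (rotation_proj K W (cis e) z) (z - rotation_proj K W (cis e) z)) \<le> 0"
    "\<forall>z\<in>F. z \<noteq> 0 \<longrightarrow>
      0 < Re (sform K (rotation_proj K W (cis e) z) (z - rotation_proj K W (cis e) z))"
proof -
  define c where "c = cis e"
  let ?X = "pos_part K" and ?V = "relative_unitary K W L" and ?A = "cis ` {0..<e}"
  let ?q = "\<lambda>z. sform K (rotation_proj K W c z) (z - rotation_proj K W c z)"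
  have c: "cmod c = 1" "c \<noteq> 1"
    unfolding c_def using e sin_gt_zero[of e]
    by (simp, metis cis.simps(2) one_complex.simps(2) order_less_irrefl)
  have c0: "0 < (cmod (c - 1))\<^sup>2" using c by simp
  have s: "0 < sin (e / 2)" using e by (intro sin_gt_zero) auto
  have angle: "\<exists>t. 0 \<le> t \<and> t < 2 * pi \<and> z = cis t" if "cmod z = 1" for z
    using Arg2pi[of z] that by (auto simp: is_Arg_def cis_conv_exp)
  let ?f = "\<lambda>z. Re (\<i> * (1 - cnj c) * ((c / (c - 1) + (- 1 / (c - 1)) * z) * cnj (- 1 / (c - 1) + (1 / (c - 1)) * z)))"
  have nonpos: "?f z \<le> 0" if "cmod z = 1" "z \<in> ?A" for z
  proof -
    obtain t where t: "0 \<le> t" "t < e" "z = cis t" using \<open>z \<in> ?A\<close> by auto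
    have "\<bar>t - e / 2\<bar> \<le> e / 2" using t by linarith
    then have "cos (e / 2) \<le> cos \<bar>t - e / 2\<bar>"
      using e by (intro cos_monotone_0_pi_le) auto
    then have "cos (e / 2) \<le> cos (t - e / 2)" by simp
    then show ?thesis
      unfolding t(3) c_def rotation_sign[OF e]
      using s by (intro divide_nonpos_nonneg mult_nonneg_nonpos) auto
  qed
  have pos: "0 < ?f z" if z: "cmod z = 1" "z \<notin> ?A" "eigenspace_on ?X ?V z \<noteq> {0}" for z
  proof -
    obtain t where t: "0 \<le> t" "t < 2 * pi" "z = cis t" using angle[OF z(1)] by blast
    have "t \<noteq> e" using z(3) noev t(3) by blast
    moreover have "\<not> t < e" using z(2) t by auto
    ultimately have "cos (t - e / 2) < cos (e / 2)"
      using t e by (intro cos_less_outside) auto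
    then show ?thesis
      using s c0 unfolding t(3) c_def rotation_sign[OF e] by simp
  qed
  obtain E F where EF: "vec.subspace E" "vec.subspace F" "E \<subseteq> ?X" "F \<subseteq> ?X"
    "vec.dim E = eigenvalue_count ?X ?V ?A" "vec.dim E + vec.dim F = vec.dim ?X"
    and En: "\<forall>x\<in>E. Re (\<i> * (1 - cnj c) *
      herm ((c / (c - 1)) *s x + (- 1 / (c - 1)) *s ?V x) ((- 1 / (c - 1)) *s x + (1 / (c - 1)) *s ?V x)) \<le> 0"
    and Fp: "\<forall>x\<in>F. x \<noteq> 0 \<longrightarrow> 0 < Re (\<i> * (1 - cnj c) *
      herm ((c / (c - 1)) *s x + (- 1 / (c - 1)) *s ?V x) ((- 1 / (c - 1)) *s x + (1 / (c - 1)) *s ?V x))"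
    by (rule unitary_sign_split[OF subspace_pos_part unitary_relative[OF K W c L] nonpos pos])
  note ULD = unitary_isoD[OF lagrange_unitary_spec(1)[OF K L]]
  obtain g where g: "Vector_Spaces.linear (*s) (*s) g" "\<And>x. x \<in> ?X \<Longrightarrow> g x = lagrange_unitary K L x"
    using linear_on_subspace_extend[OF subspace_pos_part, of K "lagrange_unitary K L"] ULD(4,5) by blast
  interpret g: Vector_Spaces.linear "(*s)" "(*s)" g by (rule g(1))
  define G where "G x = x + g x" for x
  have G: "G x = x + lagrange_unitary K L x" if "x \<in> ?X" for x using g that by (simp add: G_def)
  have lin: "Vector_Spaces.linear (*s) (*s) G"
    unfolding Vector_Spaces.linear_iff G_def
    by (simp add: vec.vector_space_axioms g.add g.scale vec.scale_right_distrib)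
  interpret G: Vector_Spaces.linear "(*s)" "(*s)" G by (rule lin)
  have GL: "G x \<in> L" if "x \<in> ?X" for x
    using G[OF that] lagrange_unitary_spec(2)[OF K L] that unfolding inner_graph_def by blast
  have G0: "x = 0" if "x \<in> ?X" "G x = 0" for x
    using proj_of_sum(1)[OF K that(1) ULD(2)[OF that(1)]] that G by (metis pos_proj_zero)
  have q: "?q (G x) = \<i> * (1 - cnj c) *
      herm ((c / (c - 1)) *s x + (- 1 / (c - 1)) *s ?V x) ((- 1 / (c - 1)) *s x + (1 / (c - 1)) *s ?V x)"
    if "x \<in> ?X" for x
    using sform_graph[OF K W c L that] G[OF that] by simp
  have dims: "vec.dim (G ` E) = vec.dim E" "vec.dim (G ` F) = vec.dim F"
    using dim_image_inj_on[OF lin EF(1)] dim_image_inj_on[OF lin EF(2)] G0 EF(3,4) by blast+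
  show ?thesis
  proof (rule that[of "G ` E" "G ` F", folded c_def])
    show "vec.subspace (G ` E)" "vec.subspace (G ` F)" using EF by (simp_all add: G.subspace_image)
    show "G ` E \<subseteq> L" "G ` F \<subseteq> L" using GL EF by auto
    show "vec.dim (G ` E) = eigenvalue_count ?X ?V ?A" using dims EF by simp
    show "vec.dim (G ` E) + vec.dim (G ` F) = vec.dim L"
      using dims EF lagrangian_proj_bij(3)[OF K L] by simp
    show "\<forall>z\<in>G ` E. Re (?q z) \<le> 0"
    proof
      fix z assume "z \<in> G ` E"
      then obtain x where x: "x \<in> E" "z = G x" by blast
      then have "x \<in> ?X" using EF(3) by blast
      from q[OF this] x En show "Re (?q z) \<le> 0" by simp
    qed
    show "\<forall>z\<in>G ` F. z \<noteq> 0 \<longrightarrow> 0 < Re (?q z)"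
    proof (intro ballI impI)
      fix z assume "z \<in> G ` F" "z \<noteq> 0"
      then obtain x where x: "x \<in> F" "z = G x" "x \<noteq> 0" by (metis G.zero imageE)
      then have "x \<in> ?X" using EF(4) by blast
      from q[OF this] x Fp show "0 < Re (?q z)" by simp
    qed
  qed
qed

section \<open>Block vectors\<close>

definition vtop :: "'a ^ ('k::finite + 'm::finite) \<Rightarrow> 'a ^ 'k" where "vtop v = (\<chi> i. v $ Inl i)"
definition vbot :: "'a ^ ('k::finite + 'm::finite) \<Rightarrow> 'a ^ 'm" where "vbot v = (\<chi> i. v $ Inr i)"

lemma vtop_vconcat [simp]: "vtop (vconcat x y) = x"
  and vbot_vconcat [simp]: "vbot (vconcat x y) = y"
  by (simp_all add: vtop_def vbot_def vec_eq_iff)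

lemma vconcat_vtop_vbot [simp]: "vconcat (vtop v) (vbot v) = v"
  unfolding vec_eq_iff
proof
  fix i show "vconcat (vtop v) (vbot v) $ i = v $ i" by (cases i) (simp_all add: vtop_def vbot_def)
qed

lemma vconcat_eq_iff [simp]: "vconcat x y = vconcat x' y' \<longleftrightarrow> x = x' \<and> y = y'"
  by (metis vbot_vconcat vtop_vconcat)

lemma vtop_linear: "vtop (x + y) = vtop x + vtop y" "vtop (c *s z) = c *s vtop z" "vtop 0 = 0"
    "vtop (x - y) = vtop x - vtop y" "vtop (- x) = - vtop x"
  and vbot_linear: "vbot (x + y) = vbot x + vbot y" "vbot (c *s z) = c *s vbot z" "vbot 0 = 0"
    "vbot (x - y) = vbot x - vbot y" "vbot (- x) = - vbot x"
  for x y :: "complex ^ ('k::finite + 'm::finite)" and z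
  by (simp_all add: vtop_def vbot_def vec_eq_iff)

lemma vconcat_eqI: "vtop v = vtop w \<Longrightarrow> vbot v = vbot w \<Longrightarrow> v = w"
  by (metis vconcat_vtop_vbot)

lemma vconcat_linear:
  fixes x x' :: "complex ^ 'k" and y y' :: "complex ^ 'm"
  shows "vconcat (x + x') (y + y') = vconcat x y + vconcat x' y'"
    "vconcat (c *s x) (c *s y) = c *s vconcat x y" "vconcat 0 0 = (0 :: complex ^ ('k + 'm))"
    "vconcat (- x) (- y) = - vconcat x y"
  by (rule vconcat_eqI; simp add: vtop_linear vbot_linear)+

lemma norm_vconcat: "(norm (vconcat x y))\<^sup>2 = (norm x)\<^sup>2 + (norm y)\<^sup>2" for x :: "complex ^ 'k" and y :: "complex ^ 'm"
proof -
  have "complex_of_real ((norm (vconcat x y))\<^sup>2) = of_real ((norm x)\<^sup>2 + (norm y)\<^sup>2)"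
    using herm_vconcat[of x y x y] unfolding herm_self of_real_add .
  then show ?thesis by (simp only: of_real_eq_iff)
qed

lemma norm_vtop_le: "norm (vtop v) \<le> norm v" for v :: "complex ^ ('k::finite + 'm::finite)"
  using norm_vconcat[of "vtop v" "vbot v"] by (simp add: power2_le_imp_le)

definition vprod :: "('a ^ 'k) set \<Rightarrow> ('a ^ 'm) set \<Rightarrow> ('a ^ ('k + 'm)) set" where
  "vprod A B = {vconcat x y |x y. x \<in> A \<and> y \<in> B}"

lemma
  fixes A :: "(complex ^ 'k) set" and B :: "(complex ^ 'm) set"
  assumes A: "vec.subspace A" and B: "vec.subspace B"
  shows subspace_vprod: "vec.subspace (vprod A B)"
    and dim_vprod: "vec.dim (vprod A B) = vec.dim A + vec.dim B"
proof -
  let ?f = "\<lambda>x :: complex ^ 'k. vconcat x (0 :: complex ^ 'm)" and ?g = "\<lambda>y :: complex ^ 'm. vconcat (0 :: complex ^ 'k) y"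
  have f: "Vector_Spaces.linear (*s) (*s) ?f" and g: "Vector_Spaces.linear (*s) (*s) ?g"
    unfolding Vector_Spaces.linear_iff
    by (simp_all add: vec.vector_space_axioms vconcat_linear(1,2)[symmetric])
  interpret f: Vector_Spaces.linear "(*s)" "(*s)" ?f by (rule f)
  interpret g: Vector_Spaces.linear "(*s)" "(*s)" ?g by (rule g)
  have sub: "vec.subspace (?f ` A)" "vec.subspace (?g ` B)"
    using f.subspace_image[OF A] g.subspace_image[OF B] .
  have eq: "vprod A B = {x + y |x y. x \<in> ?f ` A \<and> y \<in> ?g ` B}"
  proof -
    have split: "vconcat x y = vconcat x 0 + vconcat 0 y" for x :: "complex ^ 'k" and y :: "complex ^ 'm"
      by (simp flip: vconcat_linear(1))
    have "vprod A B = {?f x + ?g y |x y. x \<in> A \<and> y \<in> B}"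
      unfolding vprod_def split[symmetric] ..
    also have "\<dots> = {x + y |x y. x \<in> ?f ` A \<and> y \<in> ?g ` B}"
      by (intro set_eqI iffI) (blast+)
    finally show ?thesis .
  qed
  show "vec.subspace (vprod A B)" unfolding eq by (rule vec.subspace_sums[OF sub])
  have "?f ` A \<inter> ?g ` B \<subseteq> {0}" by (auto simp: vconcat_linear(3))
  then have "vec.dim (vprod A B) = vec.dim (?f ` A) + vec.dim (?g ` B)"
    unfolding eq by (rule dim_direct_sum[OF sub])
  also have "vec.dim (?f ` A) = vec.dim A"
    by (rule dim_image_inj_on[OF f A]) (metis vtop_linear(3) vtop_vconcat)
  also have "vec.dim (?g ` B) = vec.dim B"
    by (rule dim_image_inj_on[OF g B]) (metis vbot_linear(3) vbot_vconcat)
  finally show "vec.dim (vprod A B) = vec.dim A + vec.dim B" .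
qed

abbreviation vquad :: "'a ^ 'n \<Rightarrow> 'a ^ 'n \<Rightarrow> 'a ^ 'n \<Rightarrow> 'a ^ 'n \<Rightarrow> 'a ^ (('n + 'n) + ('n + 'n))" where
  "vquad x y z u \<equiv> vconcat (vconcat x y) (vconcat z u)"

lemma vquad_cases: obtains x y z u where "v = vquad x y z u"
  by (metis vconcat_vtop_vbot)

lemma Jdiff_vquad: "Jdiff *v vquad x y z u = vquad y (- x) (- u) z"
proof -
  have neg: "(- A) *v v = - (A *v v)" for A :: "complex ^ 'l ^ 'k" and v
    by (simp add: vec_eq_iff matrix_vector_mult_def sum_negf)
  have J: "Jstd *v vconcat x y = vconcat (- y) x" for x y :: "complex ^ 'n"
    unfolding Jstd_def block_mat_vconcat neg by simp
  show ?thesis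
    unfolding Jdiff_def block_mat_vconcat neg J
    by (simp flip: vconcat_linear(4))
qed

lemma herm_minus: "herm (- x) y = - herm x y" "herm x (- y) = - herm x y"
  using herm_diff_left[of 0 x y] herm_diff_right[of x 0 y] by (simp_all add: herm_zero_left herm_zero_right)

lemma complex_structure_Jdiff: "complex_structure Jdiff"
  unfolding complex_structure_def
proof (intro conjI allI)
  fix v w :: "complex ^ (('a + 'a) + ('a + 'a))"
  obtain x y z u where v: "v = vquad x y z u" by (rule vquad_cases)
  obtain x' y' z' u' where w: "w = vquad x' y' z' u'" by (rule vquad_cases)
  show "herm (Jdiff *v v) w = - herm v (Jdiff *v w)"
    unfolding v w Jdiff_vquad herm_vconcat by (simp add: herm_minus)
  show "Jdiff *v (Jdiff *v v) = - v"
    unfolding v Jdiff_vquad by (simp flip: vconcat_linear(4))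
qed

lemma sform_vquad:
  "sform Jdiff (vquad x y z u) (vquad x' y' z' u') = herm y x' - herm x y' - herm u z' + herm z u'"
  unfolding sform_def Jdiff_vquad herm_vconcat by (simp add: herm_minus)

lemma selfadjoint_herm:
  assumes "selfadjoint P"
  shows "herm (P *v x) y = herm x (P *v y)"
proof -
  have P: "cnj (P $ i $ j) = P $ j $ i" for i j
    using assms unfolding selfadjoint_def conj_transpose_def vec_eq_iff by simp
  have "herm (P *v x) y = (\<Sum>i\<in>UNIV. \<Sum>j\<in>UNIV. P $ i $ j * x $ j * cnj (y $ i))"
    by (simp add: herm_def matrix_vector_mult_def sum_distrib_right)
  also have "\<dots> = (\<Sum>j\<in>UNIV. \<Sum>i\<in>UNIV. P $ i $ j * x $ j * cnj (y $ i))"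
    by (rule sum.swap)
  also have "\<dots> = herm x (P *v y)"
    by (simp add: herm_def matrix_vector_mult_def sum_distrib_left P mult_ac)
  finally show ?thesis .
qed

lemma herm_form_selfadjoint:
  assumes "selfadjoint P"
  shows "herm_form (\<lambda>x y. herm (P *v x) y)"
  unfolding herm_form_def
proof (intro conjI allI)
  fix x y
  show "herm (P *v y) x = cnj (herm (P *v x) y)"
    using selfadjoint_herm[OF assms, of y x] herm_sym[of y "P *v x"] by simp
qed (simp_all add: vec.add vec.scale herm_add_left herm_scale_left)

section \<open>Graphs of shears and the subspace W(R)\<close>

definition shear :: "complex ^ 'n ^ 'n \<Rightarrow> complex ^ ('n + 'n) ^ ('n + 'n)" where
  "shear P = block_mat (mat 1) 0 P (mat 1)"

lemma mat_graph_shear: "mat_graph (shear P) = {vquad x y x (P *v x + y) |x y. True}"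
proof -
  have "shear P *v vconcat x y = vconcat x (P *v x + y)" for x y :: "complex ^ 'a"
    unfolding shear_def block_mat_vconcat by simp
  then show ?thesis
    unfolding mat_graph_def by (metis vconcat_vtop_vbot)
qed

lemma
  fixes M :: "complex ^ 'm ^ 'm"
  shows subspace_mat_graph: "vec.subspace (mat_graph M)" and dim_mat_graph: "vec.dim (mat_graph M) = CARD('m)"
proof -
  let ?f = "\<lambda>v. vconcat v (M *v v)"
  have f: "Vector_Spaces.linear (*s) (*s) ?f"
    unfolding Vector_Spaces.linear_iff
    by (simp add: vec.vector_space_axioms vconcat_linear(1,2)[symmetric] vec.add vec.scale)
  interpret f: Vector_Spaces.linear "(*s)" "(*s)" ?f by (rule f)
  have eq: "mat_graph M = ?f ` UNIV" by (auto simp: mat_graph_def)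
  show "vec.subspace (mat_graph M)" unfolding eq by (rule f.subspace_image[OF vec.subspace_UNIV])
  have "vec.dim (?f ` UNIV) = vec.dim (UNIV :: (complex ^ 'm) set)"
    by (rule dim_image_inj_on[OF f vec.subspace_UNIV]) (metis vtop_linear(3) vtop_vconcat)
  then show "vec.dim (mat_graph M) = CARD('m)" unfolding eq vec_dim_card .
qed

lemma lagrangian_mat_graph_shear:
  assumes "selfadjoint P"
  shows "lagrangian Jdiff (mat_graph (shear P))"
proof -
  have "isotropic Jdiff (mat_graph (shear P))"
    unfolding isotropic_def
  proof (intro ballI)
    fix v w assume "v \<in> mat_graph (shear P)" "w \<in> mat_graph (shear P)"
    then obtain x y x' y' where vw: "v = vquad x y x (P *v x + y)" "w = vquad x' y' x' (P *v x' + y')"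
      unfolding mat_graph_shear by blast
    show "sform Jdiff v w = 0"
      unfolding vw sform_vquad herm_add_left herm_add_right selfadjoint_herm[OF assms] by simp
  qed
  then show ?thesis
    unfolding lagrangian_def by (simp add: subspace_mat_graph dim_mat_graph)
qed

text \<open>
  Up to the order of the blocks and one sign, \<open>W(R)\<close> is the product of the orthogonal complement
  of \<open>R\<close> with \<open>R\<close>; this yields its dimension.
\<close>

lemma WR_eq_image:
  "WR R = (\<lambda>v. vquad (vtop (vtop v)) (vtop (vbot v)) (- vbot (vtop v)) (vbot (vbot v))) ` vprod (herm_compl R) R"
  (is "_ = ?f ` _")
proof
  show "WR R \<subseteq> ?f ` vprod (herm_compl R) R"
  proof
    fix v assume "v \<in> WR R"
    then obtain x y z u where v: "v = vquad x y z u" "vconcat x (- z) \<in> herm_compl R" "vconcat y u \<in> R"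
      unfolding WR_def by blast
    then have "v = ?f (vconcat (vconcat x (- z)) (vconcat y u))" by simp
    moreover have "vconcat (vconcat x (- z)) (vconcat y u) \<in> vprod (herm_compl R) R"
      using v by (auto simp: vprod_def)
    ultimately show "v \<in> ?f ` vprod (herm_compl R) R" by (rule image_eqI)
  qed
  show "?f ` vprod (herm_compl R) R \<subseteq> WR R"
  proof
    fix v assume "v \<in> ?f ` vprod (herm_compl R) R"
    then obtain p q where v: "v = ?f (vconcat p q)" "p \<in> herm_compl R" "q \<in> R"
      unfolding vprod_def by blast
    show "v \<in> WR R"
      unfolding WR_def
      by (rule CollectI, rule exI[of _ "vtop p"], rule exI[of _ "vtop q"], rule exI[of _ "- vbot p"], rule exI[of _ "vbot q"])
        (simp add: v)
  qed
qed

lemma lagrangian_WR: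
  fixes R :: "(complex ^ ('n::finite + 'n)) set"
  assumes R: "vec.subspace R"
  shows "lagrangian Jdiff (WR R)"
proof -
  let ?f = "\<lambda>v :: complex ^ (('n + 'n) + ('n + 'n)). vquad (vtop (vtop v)) (vtop (vbot v)) (- vbot (vtop v)) (vbot (vbot v))"
  have f: "Vector_Spaces.linear (*s) (*s) ?f"
    unfolding Vector_Spaces.linear_iff
    by (simp add: vec.vector_space_axioms vconcat_linear(1,2)[symmetric] vtop_linear vbot_linear)
  interpret f: Vector_Spaces.linear "(*s)" "(*s)" ?f by (rule f)
  note C = dim_herm_compl[OF R]
  note sub = subspace_vprod[OF C(1) R]
  have "vec.dim (?f ` vprod (herm_compl R) R) = vec.dim (vprod (herm_compl R) R)"
  proof (rule dim_image_inj_on[OF f sub])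
    fix v :: "complex ^ (('n + 'n) + ('n + 'n))" assume "?f v = 0"
    then have "vtop (?f v) = 0" "vbot (?f v) = 0" by (simp_all only: vtop_linear vbot_linear)
    then have "vtop (vtop (?f v)) = 0" "vbot (vtop (?f v)) = 0" "vtop (vbot (?f v)) = 0" "vbot (vbot (?f v)) = 0"
      by (simp_all only: vtop_linear vbot_linear)
    then show "v = 0" by (intro vconcat_eqI) (simp_all add: vtop_linear vbot_linear)
  qed
  then have dim: "2 * vec.dim (WR R) = CARD(('n + 'n) + ('n + 'n))"
    unfolding WR_eq_image dim_vprod[OF C(1) R] using C(2) by simp
  have "isotropic Jdiff (WR R)"
    unfolding isotropic_def
  proof (intro ballI)
    fix v w assume "v \<in> WR R" "w \<in> WR R"
    then obtain x y z u x' y' z' u' where v: "v = vquad x y z u" "vconcat x (- z) \<in> herm_compl R" "vconcat y u \<in> R"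
      and w: "w = vquad x' y' z' u'" "vconcat x' (- z') \<in> herm_compl R" "vconcat y' u' \<in> R"
      unfolding WR_def by blast
    have "herm (vconcat x (- z)) (vconcat y' u') = 0" "herm (vconcat x' (- z')) (vconcat y u) = 0"
      using v w unfolding herm_compl_def by blast+
    moreover from this(2) have "herm (vconcat y u) (vconcat x' (- z')) = 0"
      using herm_sym[of "vconcat y u"] by simp
    ultimately show "sform Jdiff v w = 0"
      unfolding v w sform_vquad unfolding herm_vconcat by (simp add: herm_minus algebra_simps)
  qed
  then show ?thesis
    unfolding lagrangian_def using dim f.subspace_image[OF sub] by (simp only: WR_eq_image simp_thms)
qed

text \<open>
  The space \<open>tied UNIV UNIV\<close> is the symplectic complement of the vectors \<open>(0, y, 0, y)\<close>; it contains
  the graphs of all shears, and its intersection with \<open>W(R)\<close> is again of this shape.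
\<close>

definition tied :: "('a ^ 'n::finite) set \<Rightarrow> ('a ^ ('n + 'n)) set \<Rightarrow> ('a ^ (('n + 'n) + ('n + 'n))) set" where
  "tied A R = {vquad x y x u |x y u. x \<in> A \<and> vconcat y u \<in> R}"

lemma
  fixes A :: "(complex ^ 'n::finite) set"
  assumes A: "vec.subspace A" and R: "vec.subspace R"
  shows subspace_tied: "vec.subspace (tied A R)" and dim_tied: "vec.dim (tied A R) = vec.dim A + vec.dim R"
proof -
  let ?f = "\<lambda>v :: complex ^ ('n + ('n + 'n)). vquad (vtop v) (vtop (vbot v)) (vtop v) (vbot (vbot v))"
  have f: "Vector_Spaces.linear (*s) (*s) ?f"
    unfolding Vector_Spaces.linear_iff
    by (simp add: vec.vector_space_axioms vconcat_linear(1,2)[symmetric] vtop_linear vbot_linear)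
  interpret f: Vector_Spaces.linear "(*s)" "(*s)" ?f by (rule f)
  have eq: "tied A R = ?f ` vprod A R"
  proof
    show "tied A R \<subseteq> ?f ` vprod A R"
    proof
      fix v assume "v \<in> tied A R"
      then obtain x y u where v: "v = vquad x y x u" "x \<in> A" "vconcat y u \<in> R" unfolding tied_def by blast
      then have "v = ?f (vconcat x (vconcat y u))" by simp
      moreover have "vconcat x (vconcat y u) \<in> vprod A R" using v by (auto simp: vprod_def)
      ultimately show "v \<in> ?f ` vprod A R" by (rule image_eqI)
    qed
    show "?f ` vprod A R \<subseteq> tied A R"
      unfolding vprod_def tied_def by (auto; metis vconcat_vtop_vbot)
  qed
  note sub = subspace_vprod[OF A R]
  show "vec.subspace (tied A R)" unfolding eq by (rule f.subspace_image[OF sub])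
  have "vec.dim (?f ` vprod A R) = vec.dim (vprod A R)"
  proof (rule dim_image_inj_on[OF f sub])
    fix v :: "complex ^ ('n + ('n + 'n))" assume "?f v = 0"
    then have "vtop (?f v) = 0" "vbot (?f v) = 0" by (simp_all only: vtop_linear vbot_linear)
    then have "vtop (vtop (?f v)) = 0" "vbot (vtop (?f v)) = 0" "vbot (vbot (?f v)) = 0"
      by (simp_all only: vtop_linear vbot_linear)
    then show "v = 0"
      by (intro vconcat_eqI[of v 0] vconcat_eqI[of "vbot v" "vbot 0"]) (simp_all add: vtop_linear vbot_linear)
  qed
  then show "vec.dim (tied A R) = vec.dim A + vec.dim R" unfolding eq dim_vprod[OF A R] .
qed

text \<open>
  The subspace called \<open>S\<close> in the theorem.
\<close>

definition antidiagonal_part :: "(complex ^ ('n::finite + 'n)) set \<Rightarrow> (complex ^ 'n) set" where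
  "antidiagonal_part R = {x. vconcat x (- x) \<in> herm_compl R}"

definition diagonal_part :: "(complex ^ ('n::finite + 'n)) set \<Rightarrow> (complex ^ 'n) set" where
  "diagonal_part R = {y. vconcat y y \<in> R}"

lemma antidiagonal_part_eq: "{x. vconcat x x \<in> Rb R} = antidiagonal_part R"
  unfolding Rb_def antidiagonal_part_def by auto

text \<open>
  A vector is orthogonal to the diagonal exactly when it has the form \<open>(x, - x)\<close>.  Hence the
  antidiagonal part of the orthogonal complement of \<open>R\<close> is the orthogonal complement of the sum of \<open>R\<close>
  and the diagonal, and the dimension formula for sums applies.
\<close>

lemma
  fixes R :: "(complex ^ ('n::finite + 'n)) set"
  assumes R: "vec.subspace R"
  shows subspace_antidiagonal_part: "vec.subspace (antidiagonal_part R)"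
    and dim_antidiagonal_part: "vec.dim (antidiagonal_part R) + vec.dim R = CARD('n) + vec.dim (diagonal_part R)"
proof -
  let ?f = "\<lambda>x :: complex ^ 'n. vconcat x (- x)" and ?g = "\<lambda>y :: complex ^ 'n. vconcat y y"
  have f: "Vector_Spaces.linear (*s) (*s) ?f" and g: "Vector_Spaces.linear (*s) (*s) ?g"
    unfolding Vector_Spaces.linear_iff
    by (simp_all add: vec.vector_space_axioms vconcat_linear(1,2)[symmetric])
  interpret f: Vector_Spaces.linear "(*s)" "(*s)" ?f by (rule f)
  interpret g: Vector_Spaces.linear "(*s)" "(*s)" ?g by (rule g)
  note C = dim_herm_compl[OF R]
  show S: "vec.subspace (antidiagonal_part R)"
    unfolding antidiagonal_part_def using f.subspace_linear_preimage[OF C(1)] .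
  have D: "vec.subspace (diagonal_part R)"
    unfolding diagonal_part_def using g.subspace_linear_preimage[OF R] .
  let ?D = "range ?g"
  have subD: "vec.subspace ?D" by (rule g.subspace_image[OF vec.subspace_UNIV])
  have "vec.dim ?D = vec.dim (UNIV :: (complex ^ 'n) set)"
    by (rule dim_image_inj_on[OF g vec.subspace_UNIV]) (metis vtop_linear(3) vtop_vconcat)
  then have dimD: "vec.dim ?D = CARD('n)" by (simp only: vec_dim_card)
  let ?Z = "{x + y |x y. x \<in> ?D \<and> y \<in> R}"
  have subZ: "vec.subspace ?Z" by (rule vec.subspace_sums[OF subD R])
  have "?D \<inter> R = ?g ` diagonal_part R" unfolding diagonal_part_def by auto
  moreover have "vec.dim (?g ` diagonal_part R) = vec.dim (diagonal_part R)"
    by (rule dim_image_inj_on[OF g D]) (metis vtop_linear(3) vtop_vconcat)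
  ultimately have 1: "vec.dim ?Z + vec.dim (diagonal_part R) = CARD('n) + vec.dim R"
    using dim_sum_Int[OF subD R] dimD by simp
  have "herm_compl ?Z = ?f ` antidiagonal_part R"
  proof
    show "herm_compl ?Z \<subseteq> ?f ` antidiagonal_part R"
    proof
      fix v assume v: "v \<in> herm_compl ?Z"
      obtain x y where xy: "v = vconcat x y" by (metis vconcat_vtop_vbot)
      have "vconcat (x + y) (x + y) + 0 \<in> ?Z" using vec.subspace_0[OF R] by blast
      then have "herm v (vconcat (x + y) (x + y) + 0) = 0" using v unfolding herm_compl_def by blast
      then have "herm (x + y) (x + y) = 0"
        unfolding xy by (simp add: herm_vconcat herm_add_left)
      then have "y = - x" by (simp add: eq_neg_iff_add_eq_0 add.commute)
      moreover have "v \<in> herm_compl R"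
        unfolding herm_compl_def
      proof (intro CollectI ballI)
        fix r assume "r \<in> R"
        then have "0 + r \<in> ?Z" using vec.subspace_0[OF subD] by blast
        then show "herm v r = 0" using v unfolding herm_compl_def by simp
      qed
      ultimately show "v \<in> ?f ` antidiagonal_part R"
        unfolding antidiagonal_part_def xy by blast
    qed
    show "?f ` antidiagonal_part R \<subseteq> herm_compl ?Z"
      unfolding antidiagonal_part_def herm_compl_def
      by (auto simp: herm_add_right herm_vconcat herm_minus)
  qed
  moreover have "vec.dim (?f ` antidiagonal_part R) = vec.dim (antidiagonal_part R)"
    by (rule dim_image_inj_on[OF f S]) (metis vtop_linear(3) vtop_vconcat)
  ultimately have "vec.dim ?Z + vec.dim (antidiagonal_part R) = CARD('n) + CARD('n)"
    using dim_herm_compl(2)[OF subZ] by simp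
  with 1 show "vec.dim (antidiagonal_part R) + vec.dim R = CARD('n) + vec.dim (diagonal_part R)"
    by linarith
qed

lemma tied_subset_WR: "A \<subseteq> antidiagonal_part R \<Longrightarrow> tied A R \<subseteq> WR R"
  unfolding tied_def WR_def antidiagonal_part_def by blast

lemma WR_Int_tied: "WR R \<inter> tied UNIV UNIV = tied (antidiagonal_part R) R"
  unfolding tied_def WR_def antidiagonal_part_def by auto

lemma graph_subset_tied: "mat_graph (shear P) \<subseteq> tied UNIV UNIV"
  unfolding mat_graph_shear tied_def by blast

section \<open>A Hermitian form comparing the two indices\<close>

definition base :: "complex ^ (('n + 'n) + ('n::finite + 'n)) \<Rightarrow> complex ^ 'n" where
  "base z = vtop (vtop z)"

definition rise :: "complex ^ (('n + 'n) + ('n::finite + 'n)) \<Rightarrow> complex ^ 'n" where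
  "rise z = vbot (vbot z) - vbot (vtop z)"

text \<open>
  Here \<open>pw\<close> is a projection onto \<open>W(R)\<close> along a Lagrangian complement.  On the tied vectors
  \<open>(x, y, x, u)\<close>, with \<open>base\<close> \<open>x\<close> and \<open>rise\<close> \<open>u - y\<close>, the terms
  \<open>(x, u' - y') + (u - y, x') - 2 (P x, x')\<close> are the form that the splitting into a
  vector of the graph of the shear and a vector with vanishing first and third block induces in the same
  way as \<open>pw\<close> induces the first two terms.  The form thus compares two splittings; it depends
  on \<open>P\<close> only through \<open>- 2 (P x, x')\<close>, on a space that does not depend on \<open>P\<close>.
\<close>

definition comparison_form ::
  "(complex ^ (('n + 'n) + ('n + 'n)) \<Rightarrow> complex ^ (('n + 'n) + ('n + 'n))) \<Rightarrow> complex ^ 'n ^ 'n \<Rightarrow>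
     complex ^ (('n::finite + 'n) + ('n + 'n)) \<Rightarrow> complex ^ (('n + 'n) + ('n + 'n)) \<Rightarrow> complex" where
  "comparison_form pw P z z' = sform Jdiff (pw z) (z' - pw z') - sform Jdiff (z - pw z) (pw z')
     + herm (base z) (rise z') + herm (rise z) (base z') - 2 * herm (P *v base z) (base z')"

lemma base_linear: "base (x + y) = base x + base y" "base (c *s x) = c *s base x"
  and rise_linear: "rise (x + y) = rise x + rise y" "rise (c *s x) = c *s rise x"
  by (simp_all add: base_def rise_def vtop_linear vbot_linear vec_eq_iff algebra_simps)

lemma base_vquad [simp]: "base (vquad x y z u) = x" and rise_vquad [simp]: "rise (vquad x y z u) = u - y"
  by (simp_all add: base_def rise_def)

lemma norm_base_le: "norm (base z) \<le> norm z"
  unfolding base_def by (rule order_trans[OF norm_vtop_le norm_vtop_le])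

lemma subspace_tied_UNIV: "vec.subspace (tied (UNIV :: (complex ^ 'n::finite) set) UNIV)"
  by (rule subspace_tied[OF vec.subspace_UNIV vec.subspace_UNIV])

definition entry_sum :: "complex ^ 'k ^ 'm \<Rightarrow> real" where
  "entry_sum M = (\<Sum>i\<in>UNIV. \<Sum>j\<in>UNIV. cmod (M $ i $ j))"

lemma cmod_herm_le: "cmod (herm (M *v x) x) \<le> entry_sum M * (norm x)\<^sup>2"
proof -
  have "herm (M *v x) x = (\<Sum>i\<in>UNIV. \<Sum>j\<in>UNIV. M $ i $ j * x $ j * cnj (x $ i))"
    by (simp add: herm_def matrix_vector_mult_def sum_distrib_right)
  also have "cmod \<dots> \<le> (\<Sum>i\<in>UNIV. \<Sum>j\<in>UNIV. cmod (M $ i $ j) * (norm x)\<^sup>2)"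
  proof (intro order_trans[OF norm_sum] sum_mono)
    fix i j
    show "cmod (M $ i $ j * x $ j * cnj (x $ i)) \<le> cmod (M $ i $ j) * (norm x)\<^sup>2"
      unfolding norm_mult complex_mod_cnj power2_eq_square mult.assoc
      by (intro mult_left_mono mult_mono Finite_Cartesian_Product.norm_nth_le) simp_all
  qed
  finally show ?thesis by (simp add: entry_sum_def sum_distrib_right)
qed

lemma dim_tied_UNIV: "vec.dim (tied (UNIV :: (complex ^ 'n::finite) set) UNIV) = 3 * CARD('n)"
proof -
  have "vec.dim (tied (UNIV :: (complex ^ 'n) set) UNIV)
      = vec.dim (UNIV :: (complex ^ 'n) set) + vec.dim (UNIV :: (complex ^ ('n + 'n)) set)"
    by (rule dim_tied[OF vec.subspace_UNIV vec.subspace_UNIV])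
  then show ?thesis unfolding vec_dim_card by simp
qed

lemma sform_tied:
  assumes "z \<in> tied UNIV UNIV" "z' \<in> tied UNIV UNIV"
  shows "sform Jdiff z z' = herm (base z) (rise z') - herm (rise z) (base z')"
proof -
  obtain x y u x' y' u' where "z = vquad x y x u" "z' = vquad x' y' x' u'"
    using assms unfolding tied_def by blast
  then show ?thesis by (simp add: sform_vquad herm_diff_left herm_diff_right)
qed

context
  fixes R :: "(complex ^ ('n::finite + 'n)) set"
    and pw :: "complex ^ (('n + 'n) + ('n + 'n)) \<Rightarrow> complex ^ (('n + 'n) + ('n + 'n))"
  assumes R: "vec.subspace R"
    and lin: "Vector_Spaces.linear (*s) (*s) pw"
    and isoW: "\<And>z z'. sform Jdiff (pw z) (pw z') = 0"
    and isoM: "\<And>z z'. sform Jdiff (z - pw z) (z' - pw z') = 0"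
    and pw_mem: "\<And>z. pw z \<in> WR R"
    and pw_id: "\<And>z. z \<in> WR R \<Longrightarrow> pw z = z"
begin

private abbreviation "Y \<equiv> tied (UNIV :: (complex ^ 'n) set) UNIV"
private abbreviation "S \<equiv> antidiagonal_part R"
private abbreviation "B \<equiv> comparison_form pw"
private abbreviation "L P \<equiv> mat_graph (shear P)"

lemma herm_form_comparison:
  assumes P: "selfadjoint P"
  shows "herm_form (B P)"
  unfolding herm_form_def
proof (intro conjI allI)
  interpret Vector_Spaces.linear "(*s)" "(*s)" pw by (rule lin)
  note K = complex_structure_Jdiff
  fix x y z
  have e: "(x + y) - pw (x + y) = (x - pw x) + (y - pw y)" by (simp add: add)
  show "B P (x + y) z = B P x z + B P y z"
    unfolding comparison_form_def e
    unfolding add base_linear rise_linear sform_add_left herm_add_left vec.add by (simp add: algebra_simps)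
  have e: "(c *s x) - pw (c *s x) = c *s (x - pw x)" for c by (simp add: scale vec.scale_right_diff_distrib)
  show "B P (c *s x) y = c * B P x y" for c
    unfolding comparison_form_def e
    unfolding scale base_linear rise_linear sform_scale_left herm_scale_left vec.scale by (simp add: algebra_simps)
  show "B P y x = cnj (B P x y)"
    unfolding comparison_form_def
    using sform_sym[OF K, of "pw y" "x - pw x"] sform_sym[OF K, of "y - pw y" "pw x"]
      herm_sym[of "base y" "rise x"] herm_sym[of "rise y" "base x"]
      form_sym[OF herm_form_selfadjoint[OF P], of "base y" "base x"]
    by simp
qed

lemma sform_pw_split: "sform Jdiff z z' = sform Jdiff (pw z) (z' - pw z') + sform Jdiff (z - pw z) (pw z')"
proof -
  have "sform Jdiff z z' = sform Jdiff (pw z + (z - pw z)) (pw z' + (z' - pw z'))" by simp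
  also have "\<dots> = sform Jdiff (pw z) (z' - pw z') + sform Jdiff (z - pw z) (pw z')"
    by (simp only: sform_add_left sform_add_right isoW isoM) simp
  finally show ?thesis .
qed

text \<open>
  On the graph the two splittings express \<open>\<omega>(z, z')\<close> in two ways, so all terms but the
  first cancel.
\<close>

lemma comparison_on_graph:
  assumes z: "z \<in> L P" and z': "z' \<in> Y"
  shows "B P z z' = 2 * sform Jdiff (pw z) (z' - pw z')"
proof -
  have "rise z = P *v base z" using z unfolding mat_graph_shear by auto
  moreover have "sform Jdiff (pw z) (z' - pw z') + sform Jdiff (z - pw z) (pw z')
      = herm (base z) (rise z') - herm (rise z) (base z')"
    using sform_tied[OF subsetD[OF graph_subset_tied z] z'] sform_pw_split[of z z'] by simp
  ultimately show ?thesis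
    unfolding comparison_form_def by (simp add: algebra_simps)
qed

text \<open>
  A vector of \<open>W(R)\<close> is fixed by the projection, so only the pairing of it with the
  complementary part of \<open>z'\<close> is left of the first two terms, and this equals \<open>\<omega>(w, z')\<close>.
\<close>

lemma comparison_on_WR:
  assumes w: "w \<in> tied S R" and z': "z' \<in> Y"
  shows "B P w z' = 2 * herm (base w) (rise z') - 2 * herm (P *v base w) (base z')"
proof -
  have w': "w \<in> WR R" "w \<in> Y" using w WR_Int_tied by blast+
  then have "sform Jdiff w (z' - pw z') = herm (base w) (rise z') - herm (rise w) (base z')"
    using sform_tied[OF w'(2) z'] sform_pw_split[of w z'] pw_id[OF w'(1)] by (simp add: sform_def vec.zero herm_zero_left)
  then show ?thesis
    unfolding comparison_form_def pw_id[OF w'(1)] by (simp add: sform_def vec.zero herm_zero_left)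
qed

text \<open>
  On \<open>W(R)\<close> the form is \<open>- 2 (P x, x')\<close> with \<open>x\<close> and \<open>x'\<close> in \<open>S\<close>: negative directions here are
  positive directions of \<open>P\<close> on \<open>S\<close>.
\<close>

lemma comparison_on_WR_WR:
  assumes w: "w \<in> tied S R" "w' \<in> tied S R"
  shows "B P w w' = - 2 * herm (P *v base w) (base w')"
proof -
  obtain x y u x' y' u' where e: "w = vquad x y x u" "x \<in> S" "w' = vquad x' y' x' u'" "vconcat y' u' \<in> R"
    using w unfolding tied_def by blast
  then have "herm (vconcat x (- x)) (vconcat y' u') = 0"
    unfolding antidiagonal_part_def herm_compl_def by blast
  then have "herm (base w) (rise w') = 0"
    unfolding e herm_vconcat by (simp add: herm_minus herm_diff_right)
  moreover have "w' \<in> Y" using w WR_Int_tied by blast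
  ultimately show ?thesis using comparison_on_WR[OF w(1)] by simp
qed

lemma comparison_graph_WR:
  assumes "z \<in> L P" "w \<in> tied S R"
  shows "B P z w = 0"
proof -
  have "w \<in> WR R" "w \<in> Y" using assms WR_Int_tied by blast+
  then show ?thesis
    using comparison_on_graph[OF assms(1)] pw_id[of w] by (simp add: sform_def herm_zero_right)
qed

private abbreviation "nullspace_on_tied P \<equiv> {z \<in> Y. \<forall>z'\<in>Y. B P z z' = 0}"

lemma tied_0_subset_kernel: "tied {0} R \<subseteq> nullspace_on_tied P"
proof
  fix w assume w: "w \<in> tied {0} R"
  have "0 \<in> S" using vec.subspace_0[OF subspace_antidiagonal_part[OF R]] .
  with w have w': "w \<in> tied S R" unfolding tied_def by blast
  have "base w = 0" using w unfolding tied_def by auto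
  then have "B P w z' = 0" if "z' \<in> Y" for z'
    using comparison_on_WR[OF w' that] by (simp add: herm_zero_left vec.zero)
  moreover have "w \<in> Y" using w' WR_Int_tied by blast
  ultimately show "w \<in> nullspace_on_tied P" by blast
qed

text \<open>
  If the graph is transversal to the complement of \<open>W(R)\<close>, it projects onto \<open>W(R)\<close>.  A null
  vector \<open>z\<close> pairs to zero with the graph, so its complementary part is symplectically
  orthogonal to \<open>W(R)\<close> and to the complement, hence zero.  Thus \<open>z\<close> lies in
  \<open>W(R)\<close>, and pairing it with \<open>(0, 0, 0, x)\<close> gives \<open>x = 0\<close>.
\<close>

lemma kernel_subset_tied_0:
  assumes P: "selfadjoint P" and trans: "\<And>z. z \<in> L P \<Longrightarrow> pw z = 0 \<Longrightarrow> z = 0"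
  shows "nullspace_on_tied P \<subseteq> tied {0} R"
proof
  fix z assume z: "z \<in> nullspace_on_tied P"
  have L: "lagrangian Jdiff (L P)" by (rule lagrangian_mat_graph_shear[OF P])
  have W: "lagrangian Jdiff (WR R)" by (rule lagrangian_WR[OF R])
  have sub: "vec.subspace (L P)" "vec.subspace (WR R)"
    and dims: "2 * vec.dim (L P) = 2 * vec.dim (WR R)"
    using L W by (simp_all add: lagrangian_def)
  have im: "pw ` L P = WR R"
    by (rule image_eq_of_dim_eq[OF lin sub(1) trans _ sub(2)]) (use pw_mem dims in auto)
  have "sform Jdiff (pw w) (z - pw z) = 0" for w
  proof -
    obtain l where l: "l \<in> L P" "pw w = pw l" using im pw_mem[of w] by (metis imageE)
    have "l \<in> Y" using graph_subset_tied l(1) by blast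
    then have "B P z l = 0" using z by blast
    then have "B P l z = 0" using form_sym[OF herm_form_comparison[OF P], of l z] by simp
    then show ?thesis using comparison_on_graph[OF l(1), of z] z l(2) by simp
  qed
  then have "sform Jdiff w (z - pw z) = 0" for w
    using isoM[of w z] sform_add_left[of Jdiff "pw w" "w - pw w" "z - pw z"] by simp
  \<comment> \<open>the choice \<open>w = J (pw z - z)\<close>, for which \<open>J w = z - pw z\<close>\<close>
  then have "herm (Jdiff *v (Jdiff *v (- (z - pw z)))) (z - pw z) = 0"
    by (simp add: sform_def)
  then have "z - pw z = 0"
    using complex_structure_square[OF complex_structure_Jdiff, of "- (z - pw z)"] by (simp add: herm_self_eq_0)
  then have "z \<in> WR R" using pw_mem[of z] by simp
  then have zt: "z \<in> tied S R" using z WR_Int_tied[of R] by blast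
  have t: "vquad 0 0 0 (base z) \<in> Y" unfolding tied_def by blast
  then have "B P z (vquad 0 0 0 (base z)) = 0" using z by blast
  then have "base z = 0"
    using comparison_on_WR[OF zt t] by (simp add: herm_zero_right)
  then show "z \<in> tied {0} R" using zt unfolding tied_def by auto
qed

lemma dim_tied_0: "vec.dim (tied {0 :: complex ^ 'n} R) = vec.dim R"
  using dim_tied[OF vec.subspace_single_0[where 'a=complex and 'b='n] R] by simp

lemma index_sum_le:
  assumes P: "selfadjoint P"
  shows "morse_pos_index (B P) Y + morse_pos_index (\<lambda>x y. - B P x y) Y + vec.dim R \<le> 3 * CARD('n)"
  using morse_index_sum[OF herm_form_comparison[OF P] subspace_tied_UNIV]
    vec.dim_subset[OF tied_0_subset_kernel[of P]]
  unfolding dim_tied_0 dim_tied_UNIV by linarith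

text \<open>
  The null space always contains the vectors of \<open>W(R)\<close> with vanishing base, a space of
  dimension \<open>dim R\<close>, and equals it exactly in the transversal case.  By the law of inertia this
  makes transversality visible in the indices of the form, and hence an open condition on \<open>P\<close>.
\<close>

lemma index_sum_eq_iff:
  assumes P: "selfadjoint P"
  shows "morse_pos_index (B P) Y + morse_pos_index (\<lambda>x y. - B P x y) Y + vec.dim R = 3 * CARD('n)
    \<longleftrightarrow> (\<forall>z\<in>L P. pw z = 0 \<longrightarrow> z = 0)"
proof -
  note F = herm_form_comparison[OF P]
  note sum = morse_index_sum[OF F subspace_tied_UNIV, unfolded dim_tied_UNIV]
  have K: "vec.subspace (nullspace_on_tied P)" by (rule subspace_orthogonal[OF F subspace_tied_UNIV])
  have T: "vec.subspace (tied {0 :: complex ^ 'n} R)" by (rule subspace_tied[OF vec.subspace_single_0 R])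
  show ?thesis
  proof
    assume "\<forall>z\<in>L P. pw z = 0 \<longrightarrow> z = 0"
    then have "nullspace_on_tied P = tied {0} R"
      using kernel_subset_tied_0[OF P] tied_0_subset_kernel by blast
    then show "morse_pos_index (B P) Y + morse_pos_index (\<lambda>x y. - B P x y) Y + vec.dim R = 3 * CARD('n)"
      using sum dim_tied_0 by simp
  next
    assume eq: "morse_pos_index (B P) Y + morse_pos_index (\<lambda>x y. - B P x y) Y + vec.dim R = 3 * CARD('n)"
    then have "vec.dim (nullspace_on_tied P) = vec.dim R" using sum by linarith
    then have ker: "tied {0} R = nullspace_on_tied P"
      using vec.subspace_dim_equal[OF T K tied_0_subset_kernel] dim_tied_0 by simp
    show "\<forall>z\<in>L P. pw z = 0 \<longrightarrow> z = 0"
    proof (intro ballI impI)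
      fix z assume z: "z \<in> L P" "pw z = 0"
      then have "B P z z' = 0" if "z' \<in> Y" for z'
        using comparison_on_graph[OF z(1) that] by (simp add: sform_def vec.zero herm_zero_left)
      then have "z \<in> tied {0} R" using ker z(1) graph_subset_tied by blast
      moreover have "0 \<in> S" using vec.subspace_0[OF subspace_antidiagonal_part[OF R]] .
      ultimately have "z \<in> WR R" using tied_subset_WR[of "{0}" R] by blast
      then show "z = 0" using pw_id z(2) by metis
    qed
  qed
qed

text \<open>
  The graph and the tied part of \<open>W(R)\<close> are orthogonal for the comparison form, so subspaces of
  definite sign in each add up to such subspaces of the whole.  Adding a nonpositive subspace \<open>E\<close> of
  the graph and a maximal subspace of \<open>W(R)\<close> whose base lies in a positive subspace of \<open>P\<close> bounds the left
  hand side from above; adding a positive subspace \<open>F\<close> of the graph and the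
  complementary nonnegative subspace of \<open>W(R)\<close> bounds it from below.  The dimension formulas for
  \<open>S\<close> and for the null space show that the two bounds coincide.
\<close>

lemma signature_identity:
  assumes P: "selfadjoint P" and trans: "\<forall>z\<in>L P. pw z = 0 \<longrightarrow> z = 0"
    and E: "vec.subspace E" "E \<subseteq> L P" "\<forall>z\<in>E. Re (sform Jdiff (pw z) (z - pw z)) \<le> 0"
    and F: "vec.subspace F" "F \<subseteq> L P" "\<forall>z\<in>F. z \<noteq> 0 \<longrightarrow> 0 < Re (sform Jdiff (pw z) (z - pw z))"
    and dims: "vec.dim E + vec.dim F = vec.dim (L P)"
  shows "vec.dim E + morse_pos_index (\<lambda>x y. herm (P *v x) y) S
    = morse_pos_index (\<lambda>x y. - B P x y) Y + vec.dim (diagonal_part R)"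
proof -
  let ?Q = "\<lambda>x y. herm (P *v x) y"
  note FQ = herm_form_selfadjoint[OF P]
  note FB = herm_form_comparison[OF P]
  note FB' = herm_form_uminus[OF FB]
  have SS: "vec.subspace S" by (rule subspace_antidiagonal_part[OF R])
  note dS = dim_antidiagonal_part[OF R]
  obtain A where A: "vec.subspace A" "A \<subseteq> S" "pos_on ?Q A" "vec.dim A = morse_pos_index ?Q S"
    using morse_pos_index_witness[OF FQ SS] by blast
  obtain A' where A': "vec.subspace A'" "A' \<subseteq> S" "nonpos_on ?Q A'" "morse_pos_index ?Q S + vec.dim A' = vec.dim S"
    using nonpos_witness[OF FQ SS] by blast
  have mono: "tied C R \<subseteq> tied S R" if "C \<subseteq> S" for C using that unfolding tied_def by blast
  have tiedY: "tied S R \<subseteq> Y" using WR_Int_tied by blast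
  have Bw: "B P w w = - 2 * ?Q (base w) (base w)" if "w \<in> tied S R" for w
    using comparison_on_WR_WR[OF that that] .
  have Bl: "B P z z = 2 * sform Jdiff (pw z) (z - pw z)" if "z \<in> L P" for z
    using comparison_on_graph[OF that] that graph_subset_tied by blast
  have LS: "B P z z = 0" if "z \<in> L P" "z \<in> tied S R" for z
    using comparison_graph_WR[OF that] .
  have base_mem: "base w \<in> C" if "w \<in> tied C R" for w C using that unfolding tied_def by auto

  \<comment> \<open>the upper bound; \<open>E\<close> and \<open>?G\<close> may meet in the vectors \<open>(0, y, 0, y)\<close> with \<open>(y, y) \<in> R\<close>\<close>
  let ?G = "tied A R"
  have G: "vec.subspace ?G" "?G \<subseteq> tied S R" using subspace_tied[OF A(1) R] mono[OF A(2)] by blast+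
  let ?V = "{x + y |x y. x \<in> E \<and> y \<in> ?G}"
  have "nonpos_on (B P) ?V"
  proof
    fix z assume "z \<in> ?V"
    then obtain x y where z: "z = x + y" "x \<in> E" "y \<in> ?G" by blast
    then have xy: "x \<in> L P" "y \<in> tied S R" using E G by blast+
    have "B P y x = 0" "B P x y = 0"
      using comparison_graph_WR[OF xy] form_sym[OF FB, of y x] by simp_all
    then have "Re (B P z z) = Re (B P x x) + Re (B P y y)"
      unfolding z by (simp add: form_add_left[OF FB] form_add_right[OF FB])
    moreover have "Re (B P x x) \<le> 0" using E(3) z(2) Bl[OF xy(1)] by simp
    moreover have "0 \<le> Re (?Q (base y) (base y))"
      using A(3) base_mem[OF z(3)] by (cases "base y = 0") (auto simp: herm_zero_right less_imp_le)
    then have "Re (B P y y) \<le> 0" using Bw[OF xy(2)] by simp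
    ultimately show "Re (B P z z) \<le> 0" by linarith
  qed
  moreover have "?V \<subseteq> Y"
  proof -
    have "E \<subseteq> Y" "?G \<subseteq> Y" using E(2) G(2) graph_subset_tied tiedY by blast+
    then show ?thesis using vec.subspace_add[OF subspace_tied_UNIV] by blast
  qed
  moreover have "vec.subspace ?V" by (rule vec.subspace_sums[OF E(1) G(1)])
  ultimately have "morse_pos_index (B P) Y + vec.dim ?V \<le> 3 * CARD('n)"
    using morse_pos_index_add_nonpos_le[OF FB subspace_tied_UNIV, of ?V] unfolding dim_tied_UNIV by blast
  moreover have "vec.dim (E \<inter> ?G) \<le> vec.dim (diagonal_part R)"
  proof -
    let ?h = "\<lambda>y :: complex ^ 'n. vquad 0 y 0 y"
    have h: "Vector_Spaces.linear (*s) (*s) ?h"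
      unfolding Vector_Spaces.linear_iff
      by (simp add: vec.vector_space_axioms vconcat_linear(1,2)[symmetric])
    have "E \<inter> ?G \<subseteq> ?h ` diagonal_part R"
    proof
      fix z assume z: "z \<in> E \<inter> ?G"
      then have zz: "z \<in> L P" "z \<in> tied S R" using E G by blast+
      have "base z = 0"
      proof (rule ccontr)
        assume "base z \<noteq> 0"
        then have "0 < Re (?Q (base z) (base z))" using A(3) base_mem z by blast
        then show False using Bw[OF zz(2)] LS[OF zz] by simp
      qed
      moreover obtain x y where "z = vquad x y x (P *v x + y)" using zz(1) unfolding mat_graph_shear by blast
      moreover obtain x' y' u' where "z = vquad x' y' x' u'" "vconcat y' u' \<in> R" using zz(2) unfolding tied_def by blast
      ultimately have "z = vquad 0 y 0 y" "vconcat y y \<in> R" by (auto simp: vec.zero)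
      then show "z \<in> ?h ` diagonal_part R" unfolding diagonal_part_def by blast
    qed
    then have "vec.dim (E \<inter> ?G) \<le> vec.dim (?h ` diagonal_part R)" by (rule vec.dim_subset)
    also have "\<dots> \<le> vec.dim (diagonal_part R)" by (rule vec.dim_image_le[OF h])
    finally show ?thesis .
  qed
  moreover have "vec.dim ?V + vec.dim (E \<inter> ?G) = vec.dim E + (vec.dim A + vec.dim R)"
    using dim_sum_Int[OF E(1) G(1)] dim_tied[OF A(1) R] by simp
  ultimately have I: "morse_pos_index (B P) Y + vec.dim E + morse_pos_index ?Q S + vec.dim R
      \<le> 3 * CARD('n) + vec.dim (diagonal_part R)"
    using A(4) by linarith

  \<comment> \<open>the lower bound; here the sum is direct\<close>
  let ?G' = "tied A' R"
  have G': "vec.subspace ?G'" "?G' \<subseteq> tied S R" using subspace_tied[OF A'(1) R] mono[OF A'(2)] by blast+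
  let ?V' = "{x + y |x y. x \<in> F \<and> y \<in> ?G'}"
  have "nonpos_on (\<lambda>x y. - B P x y) ?V'"
  proof
    fix z assume "z \<in> ?V'"
    then obtain x y where z: "z = x + y" "x \<in> F" "y \<in> ?G'" by blast
    then have xy: "x \<in> L P" "y \<in> tied S R" using F G' by blast+
    have "B P y x = 0" "B P x y = 0"
      using comparison_graph_WR[OF xy] form_sym[OF FB, of y x] by simp_all
    then have "Re (B P z z) = Re (B P x x) + Re (B P y y)"
      unfolding z by (simp add: form_add_left[OF FB] form_add_right[OF FB])
    moreover have "0 \<le> Re (B P x x)"
      using F(3) z(2) Bl[OF xy(1)] form_zero_left[OF FB, of 0] by (cases "x = 0") force+
    moreover have "Re (?Q (base y) (base y)) \<le> 0" using A'(3) base_mem[OF z(3)] by blast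
    then have "0 \<le> Re (B P y y)" using Bw[OF xy(2)] by simp
    ultimately show "Re (- B P z z) \<le> 0" by simp
  qed
  moreover have "?V' \<subseteq> Y"
  proof -
    have "F \<subseteq> Y" "?G' \<subseteq> Y" using F(2) G'(2) graph_subset_tied tiedY by blast+
    then show ?thesis using vec.subspace_add[OF subspace_tied_UNIV] by blast
  qed
  moreover have "vec.subspace ?V'" by (rule vec.subspace_sums[OF F(1) G'(1)])
  ultimately have "morse_pos_index (\<lambda>x y. - B P x y) Y + vec.dim ?V' \<le> 3 * CARD('n)"
    using morse_pos_index_add_nonpos_le[OF FB' subspace_tied_UNIV, of ?V'] unfolding dim_tied_UNIV by blast
  moreover have "F \<inter> ?G' \<subseteq> {0}"
  proof
    fix z assume z: "z \<in> F \<inter> ?G'"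
    then have zz: "z \<in> L P" "z \<in> tied S R" using F G' by blast+
    then have "Re (sform Jdiff (pw z) (z - pw z)) = 0" using LS[OF zz] Bl[OF zz(1)] by simp
    then show "z \<in> {0}" using F(3) z by fastforce
  qed
  then have "vec.dim ?V' = vec.dim F + (vec.dim A' + vec.dim R)"
    using dim_direct_sum[OF F(1) G'(1)] dim_tied[OF A'(1) R] by simp
  moreover have "vec.dim (L P) = 2 * CARD('n)" by (simp add: dim_mat_graph)
  ultimately have II: "morse_pos_index (\<lambda>x y. - B P x y) Y + vec.dim (diagonal_part R)
      \<le> vec.dim E + morse_pos_index ?Q S"
    using A'(4) dS dims by linarith
  have "morse_pos_index (B P) Y + morse_pos_index (\<lambda>x y. - B P x y) Y + vec.dim R = 3 * CARD('n)"
    using index_sum_eq_iff[OF P] trans by simp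
  with I II show ?thesis by linarith
qed

text \<open>
  Two comparison forms differ by \<open>- 2 ((P - P0) x, x')\<close>, which is small uniformly on the unit
  sphere.
\<close>

lemma comparison_indices_lower_semicontinuous:
  assumes P0: "selfadjoint P0"
  obtains c where "0 < c"
    and "\<forall>P. selfadjoint P \<longrightarrow> entry_sum (P - P0) < c \<longrightarrow>
      morse_pos_index (B P0) Y \<le> morse_pos_index (B P) Y \<and>
      morse_pos_index (\<lambda>x y. - B P0 x y) Y \<le> morse_pos_index (\<lambda>x y. - B P x y) Y"
proof -
  note F = herm_form_comparison[OF P0]
  obtain c where c: "0 < c" "\<And>b. herm_form b \<Longrightarrow> (\<And>x. \<bar>Re (b x x) - Re (B P0 x x)\<bar> \<le> c * (norm x)\<^sup>2) \<Longrightarrow>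
      morse_pos_index (B P0) Y \<le> morse_pos_index b Y"
    using morse_pos_index_lower_semicontinuous[OF F subspace_tied_UNIV] by blast
  obtain c' where c': "0 < c'" "\<And>b. herm_form b \<Longrightarrow> (\<And>x. \<bar>Re (b x x) - Re (- B P0 x x)\<bar> \<le> c' * (norm x)\<^sup>2) \<Longrightarrow>
      morse_pos_index (\<lambda>x y. - B P0 x y) Y \<le> morse_pos_index b Y"
    using morse_pos_index_lower_semicontinuous[OF herm_form_uminus[OF F] subspace_tied_UNIV] by blast
  \<comment> \<open>the factor \<open>2\<close> in front of \<open>P\<close> in the comparison form\<close>
  define d where "d = min c c' / 2"
  have d: "0 < d" "2 * d \<le> c" "2 * d \<le> c'" using c(1) c'(1) by (simp_all add: d_def)
  have "morse_pos_index (B P0) Y \<le> morse_pos_index (B P) Y \<and>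
      morse_pos_index (\<lambda>x y. - B P0 x y) Y \<le> morse_pos_index (\<lambda>x y. - B P x y) Y"
    if P: "selfadjoint P" and near: "entry_sum (P - P0) < d" for P
  proof -
    have close: "\<bar>Re (B P x x) - Re (B P0 x x)\<bar> \<le> 2 * d * (norm x)\<^sup>2" for x
    proof -
      have eq: "B P x x - B P0 x x = - 2 * herm ((P - P0) *v base x) (base x)"
        by (simp add: comparison_form_def matrix_vector_mult_diff_rdistrib herm_diff_left)
      have "\<bar>Re (B P x x) - Re (B P0 x x)\<bar> = 2 * \<bar>Re (herm ((P - P0) *v base x) (base x))\<bar>"
        using arg_cong[OF eq, of Re] by (simp add: abs_mult)
      also have "\<dots> \<le> 2 * cmod (herm ((P - P0) *v base x) (base x))"
        using abs_Re_le_cmod by simp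
      also have "\<dots> \<le> 2 * (d * (norm x)\<^sup>2)"
      proof (intro mult_left_mono)
        have "cmod (herm ((P - P0) *v base x) (base x)) \<le> entry_sum (P - P0) * (norm (base x))\<^sup>2"
          by (rule cmod_herm_le)
        also have "\<dots> \<le> d * (norm x)\<^sup>2"
          using near d(1) norm_base_le[of x] by (intro mult_mono power_mono) auto
        finally show "cmod (herm ((P - P0) *v base x) (base x)) \<le> d * (norm x)\<^sup>2" .
      qed simp
      finally show ?thesis by simp
    qed
    note FP = herm_form_comparison[OF P]
    have "2 * d * (norm x)\<^sup>2 \<le> c * (norm x)\<^sup>2" "2 * d * (norm x)\<^sup>2 \<le> c' * (norm x)\<^sup>2" for x :: "complex ^ (('n + 'n) + ('n + 'n))"
      using d by (intro mult_right_mono; simp)+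
    note le = order_trans[OF close this(1)] order_trans[OF close this(2)]
    have "morse_pos_index (B P0) Y \<le> morse_pos_index (B P) Y"
      by (rule c(2)[OF FP le(1)])
    moreover have "\<bar>Re (- B P x x) - Re (- B P0 x x)\<bar> \<le> c' * (norm x)\<^sup>2" for x
      using le(2)[of x] by (simp add: abs_minus_commute)
    then have "morse_pos_index (\<lambda>x y. - B P0 x y) Y \<le> morse_pos_index (\<lambda>x y. - B P x y) Y"
      by (rule c'(2)[OF herm_form_uminus[OF FP]])
    ultimately show ?thesis ..
  qed
  then show ?thesis using that d(1) by blast
qed

end

section \<open>Spectral flow along the path\<close>

lemma cis_neq_1: "0 < e \<Longrightarrow> e < pi \<Longrightarrow> cis e \<noteq> 1"
  using sin_gt_zero[of e] by (metis cis.simps(2) one_complex.simps(2) order_less_irrefl)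

lemma entry_sum_tendsto_0:
  assumes "continuous_on I P" "t0 \<in> I"
  shows "((\<lambda>t. entry_sum (P t - P t0)) \<longlongrightarrow> 0) (at t0 within I)"
proof -
  have "(P \<longlongrightarrow> P t0) (at t0 within I)"
    using assms by (simp add: continuous_on_def)
  then have "((\<lambda>t. \<Sum>i\<in>UNIV. \<Sum>j\<in>UNIV. cmod ((P t - P t0) $ i $ j)) \<longlongrightarrow>
      (\<Sum>i\<in>UNIV. \<Sum>j\<in>UNIV. cmod ((P t0 - P t0) $ i $ j))) (at t0 within I)"
    by (intro tendsto_intros)
  then show ?thesis by (simp add: entry_sum_def)
qed

lemma is_spectral_flow_refl: "is_spectral_flow X V a a 0"
  unfolding is_spectral_flow_def by (intro exI[of _ 0] exI[of _ "\<lambda>_. a"]) simp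

lemma is_spectral_flow_single:
  assumes "a < b" "0 < e" "e < pi" "\<And>t. t \<in> {a..b} \<Longrightarrow> eigenspace_on X (V t) (cis e) = {0}"
  shows "\<exists>k. is_spectral_flow X V a b k"
  unfolding is_spectral_flow_def
  by (rule exI, rule exI[of _ "Suc 0"], rule exI[of _ "\<lambda>j. if j = 0 then a else b"], rule exI[of _ "\<lambda>_. e"])
    (use assms in auto)

lemma is_spectral_flow_trans:
  assumes "is_spectral_flow X V a b k" "is_spectral_flow X V b c l"
  shows "is_spectral_flow X V a c (k + l)"
proof -
  let ?ok = "\<lambda>s s' e. s < s' \<and> 0 < e \<and> e < pi \<and> (\<forall>t\<in>{s..s'}. eigenspace_on X (V t) (cis e) = {0})"
  let ?d = "\<lambda>s s' e. int (eigenvalue_count X (V s') (cis ` {0..<e})) - int (eigenvalue_count X (V s) (cis ` {0..<e}))"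
  obtain N s e where 1: "s 0 = a" "s N = b" "\<forall>j<N. ?ok (s j) (s (Suc j)) (e j)" "k = (\<Sum>j<N. ?d (s j) (s (Suc j)) (e j))"
    using assms(1) unfolding is_spectral_flow_def by blast
  obtain M r f where 2: "r 0 = b" "r M = c" "\<forall>j<M. ?ok (r j) (r (Suc j)) (f j)" "l = (\<Sum>j<M. ?d (r j) (r (Suc j)) (f j))"
    using assms(2) unfolding is_spectral_flow_def by blast
  define q where "q j = (if j \<le> N then s j else r (j - N))" for j
  define g where "g j = (if j < N then e j else f (j - N))" for j
  have low: "q j = s j" "q (Suc j) = s (Suc j)" "g j = e j" if "j < N" for j
    using that by (simp_all add: q_def g_def)
  have high: "q (N + j) = r j" "q (Suc (N + j)) = r (Suc j)" "g (N + j) = f j" for j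
    using 1(2) 2(1) by (cases j; simp add: q_def g_def)+
  have "q 0 = a" using 1(1) by (simp add: q_def)
  moreover have "q (N + M) = c" using high(1)[of M] 2(2) by simp
  moreover have "?ok (q j) (q (Suc j)) (g j)" if "j < N + M" for j
  proof (cases "j < N")
    case True
    then show ?thesis unfolding low[OF True] using 1(3) by blast
  next
    case False
    define i where "i = j - N"
    have i: "j = N + i" "i < M" using that False by (auto simp: i_def)
    show ?thesis unfolding i(1) high using 2(3) i(2) by blast
  qed
  moreover have "k + l = (\<Sum>j<N + M. ?d (q j) (q (Suc j)) (g j))"
  proof -
    have "(\<Sum>j<N + M. ?d (q j) (q (Suc j)) (g j)) = (\<Sum>j<N. ?d (q j) (q (Suc j)) (g j)) + (\<Sum>j<M. ?d (q (N + j)) (q (Suc (N + j))) (g (N + j)))"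
      by (induction M) simp_all
    moreover have "(\<Sum>j<N. ?d (q j) (q (Suc j)) (g j)) = k"
      unfolding 1(4) by (rule sum.cong) (simp_all add: low)
    moreover have "(\<Sum>j<M. ?d (q (N + j)) (q (Suc (N + j))) (g (N + j))) = l"
      unfolding high 2(4) ..
    ultimately show ?thesis by simp
  qed
  ultimately show ?thesis
    unfolding is_spectral_flow_def by blast
qed

text \<open>
  Angles that avoid the eigenvalues can be chosen locally; the interval is compact, and adjacent
  subdivisions can be concatenated.
\<close>

lemma is_spectral_flow_exists:
  assumes ab: "a \<le> b"
    and local: "\<And>x. a \<le> x \<Longrightarrow> x \<le> b \<Longrightarrow> \<exists>e d. 0 < e \<and> e < pi \<and> 0 < d \<and>
      (\<forall>t\<in>{a..b}. \<bar>t - x\<bar> < d \<longrightarrow> eigenspace_on X (V t) (cis e) = {0})"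
  shows "\<exists>k. is_spectral_flow X V a b k"
proof -
  define Q where "Q c d \<longleftrightarrow> (a \<le> c \<longrightarrow> d \<le> b \<longrightarrow> c \<le> d \<longrightarrow> (\<exists>k. is_spectral_flow X V c d k))" for c d
  have "Q a b"
    using ab
  proof (induction rule: Bolzano)
    case (trans c d e)
    show ?case
      unfolding Q_def
    proof (intro impI)
      assume "a \<le> c" "e \<le> b" "c \<le> e"
      then obtain k l where "is_spectral_flow X V c d k" "is_spectral_flow X V d e l"
        using trans unfolding Q_def by fastforce
      then show "\<exists>k. is_spectral_flow X V c e k" using is_spectral_flow_trans by blast
    qed
  next
    case (local x)
    then obtain e d where ed: "0 < e" "e < pi" "0 < d"
      "\<And>t. t \<in> {a..b} \<Longrightarrow> \<bar>t - x\<bar> < d \<Longrightarrow> eigenspace_on X (V t) (cis e) = {0}"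
      using assms(2) by blast
    have "Q c c'" if "c \<le> x" "x \<le> c'" "c' - c < d" for c c'
      unfolding Q_def
    proof (intro impI)
      assume c: "a \<le> c" "c' \<le> b" "c \<le> c'"
      show "\<exists>k. is_spectral_flow X V c c' k"
      proof (cases "c = c'")
        case True
        then show ?thesis using is_spectral_flow_refl by blast
      next
        case False
        then have "c < c'" using c by simp
        then show ?thesis
          by (rule is_spectral_flow_single[OF _ ed(1,2)]) (rule ed(4), use c that in auto)
      qed
    qed
    then show ?case using ed(3) by blast
  qed
  then show ?thesis using ab by (simp add: Q_def)
qed

lemma spectral_flow_telescope:
  assumes flow: "is_spectral_flow X V a b k"
    and piece: "\<And>c d e. \<lbrakk>a \<le> c; c < d; d \<le> b; 0 < e; e < pi; \<forall>t\<in>{c..d}. eigenspace_on X (V t) (cis e) = {0}\<rbrakk> \<Longrightarrow>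
      int (eigenvalue_count X (V d) (cis ` {0..<e})) - int (eigenvalue_count X (V c) (cis ` {0..<e})) = m c - m d"
  shows "k = m a - m b"
proof -
  obtain N s e where s: "s 0 = a" "s N = b"
    "\<forall>j<N. s j < s (Suc j) \<and> 0 < e j \<and> e j < pi \<and> (\<forall>t\<in>{s j..s (Suc j)}. eigenspace_on X (V t) (cis (e j)) = {0})"
    "k = (\<Sum>j<N. int (eigenvalue_count X (V (s (Suc j))) (cis ` {0..<e j}))
                  - int (eigenvalue_count X (V (s j)) (cis ` {0..<e j})))"
    using flow unfolding is_spectral_flow_def by (elim exE conjE) (rule that)
  have up: "a \<le> s j" if "j \<le> N" for j
    using that
  proof (induction j)
    case (Suc j)
    then have "a \<le> s j" "s j < s (Suc j)" using s(3) by auto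
    then show ?case by linarith
  qed (simp add: s)
  have down: "s j \<le> b" if "j \<le> N" for j
    using that
  proof (induction rule: inc_induct)
    case (step n)
    then have "s (Suc n) \<le> b" "s n < s (Suc n)" using s(3) by auto
    then show ?case by linarith
  qed (simp add: s)
  have "k = (\<Sum>j<N. m (s j) - m (s (Suc j)))"
    unfolding s(4)
  proof (rule sum.cong[OF refl])
    fix j assume "j \<in> {..<N}"
    then have j: "j < N" by simp
    show "int (eigenvalue_count X (V (s (Suc j))) (cis ` {0..<e j}))
        - int (eigenvalue_count X (V (s j)) (cis ` {0..<e j})) = m (s j) - m (s (Suc j))"
      using s(3) j up[of j] down[of "Suc j"] by (intro piece) auto
  qed
  then show ?thesis using sum_lessThan_telescope'[of "\<lambda>j. m (s j)" N] by (simp only: s(1,2))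
qed

context
  fixes R :: "(complex ^ ('n::finite + 'n)) set"
    and P :: "real \<Rightarrow> complex ^ 'n ^ 'n"
    and G :: "real \<Rightarrow> (complex ^ (('n + 'n) + ('n + 'n))) set"
    and I :: "real set"
  assumes R: "vec.subspace R"
    and cont: "continuous_on I P"
    and sa: "\<And>t. t \<in> I \<Longrightarrow> selfadjoint (P t)"
    and G: "\<And>t. t \<in> I \<Longrightarrow> G t = mat_graph (shear (P t))"
begin

private abbreviation "Xp \<equiv> pos_part (Jdiff :: complex ^ (('n + 'n) + ('n + 'n)) ^ (('n + 'n) + ('n + 'n)))"
private abbreviation "rel t \<equiv> relative_unitary Jdiff (WR R) (G t)"
private abbreviation "m t \<equiv> morse_pos_index (\<lambda>x y. herm (P t *v x) y) (antidiagonal_part R)"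
private abbreviation "proj e \<equiv> rotation_proj Jdiff (WR R) (cis e)"
private abbreviation "posind e t \<equiv> morse_pos_index (comparison_form (proj e) (P t)) (tied UNIV UNIV)"
private abbreviation "negind e t \<equiv> morse_pos_index (\<lambda>x y. - comparison_form (proj e) (P t) x y) (tied UNIV UNIV)"

private lemmas K = complex_structure_Jdiff
private lemmas W = lagrangian_WR[OF R]

private lemma LG: "t \<in> I \<Longrightarrow> lagrangian Jdiff (G t)"
  using lagrangian_mat_graph_shear[OF sa] G by simp

lemma rotation_proj_facts:
  assumes e: "0 < e" "e < pi"
  shows "Vector_Spaces.linear (*s) (*s) (proj e)" "sform Jdiff (proj e z) (proj e z') = 0"
    "sform Jdiff (z - proj e z) (z' - proj e z') = 0" "proj e z \<in> WR R" "z \<in> WR R \<Longrightarrow> proj e z = z"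
    "t \<in> I \<Longrightarrow> eigenspace_on Xp (rel t) (cis e) = {0} \<longleftrightarrow> (\<forall>z\<in>mat_graph (shear (P t)). proj e z = 0 \<longrightarrow> z = 0)"
proof -
  have c: "cmod (cis e) = 1" "cis e \<noteq> 1" using cis_neq_1[OF e] by simp_all
  show "Vector_Spaces.linear (*s) (*s) (proj e)" by (rule linear_rotation_proj[OF K W c])
  show "sform Jdiff (proj e z) (proj e z') = 0" by (rule sform_rotation_proj[OF K W c])
  show "sform Jdiff (z - proj e z) (z' - proj e z') = 0" by (rule sform_rotation_complement[OF K W c])
  show "proj e z \<in> WR R" by (rule rotation_proj_mem[OF K W c])
  show "z \<in> WR R \<Longrightarrow> proj e z = z" using rotation_proj_id[OF K W c] by blast
  show "eigenspace_on Xp (rel t) (cis e) = {0} \<longleftrightarrow> (\<forall>z\<in>mat_graph (shear (P t)). proj e z = 0 \<longrightarrow> z = 0)" if "t \<in> I"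
    using no_eigenvalue_iff_transversal[OF K W c LG[OF that]] G[OF that] by simp
qed

text \<open>
  The right hand side is better suited to variation of \<open>t\<close>: it is the negative index of a form on
  a fixed space, depending continuously on \<open>t\<close>.
\<close>

lemma arc_count_identity:
  assumes e: "0 < e" "e < pi" and t: "t \<in> I" and noev: "eigenspace_on Xp (rel t) (cis e) = {0}"
  shows "eigenvalue_count Xp (rel t) (cis ` {0..<e}) + m t = negind e t + vec.dim (diagonal_part R)"
proof -
  note f = rotation_proj_facts[OF e]
  obtain E F where EF: "vec.subspace E" "vec.subspace F" "E \<subseteq> G t" "F \<subseteq> G t"
    "vec.dim E = eigenvalue_count Xp (rel t) (cis ` {0..<e})" "vec.dim E + vec.dim F = vec.dim (G t)"
    "\<forall>z\<in>E. Re (sform Jdiff (proj e z) (z - proj e z)) \<le> 0"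
    "\<forall>z\<in>F. z \<noteq> 0 \<longrightarrow> 0 < Re (sform Jdiff (proj e z) (z - proj e z))"
    by (rule eigenvalue_arc_split[OF K W LG[OF t] e noev])
  have trans: "\<forall>z\<in>mat_graph (shear (P t)). proj e z = 0 \<longrightarrow> z = 0"
    using f(6)[OF t] noev by simp
  show ?thesis
    using signature_identity[OF R f(1-5) sa[OF t] trans EF(1) EF(3)[unfolded G[OF t]] EF(7)
        EF(2) EF(4)[unfolded G[OF t]] EF(8) EF(6)[unfolded G[OF t]]] EF(5) by simp
qed

text \<open>
  Both indices of the comparison form are lower semicontinuous.  At \<open>t0\<close> their sum has the
  greatest value that it can take at all, so neither can jump up; and as long as the sum
  keeps this value, \<open>cis e\<close> is not an eigenvalue.
\<close>

lemma arc_end_locally_constant: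
  assumes e: "0 < e" "e < pi" and t0: "t0 \<in> I" and noev: "eigenspace_on Xp (rel t0) (cis e) = {0}"
  shows "\<forall>\<^sub>F t in at t0 within I. eigenspace_on Xp (rel t) (cis e) = {0} \<and> negind e t = negind e t0"
proof -
  note f = rotation_proj_facts[OF e]
  obtain c where c: "0 < c" "\<forall>Q. selfadjoint Q \<longrightarrow> entry_sum (Q - P t0) < c \<longrightarrow>
      posind e t0 \<le> morse_pos_index (comparison_form (proj e) Q) (tied UNIV UNIV) \<and>
      negind e t0 \<le> morse_pos_index (\<lambda>x y. - comparison_form (proj e) Q x y) (tied UNIV UNIV)"
    by (rule comparison_indices_lower_semicontinuous[OF R f(1-5) sa[OF t0]])
  have sum0: "posind e t0 + negind e t0 + vec.dim R = 3 * CARD('n)"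
    using index_sum_eq_iff[OF R f(1-5) sa[OF t0]] f(6)[OF t0] noev by simp
  have "\<forall>\<^sub>F t in at t0 within I. entry_sum (P t - P t0) < c"
    using order_tendstoD(2)[OF entry_sum_tendsto_0[OF cont t0] c(1)] .
  moreover have "\<forall>\<^sub>F t in at t0 within I. t \<in> I"
    by (simp add: eventually_at_filter)
  ultimately show ?thesis
  proof eventually_elim
    case (elim t)
    then have le: "posind e t0 \<le> posind e t" "negind e t0 \<le> negind e t" using c(2) sa by blast+
    have "posind e t + negind e t + vec.dim R \<le> 3 * CARD('n)"
      by (rule index_sum_le[OF R f(1-5) sa[OF elim(2)]])
    then have eq: "posind e t + negind e t + vec.dim R = 3 * CARD('n)" "negind e t = negind e t0" using le sum0 by linarith+
    then show ?case
      using index_sum_eq_iff[OF R f(1-5) sa[OF elim(2)]] f(6)[OF elim(2)] by simp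
  qed
qed

lemma arc_count_piece:
  assumes e: "0 < e" "e < pi" and cd: "c \<le> d" "{c..d} \<subseteq> I"
    and noev: "\<forall>t\<in>{c..d}. eigenspace_on Xp (rel t) (cis e) = {0}"
  shows "int (eigenvalue_count Xp (rel d) (cis ` {0..<e})) - int (eigenvalue_count Xp (rel c) (cis ` {0..<e}))
    = int (m c) - int (m d)"
proof -
  have "negind e c = negind e d"
  proof (rule connected_local_const[of "{c..d}"])
    show "\<forall>t\<in>{c..d}. \<forall>\<^sub>F u in at t within {c..d}. negind e t = negind e u"
    proof
      fix t assume t: "t \<in> {c..d}"
      then have tI: "t \<in> I" using cd by blast
      have "\<forall>\<^sub>F u in at t within I. negind e t = negind e u"
        using arc_end_locally_constant[OF e tI] noev t by (auto elim: eventually_mono)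
      then show "\<forall>\<^sub>F u in at t within {c..d}. negind e t = negind e u"
        using cd(2) at_le filter_leD by blast
    qed
  qed (use cd in auto)
  moreover have "c \<in> I" "d \<in> I" "c \<in> {c..d}" "d \<in> {c..d}" using cd by auto
  ultimately show ?thesis
    using arc_count_identity[OF e \<open>c \<in> I\<close>] arc_count_identity[OF e \<open>d \<in> I\<close>] noev by fastforce
qed

lemma free_angle_exists:
  assumes t: "t \<in> I"
  obtains e where "0 < e" "e < pi" "eigenspace_on Xp (rel t) (cis e) = {0}"
proof -
  \<comment> \<open>any unit number other than \<open>1\<close> serves as rotation number\<close>
  have "cmod (cis (pi / 2)) = 1" "cis (pi / 2) \<noteq> 1" using cis_neq_1[of "pi / 2"] by simp_all
  then have "unitary_iso Xp Xp (rel t)" by (rule unitary_relative[OF K W _ _ LG[OF t]])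
  then have fin: "finite {z. eigenspace_on Xp (rel t) z \<noteq> {0}}" (is "finite ?Z")
    by (rule finite_eigenvalues[OF subspace_pos_part])
  have "inj_on cis {0<..<pi}"
  proof (rule inj_onI)
    fix x y :: real assume "x \<in> {0<..<pi}" "y \<in> {0<..<pi}" "cis x = cis y"
    then show "x = y" using cos_inj_pi[of x y] by (metis cis.simps(1) greaterThanLessThan_iff less_imp_le)
  qed
  then have "finite (cis -` ?Z \<inter> {0<..<pi})" by (rule finite_vimage_IntI[OF fin])
  moreover have "infinite {0<..<pi}" by (simp add: infinite_Ioo)
  ultimately have "\<not> {0<..<pi} \<subseteq> cis -` ?Z" by (metis Int_absorb1)
  then show ?thesis using that by auto
qed

end

text \<open>
  On every piece of a subdivision the arc count plus the Morse index is constant, so the sum over any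
  subdivision telescopes.  This gives both the value and its independence of the
  subdivision.
\<close>

lemma spectral_flow_shear:
  fixes R :: "(complex ^ ('n::finite + 'n)) set"
    and P :: "real \<Rightarrow> complex ^ 'n ^ 'n"
  assumes T: "a \<le> b" and R: "vec.subspace R" and cont: "continuous_on {a..b} P"
    and sa: "\<And>t. t \<in> {a..b} \<Longrightarrow> selfadjoint (P t)"
    and G: "\<And>t. t \<in> {a..b} \<Longrightarrow> G t = mat_graph (shear (P t))"
  defines "m \<equiv> \<lambda>t. int (morse_pos_index (\<lambda>x y. herm (P t *v x) y) (antidiagonal_part R))"
  shows "spectral_flow (pos_part Jdiff) (\<lambda>t. relative_unitary Jdiff (WR R) (G t)) a b = m a - m b"
proof -
  let ?X = "pos_part (Jdiff :: complex ^ (('n + 'n) + ('n + 'n)) ^ (('n + 'n) + ('n + 'n)))"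
  let ?V = "\<lambda>t. relative_unitary Jdiff (WR R) (G t)"
  note ctx = R cont sa G
  have flow_value: "k = m a - m b" if "is_spectral_flow ?X ?V a b k" for k
  proof (rule spectral_flow_telescope[OF that])
    fix c d e :: real
    assume "a \<le> c" "c < d" "d \<le> b" "0 < e" "e < pi" "\<forall>t\<in>{c..d}. eigenspace_on ?X (?V t) (cis e) = {0}"
    then show "int (eigenvalue_count ?X (?V d) (cis ` {0..<e})) - int (eigenvalue_count ?X (?V c) (cis ` {0..<e})) = m c - m d"
      unfolding m_def by (intro arc_count_piece[OF ctx]) auto
  qed
  have "\<exists>k. is_spectral_flow ?X ?V a b k"
  proof (rule is_spectral_flow_exists[OF T])
    fix x assume "a \<le> x" "x \<le> b"
    then have x: "x \<in> {a..b}" by simp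
    obtain e where e: "0 < e" "e < pi" "eigenspace_on ?X (?V x) (cis e) = {0}"
      by (rule free_angle_exists[OF ctx x])
    have "\<forall>\<^sub>F t in at x within {a..b}. eigenspace_on ?X (?V t) (cis e) = {0}"
      by (rule eventually_mono[OF arc_end_locally_constant[OF ctx e(1,2) x e(3)]]) simp_all
    then obtain d where d: "0 < d" "\<forall>t\<in>{a..b}. t \<noteq> x \<and> dist t x < d \<longrightarrow> eigenspace_on ?X (?V t) (cis e) = {0}"
      unfolding eventually_at by blast
    have "\<forall>t\<in>{a..b}. \<bar>t - x\<bar> < d \<longrightarrow> eigenspace_on ?X (?V t) (cis e) = {0}"
    proof (intro ballI impI)
      fix t assume "t \<in> {a..b}" "\<bar>t - x\<bar> < d"
      then show "eigenspace_on ?X (?V t) (cis e) = {0}"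
        using d(2) e(3) by (cases "t = x") (auto simp: dist_real_def)
    qed
    then show "\<exists>e d. 0 < e \<and> e < pi \<and> 0 < d \<and>
      (\<forall>t\<in>{a..b}. \<bar>t - x\<bar> < d \<longrightarrow> eigenspace_on ?X (?V t) (cis e) = {0})"
      using e d(1) by blast
  qed
  then obtain k where "is_spectral_flow ?X ?V a b k" by blast
  then have "is_spectral_flow ?X ?V a b (m a - m b)" using flow_value by metis
  then show ?thesis
    unfolding spectral_flow_def using flow_value by (rule the_equality)
qed

theorem theorem1p2:
  fixes R :: "(complex ^ ('n::finite + 'n)) set"
    and P :: "real \<Rightarrow> complex ^ 'n ^ 'n"
    and \<gamma> :: "real \<Rightarrow> complex ^ ('n + 'n) ^ ('n + 'n)"
    and S :: "(complex ^ 'n) set"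
    and T :: real
  assumes "0 < T"
    and "vec.subspace R"
    and "continuous_on {0..T} P"
    and "\<And>t. t \<in> {0..T} \<Longrightarrow> selfadjoint (P t)"
    and "\<And>t. t \<in> {0..T} \<Longrightarrow> \<gamma> t = block_mat (mat 1) 0 (P t) (mat 1)"
    and "S = {x. vconcat x x \<in> Rb R}"
  shows "maslov_type_index (WR R) \<gamma> 0 T =
           int (morse_pos_index (\<lambda>x y. herm (P T *v x) y) S)
         - int (morse_pos_index (\<lambda>x y. herm (P 0 *v x) y) S)"
proof -
  have "maslov_type_index (WR R) \<gamma> 0 T
      = - spectral_flow (pos_part Jdiff) (\<lambda>t. relative_unitary Jdiff (WR R) (mat_graph (\<gamma> t))) 0 T"
    unfolding maslov_type_index_def maslov_index_def relative_unitary_def[abs_def] ..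
  also have "\<dots> = - (int (morse_pos_index (\<lambda>x y. herm (P 0 *v x) y) (antidiagonal_part R))
      - int (morse_pos_index (\<lambda>x y. herm (P T *v x) y) (antidiagonal_part R)))"
    using assms(1-5) by (subst spectral_flow_shear) (auto simp: shear_def)
  finally show ?thesis unfolding assms(6) antidiagonal_part_eq by simp
qed

end
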